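(* Let $P$ be a smooth manifold and let $L\subset TP\oplus T^*P$ be a regular almost Dirac structure such that $\mathrm{pr}_1(L)\subset TP$ is an integrable distribution on $P$. Then there exists an exact 3-form $\phi$ on $P$ with respect to which $L$ is a $\phi$-twisted Dirac structure.
   Context: An almost Dirac structure on $P$ is a subbundle $L\subset TP\oplus T^*P$ that is maximal isotropic for the pairing $\langle(X,\alpha),(Y,\beta)\rangle=\alpha(Y)+\beta(X)$; it is regular if $\mathrm{pr}_1(L)\subset TP$ has constant rank ($\mathrm{pr}_1$ is the projection to $TP$). For a closed 3-form $\phi$, the $\phi$-twisted Courant bracket is $[\![(X,\alpha),(Y,\beta)]\!]_\phi=([X,Y],\mathcal{L}_X\beta-\mathbf{i}_Yd\alpha+\mathbf{i}_{X\wedge Y}\phi)$ on $\Gamma(TP\oplus T^*P)$, where $\mathbf{i}_{X\wedge Y}\phi=\phi(X,Y,\cdot)$. A $\phi$-twisted Dirac structure is a maximal isotropic subbundle $L$ with $[\![\Gamma(L),\Gamma(L)]\!]_\phi\subseteq\Gamma(L)$. *)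

theory Defs
  imports "HOL-Analysis.Analysis"
begin

section \<open>Smooth maps\<close>

primrec Ck_on :: "nat \<Rightarrow> 'b::real_normed_vector set \<Rightarrow> ('b \<Rightarrow> 'c::real_normed_vector) \<Rightarrow> bool" where
  "Ck_on 0 S f \<longleftrightarrow> continuous_on S f"
| "Ck_on (Suc k) S f \<longleftrightarrow>
     (\<forall>x\<in>S. f differentiable (at x)) \<and> (\<forall>v. Ck_on k S (\<lambda>x. frechet_derivative f (at x) v))"

text \<open>Used only for open \<open>S\<close> in a finite-dimensional space, where continuity of all iterated
  directional derivatives is the usual notion of smoothness.\<close>

definition smooth_on :: "'b::real_normed_vector set \<Rightarrow> ('b \<Rightarrow> 'c::real_normed_vector) \<Rightarrow> bool" where
  "smooth_on S f \<longleftrightarrow> (\<forall>k. Ck_on k S f)"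

section \<open>Smooth manifolds\<close>

text \<open>A chart is a pair of its domain and its coordinate map; the values of the coordinate map
  outside the domain are irrelevant. The underlying space of the manifold is the whole type
  \<open>'a\<close>. The model space \<open>'b\<close> is an inner product space, required below to be finite-dimensional.
  It plays the role of $\mathbb{R}^n$; the class \<open>euclidean_space\<close> is not used because it
  excludes \<open>n = 0\<close>.\<close>

type_synonym ('a, 'b) chart = "'a set \<times> ('a \<Rightarrow> 'b)"

abbreviation dom_of :: "('a, 'b) chart \<Rightarrow> 'a set" where
  "dom_of c \<equiv> fst c"

abbreviation coord :: "('a, 'b) chart \<Rightarrow> 'a \<Rightarrow> 'b" where
  "coord c \<equiv> snd c"

definition param :: "('a, 'b) chart \<Rightarrow> 'b \<Rightarrow> 'a" where
  "param c = inv_into (dom_of c) (coord c)"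

definition is_chart :: "('a::topological_space, 'b::real_inner) chart \<Rightarrow> bool" where
  "is_chart c \<longleftrightarrow> open (dom_of c) \<and> open (coord c ` dom_of c) \<and>
     homeomorphism (dom_of c) (coord c ` dom_of c) (coord c) (param c)"

definition smooth_transition ::
    "('a, 'b::real_inner) chart \<Rightarrow> ('a, 'b) chart \<Rightarrow> bool" where
  "smooth_transition c c' \<longleftrightarrow>
     smooth_on (coord c ` (dom_of c \<inter> dom_of c')) (coord c' \<circ> param c)"

definition smooth_manifold ::
    "('a::{t2_space,second_countable_topology}, 'b::real_inner) chart set \<Rightarrow> bool" where
  "smooth_manifold A \<longleftrightarrow>
     (\<exists>B::'b set. finite B \<and> span B = UNIV) \<and>
     (\<forall>c\<in>A. is_chart c) \<and>
     (\<Union>c\<in>A. dom_of c) = UNIV \<and>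
     (\<forall>c\<in>A. \<forall>c'\<in>A. smooth_transition c c')"

text \<open>The charts of the maximal atlas determined by \<open>A\<close>.\<close>

definition compatible_chart ::
    "('a::topological_space, 'b::real_inner) chart set \<Rightarrow> ('a, 'b) chart \<Rightarrow> bool" where
  "compatible_chart A c \<longleftrightarrow>
     is_chart c \<and> (\<forall>c'\<in>A. smooth_transition c c' \<and> smooth_transition c' c)"

section \<open>Tangent vectors, covectors and forms\<close>

text \<open>The tangent space at \<open>p\<close> is the model space \<open>'b\<close>: a vector \<open>v\<close> stands for the tangent
  vector whose coordinates in the chosen chart \<open>chart_at A p\<close> are \<open>v\<close>. The function
  \<open>dchart A c p\<close> is then the differential at \<open>p\<close> of the chart \<open>c\<close>, that is, it sends a tangent
  vector at \<open>p\<close> to its coordinates in \<open>c\<close>, and \<open>dparam A c p\<close> is its inverse. Since the choice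
  of \<open>chart_at A p\<close> does not depend continuously on \<open>p\<close>, smoothness and derivatives of fields
  are always taken after passing to the coordinates of a single chart
  (\<open>vec_rep\<close>, \<open>form_rep\<close>).\<close>

definition chart_at :: "('a, 'b) chart set \<Rightarrow> 'a \<Rightarrow> ('a, 'b) chart" where
  "chart_at A p = (SOME c. c \<in> A \<and> p \<in> dom_of c)"

definition dchart ::
    "('a, 'b::real_inner) chart set \<Rightarrow> ('a, 'b) chart \<Rightarrow> 'a \<Rightarrow> 'b \<Rightarrow> 'b" where
  "dchart A c p = frechet_derivative (coord c \<circ> param (chart_at A p)) (at (coord (chart_at A p) p))"

definition dparam ::
    "('a, 'b::real_inner) chart set \<Rightarrow> ('a, 'b) chart \<Rightarrow> 'a \<Rightarrow> 'b \<Rightarrow> 'b" where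
  "dparam A c p = frechet_derivative (coord (chart_at A p) \<circ> param c) (at (coord c p))"

definition vec_rep ::
    "('a, 'b::real_inner) chart set \<Rightarrow> ('a, 'b) chart \<Rightarrow> ('a \<Rightarrow> 'b) \<Rightarrow> 'b \<Rightarrow> 'b" where
  "vec_rep A c X x = dchart A c (param c x) (X (param c x))"

definition smooth_vec_on ::
    "('a, 'b::real_inner) chart set \<Rightarrow> 'a set \<Rightarrow> ('a \<Rightarrow> 'b) \<Rightarrow> bool" where
  "smooth_vec_on A U X \<longleftrightarrow> (\<forall>c\<in>A. smooth_on (coord c ` (dom_of c \<inter> U)) (vec_rep A c X))"

text \<open>A differential form of degree \<open>k\<close> assigns to every point a function on lists of tangent
  vectors; only its values on lists of length \<open>k\<close> are relevant.\<close>

type_synonym ('a, 'b) form = "'a \<Rightarrow> 'b list \<Rightarrow> real"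

definition alternating_multilinear :: "nat \<Rightarrow> ('b::real_vector list \<Rightarrow> real) \<Rightarrow> bool" where
  "alternating_multilinear k \<mu> \<longleftrightarrow> (\<forall>vs. length vs = k \<longrightarrow>
     (\<forall>i<k. linear (\<lambda>v. \<mu> (vs[i := v]))) \<and>
     (\<forall>i<k. \<forall>j<k. i \<noteq> j \<and> vs ! i = vs ! j \<longrightarrow> \<mu> vs = 0))"

definition form_rep ::
    "('a, 'b::real_inner) chart set \<Rightarrow> ('a, 'b) chart \<Rightarrow> ('a, 'b) form \<Rightarrow> 'b \<Rightarrow> 'b list \<Rightarrow> real" where
  "form_rep A c \<omega> x vs = \<omega> (param c x) (map (dparam A c (param c x)) vs)"

definition smooth_form_on ::
    "('a, 'b::real_inner) chart set \<Rightarrow> nat \<Rightarrow> 'a set \<Rightarrow> ('a, 'b) form \<Rightarrow> bool" where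
  "smooth_form_on A k U \<omega> \<longleftrightarrow> (\<forall>c\<in>A. \<forall>vs. length vs = k \<longrightarrow>
     smooth_on (coord c ` (dom_of c \<inter> U)) (\<lambda>x. form_rep A c \<omega> x vs))"

definition differential_form ::
    "('a, 'b::real_inner) chart set \<Rightarrow> nat \<Rightarrow> ('a, 'b) form \<Rightarrow> bool" where
  "differential_form A k \<omega> \<longleftrightarrow>
     (\<forall>p. alternating_multilinear k (\<omega> p)) \<and> smooth_form_on A k UNIV \<omega>"

text \<open>The coordinate formula
  $d\omega(v_0,\dots,v_k) = \sum_i (-1)^i\, (D_{v_i}\omega)(v_0,\dots,\widehat{v_i},\dots,v_k)$.\<close>

definition ext_deriv ::
    "('a, 'b::real_inner) chart set \<Rightarrow> ('a, 'b) form \<Rightarrow> ('a, 'b) form" where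
  "ext_deriv A \<omega> p vs = (let c = chart_at A p in
     \<Sum>i<length vs. (- 1) ^ i *
       frechet_derivative (\<lambda>x. form_rep A c \<omega> x (take i vs @ drop (Suc i) vs))
         (at (coord c p)) (vs ! i))"

definition closed_form ::
    "('a, 'b::real_inner) chart set \<Rightarrow> nat \<Rightarrow> ('a, 'b) form \<Rightarrow> bool" where
  "closed_form A k \<omega> \<longleftrightarrow> differential_form A k \<omega> \<and>
     (\<forall>p vs. length vs = Suc k \<longrightarrow> ext_deriv A \<omega> p vs = 0)"

definition exact_form ::
    "('a, 'b::real_inner) chart set \<Rightarrow> nat \<Rightarrow> ('a, 'b) form \<Rightarrow> bool" where
  "exact_form A k \<phi> \<longleftrightarrow> differential_form A k \<phi> \<and>
     (\<exists>j \<omega>. k = Suc j \<and> differential_form A j \<omega> \<and>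
        (\<forall>p vs. length vs = k \<longrightarrow> \<phi> p vs = ext_deriv A \<omega> p vs))"

text \<open>In coordinates, $[X,Y] = DY(X) - DX(Y)$.\<close>

definition lie_bracket ::
    "('a, 'b::real_inner) chart set \<Rightarrow> ('a \<Rightarrow> 'b) \<Rightarrow> ('a \<Rightarrow> 'b) \<Rightarrow> 'a \<Rightarrow> 'b" where
  "lie_bracket A X Y p = (let c = chart_at A p in
     frechet_derivative (vec_rep A c Y) (at (coord c p)) (X p)
     - frechet_derivative (vec_rep A c X) (at (coord c p)) (Y p))"

text \<open>Since \<open>'b\<close> is finite-dimensional, \<open>'b \<Rightarrow>\<^sub>L real\<close> is its full dual, that is, the cotangent
  space.\<close>

definition form_of_covec :: "('a \<Rightarrow> 'b::real_inner \<Rightarrow>\<^sub>L real) \<Rightarrow> ('a, 'b) form" where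
  "form_of_covec \<alpha> p vs = blinfun_apply (\<alpha> p) (vs ! 0)"

text \<open>In coordinates, $(\mathcal{L}_X\beta)_i = X^j \partial_j \beta_i + \beta_j \partial_i X^j$.\<close>

definition lie_deriv_covec ::
    "('a, 'b::real_inner) chart set \<Rightarrow> ('a \<Rightarrow> 'b) \<Rightarrow> ('a \<Rightarrow> 'b \<Rightarrow>\<^sub>L real) \<Rightarrow> 'a \<Rightarrow> 'b \<Rightarrow> real" where
  "lie_deriv_covec A X \<beta> p v = (let c = chart_at A p in
     frechet_derivative (\<lambda>x. form_rep A c (form_of_covec \<beta>) x [v]) (at (coord c p)) (X p)
     + blinfun_apply (\<beta> p) (frechet_derivative (vec_rep A c X) (at (coord c p)) v))"

section \<open>The bundle $TP \oplus T^*P$\<close>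

type_synonym 'b gen_vec = "'b \<times> ('b \<Rightarrow>\<^sub>L real)"

definition smooth_section_on ::
    "('a, 'b::real_inner) chart set \<Rightarrow> 'a set \<Rightarrow> ('a \<Rightarrow> 'b gen_vec) \<Rightarrow> bool" where
  "smooth_section_on A U s \<longleftrightarrow>
     smooth_vec_on A U (fst \<circ> s) \<and> smooth_form_on A 1 U (form_of_covec (snd \<circ> s))"

text \<open>A family of subspaces of the fibres that locally is spanned by a smooth frame.\<close>

definition subbundle ::
    "('a::topological_space, 'b::real_inner) chart set \<Rightarrow> ('a \<Rightarrow> 'b gen_vec set) \<Rightarrow> bool" where
  "subbundle A L \<longleftrightarrow> (\<exists>r. \<forall>p. \<exists>U (e :: nat \<Rightarrow> 'a \<Rightarrow> 'b gen_vec).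
     open U \<and> p \<in> U \<and> (\<forall>i<r. smooth_section_on A U (e i)) \<and>
     (\<forall>q\<in>U. inj_on (\<lambda>i. e i q) {..<r} \<and> independent ((\<lambda>i. e i q) ` {..<r}) \<and>
            span ((\<lambda>i. e i q) ` {..<r}) = L q))"

definition pairing :: "'b::real_inner gen_vec \<Rightarrow> 'b gen_vec \<Rightarrow> real" where
  "pairing a b = blinfun_apply (snd a) (fst b) + blinfun_apply (snd b) (fst a)"

definition isotropic :: "'b::real_inner gen_vec set \<Rightarrow> bool" where
  "isotropic V \<longleftrightarrow> subspace V \<and> (\<forall>a\<in>V. \<forall>b\<in>V. pairing a b = 0)"

definition maximal_isotropic :: "'b::real_inner gen_vec set \<Rightarrow> bool" where
  "maximal_isotropic V \<longleftrightarrow> isotropic V \<and> (\<forall>W. isotropic W \<and> V \<subseteq> W \<longrightarrow> W = V)"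

definition almost_dirac ::
    "('a::topological_space, 'b::real_inner) chart set \<Rightarrow> ('a \<Rightarrow> 'b gen_vec set) \<Rightarrow> bool" where
  "almost_dirac A L \<longleftrightarrow> subbundle A L \<and> (\<forall>p. maximal_isotropic (L p))"

definition pr1 :: "('a \<Rightarrow> 'b::real_inner gen_vec set) \<Rightarrow> 'a \<Rightarrow> 'b set" where
  "pr1 L p = fst ` L p"

definition regular :: "('a \<Rightarrow> 'b::real_inner gen_vec set) \<Rightarrow> bool" where
  "regular L \<longleftrightarrow> (\<exists>k. \<forall>p. dim (pr1 L p) = k)"

definition sections ::
    "('a, 'b::real_inner) chart set \<Rightarrow> ('a \<Rightarrow> 'b gen_vec set) \<Rightarrow> ('a \<Rightarrow> 'b gen_vec) set" where
  "sections A L = {s. smooth_section_on A UNIV s \<and> (\<forall>p. s p \<in> L p)}"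

definition courant_bracket ::
    "('a, 'b::real_inner) chart set \<Rightarrow> ('a, 'b) form \<Rightarrow>
     ('a \<Rightarrow> 'b gen_vec) \<Rightarrow> ('a \<Rightarrow> 'b gen_vec) \<Rightarrow> 'a \<Rightarrow> 'b gen_vec" where
  "courant_bracket A \<phi> s t p =
     (let X = fst \<circ> s; \<alpha> = snd \<circ> s; Y = fst \<circ> t; \<beta> = snd \<circ> t in
       (lie_bracket A X Y p,
        Blinfun (\<lambda>v. lie_deriv_covec A X \<beta> p v
                   - ext_deriv A (form_of_covec \<alpha>) p [Y p, v]
                   + \<phi> p [X p, Y p, v])))"

definition twisted_dirac ::
    "('a::topological_space, 'b::real_inner) chart set \<Rightarrow> ('a, 'b) form \<Rightarrow>
     ('a \<Rightarrow> 'b gen_vec set) \<Rightarrow> bool" where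
  "twisted_dirac A \<phi> L \<longleftrightarrow> closed_form A 3 \<phi> \<and> almost_dirac A L \<and>
     (\<forall>s\<in>sections A L. \<forall>t\<in>sections A L. courant_bracket A \<phi> s t \<in> sections A L)"

section \<open>Integrable distributions\<close>

text \<open>\<open>N\<close> is an embedded submanifold (each of its points has a slice chart \<open>c\<close> in which \<open>N\<close> is a
  linear subspace \<open>W\<close>), and its tangent space at every point, which in the slice chart is
  \<open>W\<close>, equals \<open>D\<close>. An immersed integral manifold is locally embedded, so for the existence of
  an integral manifold through a point it makes no difference which kind is used.\<close>

definition integral_manifold ::
    "('a::topological_space, 'b::real_inner) chart set \<Rightarrow> ('a \<Rightarrow> 'b set) \<Rightarrow> 'a set \<Rightarrow> bool" where
  "integral_manifold A D N \<longleftrightarrow> (\<forall>p\<in>N. \<exists>c W.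
     compatible_chart A c \<and> p \<in> dom_of c \<and> subspace W \<and>
     coord c ` (dom_of c \<inter> N) = coord c ` dom_of c \<inter> W \<and>
     (\<forall>q\<in>dom_of c \<inter> N. dchart A c q ` D q = W))"

definition integrable_distribution ::
    "('a::topological_space, 'b::real_inner) chart set \<Rightarrow> ('a \<Rightarrow> 'b set) \<Rightarrow> bool" where
  "integrable_distribution A D \<longleftrightarrow> (\<forall>p. \<exists>N. p \<in> N \<and> integral_manifold A D N)"

end

theory Submission
  imports Defs
begin

text \<open>On the distribution \<open>D = pr1 L\<close> the structure \<open>L\<close> determines a 2-form, sending \<open>(x, y)\<close> to \<open>\<xi> y\<close> for any
  \<open>(x, \<xi>)\<close> in \<open>L\<close>. Since \<open>D\<close> has constant rank this 2-form is smooth and extends to a global form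
  \<open>\<omega>\<close>: locally by an orthogonal frame of \<open>D\<close>, globally by cutoff functions. Maximality of \<open>L\<close>
  then says that \<open>(x, \<xi>)\<close> is in \<open>L\<close> exactly if \<open>x\<close> is in \<open>D\<close> and \<open>\<xi>\<close> agrees with the contraction of \<open>\<omega>\<close> by
  \<open>x\<close> on \<open>D\<close>. Twisting by \<open>\<phi> = d (- \<omega>)\<close> cancels the term by which Cartan calculus makes such pairs
  fail to be closed under the bracket, and what remains vanishes because \<open>D\<close> is involutive.
  Involutivity comes from the slice charts: along the slice \<open>W\<close> the fields of \<open>D\<close> take values in \<open>W\<close>,
  hence so do their derivatives in directions of \<open>W\<close>.\<close>

section \<open>Smooth functions\<close>

text \<open>If the covectors were exactly the contractions of \<omega>, Cartan calculus would turn
  the untwisted bracket covector into the contraction of \<omega> by [X,Y] plus d\<omega>(X,Y,.), so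
  d(-\<omega>) is the twist that removes the excess. The obstacle is that they agree with the
  contractions only along D, while the bracket differentiates them. The remedy is to evaluate on a
  field Z of D: by maximality such values decide membership in L, and the defining relations,
  differentiated along X, Y and Z only, contain all that is needed. Z extends to a section of L only
  near a point, so involutivity is required for local fields. The frame of D consists of anchors of
  sections of L, so that the values of the 2-form on it are smooth coefficients; being orthogonal,
  it has a dual coframe given by quotients of inner products, defined on all of TP. Tangent vectors
  at p are read in a chart that depends on p without continuity. Hence each operator must also be
  shown to obey the same coordinate formula in every chart; symmetry of second derivatives is what
  makes this true.\<close>

abbreviation fd :: "('b::real_normed_vector \<Rightarrow> 'c::real_normed_vector) \<Rightarrow> 'b \<Rightarrow> 'b \<Rightarrow> 'c" where
  "fd f x \<equiv> frechet_derivative f (at x)"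

lemma fd_eq: "(f has_derivative f') (at x) \<Longrightarrow> fd f x = f'"
  using frechet_derivative_at by metis

lemma fd_transform:
  "f differentiable at x \<Longrightarrow> open X \<Longrightarrow> x \<in> X \<Longrightarrow> (\<And>y. y \<in> X \<Longrightarrow> f y = g y) \<Longrightarrow> fd f x = fd g x"
  by (rule frechet_derivative_transform_within_open)

lemma differentiable_transform_open:
  assumes "f differentiable at x" "open X" "x \<in> X" "\<And>y. y \<in> X \<Longrightarrow> f y = g y"
  shows "g differentiable at x"
proof -
  obtain f' where "(f has_derivative f') (at x)"
    using assms(1) unfolding differentiable_def by blast
  then have "(g has_derivative f') (at x)"
    by (rule has_derivative_transform_within_open) (use assms in auto)
  then show ?thesis by (rule differentiableI)
qed

lemma Ck_on_subset: "Ck_on k S f \<Longrightarrow> T \<subseteq> S \<Longrightarrow> Ck_on k T f"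
proof (induction k arbitrary: f)
  case 0
  then show ?case by (simp add: continuous_on_subset)
next
  case (Suc k)
  then have "Ck_on k T (\<lambda>x. fd f x v)" for v
    by (intro Suc.IH) auto
  then show ?case using Suc.prems by auto
qed

lemma Ck_on_Suc: "Ck_on (Suc k) S f \<Longrightarrow> Ck_on k S f"
proof (induction k arbitrary: f)
  case 0
  then show ?case
    by (auto intro!: continuous_at_imp_continuous_on differentiable_imp_continuous_within)
next
  case (Suc k)
  have "Ck_on k S (\<lambda>x. fd f x v)" for v
    by (rule Suc.IH) (use Suc.prems in simp)
  then show ?case using Suc.prems by simp
qed

text \<open>Openness of \<open>S\<close> lets a derivative at a point of \<open>S\<close> depend on
  the values in \<open>S\<close> alone. This is why most of the calculus rules below carry it as an
  assumption.\<close>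

lemma Ck_on_cong:
  assumes "open S" "\<And>x. x \<in> S \<Longrightarrow> f x = g x" "Ck_on k S f"
  shows "Ck_on k S g"
  using assms(2,3)
proof (induction k arbitrary: f g)
  case 0
  then show ?case using continuous_on_cong by force
next
  case (Suc k)
  have eq: "fd f x = fd g x" if "x \<in> S" for x
    using Suc.prems that assms(1) by (intro fd_transform[of f x S g]) auto
  have "g differentiable at x" if "x \<in> S" for x
    using Suc.prems that assms(1) by (intro differentiable_transform_open[of f x S g]) auto
  moreover have "Ck_on k S (\<lambda>x. fd g x v)" for v
  proof (rule Suc.IH)
    show "fd f x v = fd g x v" if "x \<in> S" for x
      by (simp only: eq[OF that])
    show "Ck_on k S (\<lambda>x. fd f x v)"
      using Suc.prems(2) by simp
  qed
  ultimately show ?case by simp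
qed

lemma Ck_on_local:
  assumes "\<And>x. x \<in> S \<Longrightarrow> \<exists>T. open T \<and> x \<in> T \<and> Ck_on k T f"
  shows "Ck_on k S f"
  using assms
proof (induction k arbitrary: f)
  case 0
  have "isCont f x" if "x \<in> S" for x
    using 0[OF that] by (auto simp: continuous_on_eq_continuous_at)
  then show ?case by (simp add: continuous_at_imp_continuous_on)
next
  case (Suc k)
  then show ?case by (fastforce intro: Suc.IH)
qed

lemma Ck_on_const: "Ck_on k S (\<lambda>x. c)"
  by (induction k arbitrary: c) auto

lemma bounded_linear_Ck_on:
  assumes "bounded_linear f" shows "Ck_on k S f"
proof (cases k)
  case 0
  then show ?thesis using assms by (simp add: linear_continuous_on)
next
  case (Suc j)
  have "f differentiable at x" "fd f x = f" for x
    using assms by (auto simp: bounded_linear_imp_differentiable intro!: fd_eq bounded_linear_imp_has_derivative)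
  then show ?thesis by (simp add: Suc Ck_on_const)
qed

lemma Ck_on_add:
  assumes "Ck_on k S f" "Ck_on k S g" "open S"
  shows "Ck_on k S (\<lambda>x. f x + g x)"
  using assms(1,2)
proof (induction k arbitrary: f g)
  case 0
  then show ?case by (simp add: continuous_on_add)
next
  case (Suc k)
  have "Ck_on k S (\<lambda>x. fd (\<lambda>x. f x + g x) x v)" for v
  proof (rule Ck_on_cong[OF assms(3)])
    show "Ck_on k S (\<lambda>x. fd f x v + fd g x v)"
      using Suc by auto
    show "fd f x v + fd g x v = fd (\<lambda>x. f x + g x) x v" if "x \<in> S" for x
      using Suc.prems that fd_eq[OF has_derivative_add, of f "fd f x" x g "fd g x"]
      by (simp add: frechet_derivative_works)
  qed
  then show ?case using Suc.prems by auto
qed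

text \<open>The product rule writes the derivative as two terms of the same shape, so the induction
  runs with \<open>f\<close> and \<open>g\<close> arbitrary. Multiplication, scaling and the inner
  product are instances.\<close>

lemma Ck_on_bilinear:
  assumes "bounded_bilinear B" "Ck_on k S f" "Ck_on k S g" "open S"
  shows "Ck_on k S (\<lambda>x. B (f x) (g x))"
  using assms(2,3)
proof (induction k arbitrary: f g)
  case 0
  then show ?case by (simp add: bounded_bilinear.continuous_on[OF assms(1)])
next
  case (Suc k)
  have hd: "((\<lambda>x. B (f x) (g x)) has_derivative (\<lambda>h. B (f x) (fd g x h) + B (fd f x h) (g x))) (at x)"
    if "x \<in> S" for x
    using Suc.prems that bounded_bilinear.FDERIV[OF assms(1), of f "fd f x" x UNIV g "fd g x"]
    by (simp add: frechet_derivative_works)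
  have "Ck_on k S (\<lambda>x. fd (\<lambda>x. B (f x) (g x)) x v)" for v
  proof (rule Ck_on_cong[OF assms(4)])
    show "Ck_on k S (\<lambda>x. B (f x) (fd g x v) + B (fd f x v) (g x))"
      using Suc.prems by (intro Ck_on_add Suc.IH assms(4)) (auto intro: Ck_on_Suc)
    show "B (f x) (fd g x v) + B (fd f x v) (g x) = fd (\<lambda>x. B (f x) (g x)) x v" if "x \<in> S" for x
      using fd_eq[OF hd[OF that]] by simp
  qed
  then show ?case using hd by (auto simp: differentiable_def)
qed

lemma Ck_on_bounded_linear:
  assumes "bounded_linear h" "Ck_on k S f" "open S"
  shows "Ck_on k S (\<lambda>x. h (f x))"
  using assms(2)
proof (induction k arbitrary: f)
  case 0
  then show ?case using assms(1) by (simp add: bounded_linear.continuous_on)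
next
  case (Suc k)
  have hd: "((\<lambda>x. h (f x)) has_derivative (\<lambda>v. h (fd f x v))) (at x)"
    if "x \<in> S" for x
    using Suc.prems that bounded_linear.has_derivative[OF assms(1), of f "fd f x" "at x"]
    by (simp add: frechet_derivative_works)
  have "Ck_on k S (\<lambda>x. fd (\<lambda>x. h (f x)) x v)" for v
  proof (rule Ck_on_cong[OF assms(3)])
    show "Ck_on k S (\<lambda>x. h (fd f x v))"
      using Suc.prems by (intro Suc.IH) simp
    show "h (fd f x v) = fd (\<lambda>x. h (f x)) x v" if "x \<in> S" for x
      using fd_eq[OF hd[OF that]] by simp
  qed
  then show ?case using hd by (auto simp: differentiable_def)
qed

lemma Ck_on_sum:
  assumes "\<And>i. i \<in> I \<Longrightarrow> Ck_on k S (f i)" "open S"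
  shows "Ck_on k S (\<lambda>x. \<Sum>i\<in>I. f i x)"
  using assms(1) by (induction I rule: infinite_finite_induct) (auto intro!: Ck_on_const Ck_on_add assms(2))

text \<open>The derivative of 1/f is a product of 1/f and the derivative of f, so class k of 1/f
  yields class k + 1.\<close>

lemma Ck_on_inverse:
  fixes f :: "'b::real_normed_vector \<Rightarrow> real"
  assumes "Ck_on k S f" "open S" "\<And>x. x \<in> S \<Longrightarrow> f x \<noteq> 0"
  shows "Ck_on k S (\<lambda>x. inverse (f x))"
  using assms(1)
proof (induction k)
  case 0
  then show ?case using assms(3) by (simp add: continuous_on_inverse)
next
  case (Suc k)
  have hd: "((\<lambda>x. inverse (f x)) has_derivative (\<lambda>h. - (inverse (f x) * fd f x h * inverse (f x)))) (at x)"
    if "x \<in> S" for x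
    using Suc.prems that Deriv.has_derivative_inverse[of f x "fd f x" UNIV] assms(3)[OF that]
    by (simp add: frechet_derivative_works)
  have "Ck_on k S (\<lambda>x. fd (\<lambda>x. inverse (f x)) x v)" for v
  proof (rule Ck_on_cong[OF assms(2)])
    show "Ck_on k S (\<lambda>x. - (inverse (f x) * fd f x v * inverse (f x)))"
      using Suc.prems Suc.IH[OF Ck_on_Suc[OF Suc.prems]]
      by (intro Ck_on_bounded_linear[OF bounded_linear_minus[OF bounded_linear_ident]]
        Ck_on_bilinear[OF bounded_bilinear_mult] assms(2)) auto
    show "- (inverse (f x) * fd f x v * inverse (f x)) = fd (\<lambda>x. inverse (f x)) x v" if "x \<in> S" for x
      using fd_eq[OF hd[OF that]] by simp
  qed
  then show ?case using hd by (auto simp: differentiable_def)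
qed

lemma smooth_onI: "(\<And>k. Ck_on k S f) \<Longrightarrow> smooth_on S f"
  by (simp add: smooth_on_def)

lemma smooth_onD: "smooth_on S f \<Longrightarrow> Ck_on k S f"
  by (simp add: smooth_on_def)

lemma smooth_on_imp_differentiable: "smooth_on S f \<Longrightarrow> x \<in> S \<Longrightarrow> f differentiable at x"
  using smooth_onD[of S f "Suc 0"] by simp

lemma smooth_on_fd: "smooth_on S f \<Longrightarrow> smooth_on S (\<lambda>x. fd f x v)"
  by (metis Ck_on.simps(2) smooth_on_def)

lemma smooth_on_imp_continuous_on: "smooth_on S f \<Longrightarrow> continuous_on S f"
  using smooth_onD[of S f 0] by simp

lemma smooth_on_subset: "smooth_on S f \<Longrightarrow> T \<subseteq> S \<Longrightarrow> smooth_on T f"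
  unfolding smooth_on_def using Ck_on_subset by blast

lemma smooth_on_cong: "smooth_on S f \<Longrightarrow> open S \<Longrightarrow> (\<And>x. x \<in> S \<Longrightarrow> f x = g x) \<Longrightarrow> smooth_on S g"
  by (intro smooth_onI Ck_on_cong[of S f g]) (auto dest: smooth_onD)

lemma smooth_on_local:
  assumes "\<And>x. x \<in> S \<Longrightarrow> \<exists>T. open T \<and> x \<in> T \<and> smooth_on T f"
  shows "smooth_on S f"
proof (rule smooth_onI, rule Ck_on_local)
  show "\<exists>T. open T \<and> x \<in> T \<and> Ck_on k T f" if "x \<in> S" for k x
    using assms[OF that] smooth_onD by blast
qed

lemma smooth_on_const: "smooth_on S (\<lambda>x. c)"
  by (simp add: Ck_on_const smooth_on_def)

lemma smooth_on_ident: "smooth_on S (\<lambda>x. x)"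
  by (simp add: bounded_linear_Ck_on smooth_on_def)

lemma smooth_on_add:
  "smooth_on S f \<Longrightarrow> smooth_on S g \<Longrightarrow> open S \<Longrightarrow> smooth_on S (\<lambda>x. f x + g x)"
  by (simp add: Ck_on_add smooth_on_def)

lemma smooth_on_sum:
  "(\<And>i. i \<in> I \<Longrightarrow> smooth_on S (f i)) \<Longrightarrow> open S \<Longrightarrow> smooth_on S (\<lambda>x. \<Sum>i\<in>I. f i x)"
  by (simp add: Ck_on_sum smooth_on_def)

lemma smooth_on_bilinear:
  "bounded_bilinear B \<Longrightarrow> smooth_on S f \<Longrightarrow> smooth_on S g \<Longrightarrow> open S \<Longrightarrow> smooth_on S (\<lambda>x. B (f x) (g x))"
  by (simp add: Ck_on_bilinear smooth_on_def)

lemmas smooth_on_mult = smooth_on_bilinear[OF bounded_bilinear_mult]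
lemmas smooth_on_scaleR = smooth_on_bilinear[OF bounded_bilinear_scaleR]
lemmas smooth_on_inner = smooth_on_bilinear[OF bounded_bilinear_inner]

lemma smooth_on_bounded_linear:
  "bounded_linear h \<Longrightarrow> smooth_on S f \<Longrightarrow> open S \<Longrightarrow> smooth_on S (\<lambda>x. h (f x))"
  by (simp add: Ck_on_bounded_linear smooth_on_def)

lemmas smooth_on_minus = smooth_on_bounded_linear[OF bounded_linear_minus[OF bounded_linear_ident]]

lemma smooth_on_diff:
  "smooth_on S f \<Longrightarrow> smooth_on S g \<Longrightarrow> open S \<Longrightarrow> smooth_on S (\<lambda>x. f x - g x)"
  using smooth_on_add[of S f "\<lambda>x. - g x"] smooth_on_minus[of S g] by simp

lemma smooth_on_inverse:
  fixes f :: "'b::real_normed_vector \<Rightarrow> real"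
  shows "smooth_on S f \<Longrightarrow> open S \<Longrightarrow> (\<And>x. x \<in> S \<Longrightarrow> f x \<noteq> 0) \<Longrightarrow> smooth_on S (\<lambda>x. inverse (f x))"
  by (simp add: Ck_on_inverse smooth_on_def)

section \<open>A smooth function that is flat at 0\<close>

text \<open>The powers of \<open>1 / t\<close> make the family closed under differentiation.\<close>

definition flat :: "nat \<Rightarrow> real \<Rightarrow> real" where
  "flat n t = (if t > 0 then inverse t ^ n * exp (- inverse t) else 0)"

text \<open>On the right, s = 1/t tends to infinity and the value is s^n / exp s, where the
  exponential dominates. On the left the function is identically 0.\<close>

lemma flat_tendsto_0: "(flat n \<longlongrightarrow> 0) (at 0)"
proof -
  have "((\<lambda>t. inverse t ^ n / exp (inverse t)) \<longlongrightarrow> (0::real)) (at_right 0)"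
    by (rule filterlim_compose[OF tendsto_power_div_exp_0 filterlim_inverse_at_top_right])
  moreover have "\<forall>\<^sub>F t in at_right 0. inverse t ^ n / exp (inverse t) = flat n t"
    by (rule eventually_at_rightI[of 0 1]) (simp_all add: flat_def exp_minus divide_inverse)
  ultimately have "(flat n \<longlongrightarrow> 0) (at_right 0)"
    by (rule Lim_transform_eventually)
  moreover have "(flat n \<longlongrightarrow> 0) (at_left 0)"
    by (intro tendsto_eventually eventually_at_leftI[of "-1"]) (simp_all add: flat_def)
  ultimately show ?thesis by (simp add: filterlim_at_split)
qed

lemma flat_has_derivative:
  "(flat n has_real_derivative (flat (n + 2) t - of_nat n * flat (n + 1) t)) (at t)"
proof -
  consider "t > 0" | "t < 0" | "t = 0" by linarith
  then show ?thesis
  proof cases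
    case 1
    have "((\<lambda>t. inverse t ^ n * exp (- inverse t)) has_real_derivative
        of_nat n * (- (inverse t ^ Suc (Suc 0))) * inverse t ^ (n - Suc 0) * exp (- inverse t)
        + inverse t ^ n * (exp (- inverse t) * inverse t ^ Suc (Suc 0))) (at t)"
      using 1 by (auto intro!: derivative_eq_intros)
    moreover have "of_nat n * (- (inverse t ^ Suc (Suc 0))) * inverse t ^ (n - Suc 0) * exp (- inverse t)
        + inverse t ^ n * (exp (- inverse t) * inverse t ^ Suc (Suc 0))
      = flat (n + 2) t - of_nat n * flat (n + 1) t"
      using 1 by (cases n) (simp_all add: flat_def algebra_simps)
    ultimately have "((\<lambda>t. inverse t ^ n * exp (- inverse t)) has_real_derivative
        (flat (n + 2) t - of_nat n * flat (n + 1) t)) (at t)"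
      by simp
    then show ?thesis
      by (rule has_field_derivative_transform_within_open[of _ _ _ "{0<..}"]) (use 1 in \<open>auto simp: flat_def\<close>)
  next
    case 2
    have "((\<lambda>t. 0) has_real_derivative (flat (n + 2) t - of_nat n * flat (n + 1) t)) (at t)"
      using 2 by (simp add: flat_def)
    then show ?thesis
      by (rule has_field_derivative_transform_within_open[of _ _ _ "{..<0}"]) (use 2 in \<open>auto simp: flat_def\<close>)
  next
    case 3
    \<comment> \<open>The difference quotient at 0 is the next member of the family,
      \<open>flat (n + 1) h\<close>, which tends to 0.\<close>
    have "((\<lambda>h. (flat n (0 + h) - flat n 0) / h) \<longlongrightarrow> 0) (at 0)"
      by (rule Lim_transform_eventually[OF flat_tendsto_0[of "n+1"]])
         (simp add: flat_def divide_inverse eventually_at_filter)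
    then show ?thesis using 3 by (simp add: DERIV_def flat_def)
  qed
qed

lemma smooth_on_flat: "smooth_on S (flat n)"
proof -
  have hd: "(flat n has_derivative (\<lambda>v. (flat (n + 2) t - of_nat n * flat (n + 1) t) * v)) (at t)" for n t
    using flat_has_derivative[of n t] by (simp add: has_field_derivative_def)
  have "Ck_on k UNIV (flat n)" for k
  proof (induction k arbitrary: n)
    case 0
    show ?case
      by (simp add: continuous_at_imp_continuous_on DERIV_isCont[OF flat_has_derivative])
  next
    case (Suc k)
    have "Ck_on k UNIV (\<lambda>t. flat (n + 2) t * v + (- of_nat n * v) * flat (n + 1) t)" for v
      by (intro Ck_on_add Ck_on_bilinear[OF bounded_bilinear_mult] Ck_on_const Suc.IH) auto
    moreover have "fd (flat n) t v = flat (n + 2) t * v + (- of_nat n * v) * flat (n + 1) t" for t v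
      unfolding fd_eq[OF hd] by (simp add: algebra_simps)
    ultimately show ?case
      using differentiableI[OF hd] by (simp only: Ck_on.simps) simp
  qed
  then show ?thesis
    using Ck_on_subset by (metis smooth_on_def subset_UNIV)
qed

section \<open>Symmetry of second derivatives\<close>

lemma has_real_derivative_along_line:
  fixes f :: "'b::real_normed_vector \<Rightarrow> real"
  assumes "f differentiable at (a + s *\<^sub>R u)"
  shows "((\<lambda>s. f (a + s *\<^sub>R u)) has_real_derivative fd f (a + s *\<^sub>R u) u) (at s)"
proof -
  have "((\<lambda>s. a + s *\<^sub>R u) has_derivative (\<lambda>h. h *\<^sub>R u)) (at s)"
    by (auto intro!: derivative_eq_intros)
  from has_derivative_compose[OF this assms[unfolded frechet_derivative_works]]
  have "((\<lambda>s. f (a + s *\<^sub>R u)) has_derivative (\<lambda>h. h * fd f (a + s *\<^sub>R u) u)) (at s)"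
    by (simp add: linear_scale[OF linear_frechet_derivative[OF assms]])
  moreover have "(*) (fd f (a + s *\<^sub>R u) u) = (\<lambda>h. h * fd f (a + s *\<^sub>R u) u)"
    by (rule ext) simp
  ultimately show ?thesis unfolding has_field_derivative_def by simp
qed

text \<open>The mean value theorem is applied twice, first in direction \<open>u\<close> to a
  difference in direction \<open>v\<close>, then in direction \<open>v\<close> to the resulting
  derivative. The left side is symmetric in \<open>u\<close> and \<open>v\<close>, the right side is
  a mixed derivative at a nearby point.\<close>

lemma second_difference:
  fixes f :: "'b::real_normed_vector \<Rightarrow> real"
  assumes f: "smooth_on S f" and h: "h > 0"
    and S: "\<And>s t. 0 \<le> s \<Longrightarrow> s \<le> h \<Longrightarrow> 0 \<le> t \<Longrightarrow> t \<le> h \<Longrightarrow> x + s *\<^sub>R u + t *\<^sub>R v \<in> S"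
  shows "\<exists>s t. 0 < s \<and> s < h \<and> 0 < t \<and> t < h \<and>
    f (x + h *\<^sub>R u + h *\<^sub>R v) - f (x + h *\<^sub>R u) - f (x + h *\<^sub>R v) + f x
      = h * h * fd (\<lambda>y. fd f y u) (x + s *\<^sub>R u + t *\<^sub>R v) v"
proof -
  \<comment> \<open>The increment of \<open>\<phi>\<close> from 0 to \<open>h\<close> is the whole
    second difference.\<close>
  define \<phi> where "\<phi> s = f ((x + h *\<^sub>R v) + s *\<^sub>R u) - f (x + s *\<^sub>R u)" for s
  have d: "(\<phi> has_real_derivative fd f ((x + h *\<^sub>R v) + s *\<^sub>R u) u - fd f (x + s *\<^sub>R u) u) (at s)"
    if "0 \<le> s" "s \<le> h" for s
  proof -
    have "x + h *\<^sub>R v + s *\<^sub>R u \<in> S" "x + s *\<^sub>R u \<in> S"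
      using S[of s h] S[of s 0] that h by (simp_all add: ac_simps)
    then show ?thesis unfolding \<phi>_def
      by (intro DERIV_diff has_real_derivative_along_line smooth_on_imp_differentiable[OF f])
  qed
  obtain s where s: "0 < s" "s < h"
    and 1: "\<phi> h - \<phi> 0 = (h - 0) * (fd f ((x + h *\<^sub>R v) + s *\<^sub>R u) u - fd f (x + s *\<^sub>R u) u)"
    using MVT2[OF h d] by blast
  have d2: "((\<lambda>t. fd f ((x + s *\<^sub>R u) + t *\<^sub>R v) u) has_real_derivative
      fd (\<lambda>y. fd f y u) ((x + s *\<^sub>R u) + t *\<^sub>R v) v) (at t)" if "0 \<le> t" "t \<le> h" for t
    using S[of s t] s that smooth_on_imp_differentiable[OF smooth_on_fd[OF f]]
    by (intro has_real_derivative_along_line[of "\<lambda>y. fd f y u"]) auto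
  obtain t where t: "0 < t" "t < h"
    and 2: "fd f ((x + s *\<^sub>R u) + h *\<^sub>R v) u - fd f ((x + s *\<^sub>R u) + 0 *\<^sub>R v) u
      = (h - 0) * fd (\<lambda>y. fd f y u) ((x + s *\<^sub>R u) + t *\<^sub>R v) v"
    using MVT2[OF h d2] by blast
  have "x + h *\<^sub>R v + s *\<^sub>R u = x + s *\<^sub>R u + h *\<^sub>R v" "x + h *\<^sub>R v + h *\<^sub>R u = x + h *\<^sub>R u + h *\<^sub>R v"
    by (simp_all add: ac_simps)
  then have "f (x + h *\<^sub>R u + h *\<^sub>R v) - f (x + h *\<^sub>R u) - f (x + h *\<^sub>R v) + f x
      = h * h * fd (\<lambda>y. fd f y u) (x + s *\<^sub>R u + t *\<^sub>R v) v"
    using 1 2 by (simp add: \<phi>_def algebra_simps)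
  then show ?thesis using s t by blast
qed

text \<open>Both mixed derivatives, taken at suitable nearby points, equal the same second
  difference divided by \<open>h * h\<close>. Continuity would keep them apart if they differed at
  \<open>x\<close>.\<close>

lemma second_derivative_symmetric_real:
  fixes f :: "'b::real_normed_vector \<Rightarrow> real"
  assumes f: "smooth_on S f" and S: "open S" "x \<in> S"
  shows "fd (\<lambda>y. fd f y u) x v = fd (\<lambda>y. fd f y v) x u"
proof (rule ccontr)
  define G where "G u v y = fd (\<lambda>y. fd f y u) y v" for u v y
  assume "\<not> ?thesis"
  \<comment> \<open>Half the supposed gap is the tolerance: two values within it of the respective
    limits cannot coincide.\<close>
  then have e: "dist (G u v x) (G v u x) / 2 > 0" by (simp add: G_def)
  have "isCont (G u v) x" for u v
    unfolding G_def using smooth_on_imp_continuous_on[OF smooth_on_fd[OF smooth_on_fd[OF f]]] S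
    by (simp add: continuous_on_eq_continuous_at)
  then have "\<exists>d>0. \<forall>y. dist y x < d \<longrightarrow> dist (G u v y) (G u v x) < dist (G u v x) (G v u x) / 2"
            "\<exists>d>0. \<forall>y. dist y x < d \<longrightarrow> dist (G v u y) (G v u x) < dist (G u v x) (G v u x) / 2"
    using e unfolding continuous_at_eps_delta by blast+
  then obtain d1 d2 where d1: "d1 > 0" "\<And>y. dist y x < d1 \<Longrightarrow> dist (G u v y) (G u v x) < dist (G u v x) (G v u x) / 2"
    and d2: "d2 > 0" "\<And>y. dist y x < d2 \<Longrightarrow> dist (G v u y) (G v u x) < dist (G u v x) (G v u x) / 2"
    by blast
  obtain d3 where d3: "d3 > 0" "ball x d3 \<subseteq> S"
    using S open_contains_ball by blast
  define d where "d = min d1 (min d2 d3)"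
  \<comment> \<open>This makes the parallelogram with sides \<open>h *\<^sub>R u\<close> and
    \<open>h *\<^sub>R v\<close> stay within distance \<open>d\<close> of \<open>x\<close>; the
    summand 1 covers the case of two zero vectors.\<close>
  define h where "h = d / (norm u + norm v + 1)"
  have d0: "d > 0" using d1 d2 d3 by (simp add: d_def)
  have np: "norm u + norm v + 1 > 0" by (smt (verit) norm_ge_zero)
  have h: "h > 0" unfolding h_def using d0 np by (rule divide_pos_pos)
  have hd: "h * (norm u + norm v) < d"
    using h np unfolding h_def using d0 by (simp add: field_simps)
  have near: "dist (x + s *\<^sub>R u + t *\<^sub>R v) x < d" if "0 \<le> s" "s \<le> h" "0 \<le> t" "t \<le> h" for s t
  proof -
    have "dist (x + s *\<^sub>R u + t *\<^sub>R v) x = norm (s *\<^sub>R u + t *\<^sub>R v)"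
      by (simp add: dist_norm add.assoc)
    also have "\<dots> \<le> s * norm u + t * norm v"
      using norm_triangle_ineq[of "s *\<^sub>R u" "t *\<^sub>R v"] that by simp
    also have "\<dots> \<le> h * norm u + h * norm v"
      using that by (intro add_mono mult_right_mono) auto
    finally show ?thesis using hd by (simp add: distrib_left)
  qed
  then have inS: "x + s *\<^sub>R u + t *\<^sub>R v \<in> S" if "0 \<le> s" "s \<le> h" "0 \<le> t" "t \<le> h" for s t
    using that d3(2) by (auto simp: subset_iff dist_commute d_def)
  obtain s t where st: "0 < s" "s < h" "0 < t" "t < h" and 1:
    "f (x + h *\<^sub>R u + h *\<^sub>R v) - f (x + h *\<^sub>R u) - f (x + h *\<^sub>R v) + f x
      = h * h * G u v (x + s *\<^sub>R u + t *\<^sub>R v)"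
    using second_difference[OF f h inS] unfolding G_def by blast
  have inS': "x + s *\<^sub>R v + t *\<^sub>R u \<in> S" if "0 \<le> s" "s \<le> h" "0 \<le> t" "t \<le> h" for s t
    using inS[of t s] that by (simp add: ac_simps)
  obtain s' t' where st': "0 < s'" "s' < h" "0 < t'" "t' < h" and 2:
    "f (x + h *\<^sub>R v + h *\<^sub>R u) - f (x + h *\<^sub>R v) - f (x + h *\<^sub>R u) + f x
      = h * h * G v u (x + s' *\<^sub>R v + t' *\<^sub>R u)"
    using second_difference[OF f h inS'] unfolding G_def by blast
  have "x + h *\<^sub>R v + h *\<^sub>R u = x + h *\<^sub>R u + h *\<^sub>R v" by (simp add: ac_simps)
  with 1 2 have "h * h * G u v (x + s *\<^sub>R u + t *\<^sub>R v) = h * h * G v u (x + s' *\<^sub>R v + t' *\<^sub>R u)"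
    by (simp add: algebra_simps)
  then have "G u v (x + s *\<^sub>R u + t *\<^sub>R v) = G v u (x + s' *\<^sub>R v + t' *\<^sub>R u)"
    using h by simp
  moreover have "dist (G u v (x + s *\<^sub>R u + t *\<^sub>R v)) (G u v x) < dist (G u v x) (G v u x) / 2"
    using near[of s t] st by (intro d1(2)) (auto simp: d_def)
  moreover have "dist (G v u (x + t' *\<^sub>R u + s' *\<^sub>R v)) (G v u x) < dist (G u v x) (G v u x) / 2"
    using near[of t' s'] st' by (intro d2(2)) (auto simp: d_def)
  moreover have "x + t' *\<^sub>R u + s' *\<^sub>R v = x + s' *\<^sub>R v + t' *\<^sub>R u" by (simp add: ac_simps)
  ultimately show False
    using dist_triangle3[of "G u v x" "G v u x" "G v u (x + s' *\<^sub>R v + t' *\<^sub>R u)"] by simp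
qed

text \<open>Inner products with fixed vectors commute with differentiation and separate points, so
  the scalar case suffices.\<close>

lemma second_derivative_symmetric:
  fixes f :: "'b::real_normed_vector \<Rightarrow> 'c::real_inner"
  assumes f: "smooth_on S f" and S: "open S" "x \<in> S"
  shows "fd (\<lambda>y. fd f y u) x v = fd (\<lambda>y. fd f y v) x u"
proof -
  have inner: "fd (\<lambda>y. g y \<bullet> c) y w = fd g y w \<bullet> c" if "g differentiable at y" for g :: "'b \<Rightarrow> 'c" and y w c
    using has_derivative_inner_left[of g "fd g y" "at y" c] that
    by (metis fd_eq frechet_derivative_works)
  have "fd (\<lambda>y. fd f y u) x v \<bullet> c = fd (\<lambda>y. fd (\<lambda>y. f y \<bullet> c) y u) x v" for u v c
  proof -
    have "fd (\<lambda>y. fd f y u) x v \<bullet> c = fd (\<lambda>y. fd f y u \<bullet> c) x v"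
      using inner[OF smooth_on_imp_differentiable[OF smooth_on_fd[OF f] S(2)]] by simp
    also have "(fd (\<lambda>y. fd f y u \<bullet> c) x) = fd (\<lambda>y. fd (\<lambda>y. f y \<bullet> c) y u) x"
    proof (rule fd_transform[OF _ S])
      show "(\<lambda>y. fd f y u \<bullet> c) differentiable at x"
        using smooth_on_imp_differentiable[OF smooth_on_fd[OF f] S(2)]
        by (intro differentiable_inner) auto
      show "fd f y u \<bullet> c = fd (\<lambda>y. f y \<bullet> c) y u" if "y \<in> S" for y
        using inner[OF smooth_on_imp_differentiable[OF f that]] by simp
    qed
    finally show ?thesis .
  qed
  moreover have "smooth_on S (\<lambda>y. f y \<bullet> c)" for c
    using f S(1) by (intro smooth_on_inner smooth_on_const)
  ultimately have "fd (\<lambda>y. fd f y u) x v \<bullet> c = fd (\<lambda>y. fd f y v) x u \<bullet> c" for c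
    using second_derivative_symmetric_real[OF _ S] by simp
  then show ?thesis
    by (metis vector_eq_rdot)
qed

section \<open>Finite-dimensional inner product spaces\<close>

text \<open>The expansion identity is how an orthonormal basis enters all later arguments. In
  dimension 0 the set may be empty.\<close>

locale finite_dim_inner =
  fixes E :: "'b::real_inner set"
  assumes finite_E: "finite E"
    and expand_E: "(\<Sum>b\<in>E. (x \<bullet> b) *\<^sub>R b) = x"
begin

lemma linear_expand:
  assumes "linear (f :: 'b \<Rightarrow> 'c::real_vector)"
  shows "f v = (\<Sum>b\<in>E. (v \<bullet> b) *\<^sub>R f b)"
  using linear_sum[OF assms, of "\<lambda>b. (v \<bullet> b) *\<^sub>R b" E] by (simp add: expand_E linear_scale[OF assms])

lemma linear_imp_bounded_linear:
  assumes "linear (f :: 'b \<Rightarrow> 'c::real_normed_vector)"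
  shows "bounded_linear f"
proof -
  have "bounded_linear (\<lambda>v. \<Sum>b\<in>E. (v \<bullet> b) *\<^sub>R f b)"
    by (intro bounded_linear_sum bounded_linear_scaleR_const bounded_linear_inner_left)
  also have "(\<lambda>v. \<Sum>b\<in>E. (v \<bullet> b) *\<^sub>R f b) = f"
    by (rule ext) (rule linear_expand[OF assms, symmetric])
  finally show ?thesis .
qed

text \<open>In the chain rule the direction in which \<open>f\<close> is differentiated varies with
  the point, whereas \<open>Ck_on\<close> speaks of fixed directions. Expanding that direction in
  \<open>E\<close> leaves products of scalar functions with derivatives of \<open>f\<close> in fixed
  directions, to which the induction hypothesis applies.\<close>

lemma Ck_on_compose:
  fixes f :: "'b \<Rightarrow> 'c::real_normed_vector" and g :: "'d::real_normed_vector \<Rightarrow> 'b"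
  assumes "open S" "g ` S \<subseteq> T" "Ck_on k T f" "Ck_on k S g"
  shows "Ck_on k S (\<lambda>x. f (g x))"
  using assms(3,4)
proof (induction k arbitrary: f)
  case 0
  then show ?case using assms(2) continuous_on_compose2 by auto
next
  case (Suc k)
  have gT: "g x \<in> T" if "x \<in> S" for x using assms(2) that by auto
  have hd: "((\<lambda>x. f (g x)) has_derivative (\<lambda>v. fd f (g x) (fd g x v))) (at x)" if "x \<in> S" for x
    using Suc.prems that gT[OF that]
    by (intro has_derivative_compose[of g "fd g x" x UNIV f "fd f (g x)"])
       (auto simp flip: frechet_derivative_works)
  have "Ck_on k S (\<lambda>x. fd (\<lambda>x. f (g x)) x v)" for v
  proof (rule Ck_on_cong[OF assms(1)])
    show "Ck_on k S (\<lambda>x. \<Sum>b\<in>E. (fd g x v \<bullet> b) *\<^sub>R fd f (g x) b)"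
      using Suc.prems Ck_on_Suc[OF Suc.prems(2)]
      by (intro Ck_on_sum Ck_on_bilinear[OF bounded_bilinear_scaleR]
        Ck_on_bilinear[OF bounded_bilinear_inner] Suc.IH Ck_on_const assms(1)) simp_all
    show "(\<Sum>b\<in>E. (fd g x v \<bullet> b) *\<^sub>R fd f (g x) b) = fd (\<lambda>x. f (g x)) x v" if "x \<in> S" for x
    proof -
      have "linear (fd f (g x))"
        using Suc.prems(1) gT[OF that] by (intro linear_frechet_derivative) simp
      from linear_expand[OF this, of "fd g x v", symmetric] show ?thesis
        unfolding fd_eq[OF hd[OF that]] .
    qed
  qed
  moreover have "\<forall>x\<in>S. (\<lambda>x. f (g x)) differentiable at x"
    using hd by (auto simp only: differentiable_def)
  ultimately show ?case by simp
qed

lemma smooth_on_compose: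
  fixes f :: "'b \<Rightarrow> 'c::real_normed_vector" and g :: "'d::real_normed_vector \<Rightarrow> 'b"
  assumes "smooth_on T f" "smooth_on S g" "open S" "g ` S \<subseteq> T"
  shows "smooth_on S (\<lambda>x. f (g x))"
  unfolding smooth_on_def using Ck_on_compose[OF assms(3,4) smooth_onD[OF assms(1)] smooth_onD[OF assms(2)]]
  by blast

text \<open>By linearity the value at a moving vector is a finite combination of the values at the
  elements of \<open>E\<close>. This is how smoothness of a form or a derivative on constant vectors
  is upgraded to smoothness on vector fields.\<close>

lemma smooth_on_eval:
  fixes \<beta> :: "'d::real_normed_vector \<Rightarrow> 'b \<Rightarrow> 'c::real_normed_vector"
  assumes "\<And>x. x \<in> S \<Longrightarrow> linear (\<beta> x)" "\<And>v. smooth_on S (\<lambda>x. \<beta> x v)" "smooth_on S g" "open S"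
  shows "smooth_on S (\<lambda>x. \<beta> x (g x))"
proof (rule smooth_on_cong[OF _ assms(4)])
  show "smooth_on S (\<lambda>x. \<Sum>b\<in>E. (g x \<bullet> b) *\<^sub>R \<beta> x b)"
    by (intro smooth_on_sum smooth_on_scaleR smooth_on_inner smooth_on_const assms)
  show "(\<Sum>b\<in>E. (g x \<bullet> b) *\<^sub>R \<beta> x b) = \<beta> x (g x)" if "x \<in> S" for x
    by (rule linear_expand[OF assms(1)[OF that], symmetric])
qed

lemma smooth_on_fd_eval:
  fixes f :: "'b \<Rightarrow> 'c::real_normed_vector"
  assumes "smooth_on S f" "smooth_on S g" "open S"
  shows "smooth_on S (\<lambda>x. fd f x (g x))"
proof (rule smooth_on_eval[OF _ _ assms(2,3)])
  show "linear (fd f x)" if "x \<in> S" for x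
    by (rule linear_frechet_derivative[OF smooth_on_imp_differentiable[OF assms(1) that]])
  show "smooth_on S (\<lambda>x. fd f x v)" for v
    by (rule smooth_on_fd[OF assms(1)])
qed

text \<open>A product rule for a linear family evaluated at a moving vector: expand in
  \<open>E\<close>, differentiate the finite sum, and recognise the two groups of terms.\<close>

lemma has_derivative_eval:
  fixes \<beta> :: "'d::real_normed_vector \<Rightarrow> 'b \<Rightarrow> 'c::real_normed_vector"
  assumes S: "open S" "x \<in> S" and lin: "\<And>y. y \<in> S \<Longrightarrow> linear (\<beta> y)"
    and \<beta>: "\<And>v. (\<lambda>y. \<beta> y v) differentiable at x" and g: "g differentiable at x"
  shows "((\<lambda>y. \<beta> y (g y)) has_derivative (\<lambda>h. fd (\<lambda>y. \<beta> y (g x)) x h + \<beta> x (fd g x h))) (at x)"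
proof -
  have h\<beta>: "((\<lambda>y. \<beta> y b) has_derivative fd (\<lambda>y. \<beta> y b) x) (at x)" for b
    using \<beta> frechet_derivative_works by blast
  have hg: "(g has_derivative fd g x) (at x)"
    using g frechet_derivative_works by blast
  have expand: "((\<lambda>y. \<Sum>b\<in>E. (k y \<bullet> b) *\<^sub>R \<beta> y b) has_derivative
      (\<lambda>h. \<Sum>b\<in>E. (k x \<bullet> b) *\<^sub>R fd (\<lambda>y. \<beta> y b) x h + (k' h \<bullet> b) *\<^sub>R \<beta> x b)) (at x)"
    if "(k has_derivative k') (at x)" for k k'
    by (intro has_derivative_sum has_derivative_scaleR has_derivative_inner_left h\<beta> that)
  have tr: "((\<lambda>y. \<beta> y (k y)) has_derivative
      (\<lambda>h. \<Sum>b\<in>E. (k x \<bullet> b) *\<^sub>R fd (\<lambda>y. \<beta> y b) x h + (k' h \<bullet> b) *\<^sub>R \<beta> x b)) (at x)"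
    if "(k has_derivative k') (at x)" for k k'
    by (rule has_derivative_transform_within_open[OF expand[OF that] S])
       (rule linear_expand[OF lin, symmetric])
  have "fd (\<lambda>y. \<beta> y (g x)) x h = (\<Sum>b\<in>E. (g x \<bullet> b) *\<^sub>R fd (\<lambda>y. \<beta> y b) x h)" for h
    using fd_eq[OF tr[of "\<lambda>_. g x" "\<lambda>_. 0"]] by simp
  moreover have "\<beta> x (fd g x h) = (\<Sum>b\<in>E. (fd g x h \<bullet> b) *\<^sub>R \<beta> x b)" for h
    by (rule linear_expand[OF lin[OF S(2)]])
  ultimately show ?thesis
    using tr[OF hg] by (simp add: sum.distrib)
qed

lemma fd_eval:
  fixes \<beta> :: "'d::real_normed_vector \<Rightarrow> 'b \<Rightarrow> 'c::real_normed_vector"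
  assumes "open S" "x \<in> S" "\<And>y. y \<in> S \<Longrightarrow> linear (\<beta> y)"
    "\<And>v. (\<lambda>y. \<beta> y v) differentiable at x" "g differentiable at x"
  shows "fd (\<lambda>y. \<beta> y (g y)) x h = fd (\<lambda>y. \<beta> y (g x)) x h + \<beta> x (fd g x h)"
  using fd_eq[OF has_derivative_eval[OF assms]] by simp

lemma differentiable_eval:
  fixes \<beta> :: "'d::real_normed_vector \<Rightarrow> 'b \<Rightarrow> 'c::real_normed_vector"
  assumes "open S" "x \<in> S" "\<And>y. y \<in> S \<Longrightarrow> linear (\<beta> y)"
    "\<And>v. (\<lambda>y. \<beta> y v) differentiable at x" "g differentiable at x"
  shows "(\<lambda>y. \<beta> y (g y)) differentiable at x"
  using has_derivative_eval[OF assms] by (rule differentiableI)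

lemma
  fixes W :: "'d::real_normed_vector \<Rightarrow> 'b \<Rightarrow> 'b \<Rightarrow> 'c::real_normed_vector"
  assumes S: "open S" "x \<in> S"
    and lin1: "\<And>y v. y \<in> S \<Longrightarrow> linear (\<lambda>u. W y u v)" and lin2: "\<And>y u. y \<in> S \<Longrightarrow> linear (W y u)"
    and W: "\<And>u v. (\<lambda>y. W y u v) differentiable at x"
    and f: "f differentiable at x" and g: "g differentiable at x"
  shows fd_eval2: "fd (\<lambda>y. W y (f y) (g y)) x h
      = fd (\<lambda>y. W y (f x) (g x)) x h + W x (fd f x h) (g x) + W x (f x) (fd g x h)"
    and differentiable_eval2: "(\<lambda>y. W y (f y) (g y)) differentiable at x"
proof -
  have d: "(\<lambda>y. W y (f y) v) differentiable at x" for v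
    using differentiable_eval[of S x "\<lambda>y u. W y u v", OF S lin1 W f] .
  have "fd (\<lambda>y. W y (f y) (g y)) x h = fd (\<lambda>y. W y (f y) (g x)) x h + W x (f x) (fd g x h)"
    using fd_eval[of S x "\<lambda>y. W y (f y)", OF S lin2 d g] .
  also have "fd (\<lambda>y. W y (f y) (g x)) x h = fd (\<lambda>y. W y (f x) (g x)) x h + W x (fd f x h) (g x)"
    using fd_eval[of S x "\<lambda>y u. W y u (g x)", OF S lin1 W f] .
  finally show "fd (\<lambda>y. W y (f y) (g y)) x h
      = fd (\<lambda>y. W y (f x) (g x)) x h + W x (fd f x h) (g x) + W x (f x) (fd g x h)" .
  show "(\<lambda>y. W y (f y) (g y)) differentiable at x"
    using differentiable_eval[of S x "\<lambda>y. W y (f y)", OF S lin2 d g] .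
qed

text \<open>The ball lies in the continuous image of a product of compact intervals under the map
  from coefficients to vectors, and it is closed.\<close>

lemma compact_cball_finite_dim: "compact (cball (x::'b) r)"
proof -
  define \<Phi> where "\<Phi> c = (\<Sum>b\<in>E. c b *\<^sub>R b)" for c :: "'b \<Rightarrow> real"
  \<comment> \<open>By Cauchy-Schwarz this bounds the coefficient at \<open>b\<close> of every
    vector of the ball.\<close>
  define R where "R b = (norm x + \<bar>r\<bar>) * norm b" for b :: 'b
  have "compact (PiE UNIV (\<lambda>b. {- R b .. R b}))"
    unfolding compactin_euclidean_iff[symmetric] euclidean_product_topology[symmetric]
    by (simp add: compactin_PiE)
  moreover have "continuous_on (PiE UNIV (\<lambda>b. {- R b .. R b})) \<Phi>"
    unfolding \<Phi>_def
    by (intro continuous_on_sum continuous_on_scaleR continuous_on_const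
      continuous_on_subset[OF continuous_on_product_coordinates] subset_UNIV)
  ultimately have "compact (\<Phi> ` PiE UNIV (\<lambda>b. {- R b .. R b}))"
    by (rule compact_continuous_image[rotated])
  then have "compact (\<Phi> ` PiE UNIV (\<lambda>b. {- R b .. R b}) \<inter> cball x r)"
    by (rule compact_Int_closed) simp
  moreover have "cball x r \<subseteq> \<Phi> ` PiE UNIV (\<lambda>b. {- R b .. R b})"
  proof
    fix y assume "y \<in> cball x r"
    then have "norm y \<le> norm x + \<bar>r\<bar>"
      using norm_triangle_sub[of y x] by (simp add: dist_norm norm_minus_commute)
    then have "norm y * norm b \<le> R b" for b
      unfolding R_def by (rule mult_right_mono) simp
    then have R: "\<bar>y \<bullet> b\<bar> \<le> R b" for b
      using Cauchy_Schwarz_ineq2[of y b] order_trans by blast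
    have "y \<bullet> b \<in> {- R b .. R b}" for b
      using abs_le_D1[OF R[of b]] abs_le_D2[OF R[of b]] by simp
    then have "(\<lambda>b. y \<bullet> b) \<in> PiE UNIV (\<lambda>b. {- R b .. R b})"
      by (simp add: PiE_UNIV_domain)
    moreover have "\<Phi> (\<lambda>b. y \<bullet> b) = y" by (simp add: \<Phi>_def expand_E)
    ultimately show "y \<in> \<Phi> ` PiE UNIV (\<lambda>b. {- R b .. R b})"
      by (intro image_eqI[of y \<Phi> "\<lambda>b. y \<bullet> b"]) simp_all
  qed
  ultimately show ?thesis by (simp add: Int_absorb1)
qed

end

interpretation real_fd: finite_dim_inner "{1::real}"
  by standard simp_all

lemma pairwise_orthogonal_expand:
  fixes C :: "'b::real_inner set"
  assumes "finite C" "pairwise orthogonal C" "x \<in> span C"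
  shows "(\<Sum>b\<in>C. (x \<bullet> b / (b \<bullet> b)) *\<^sub>R b) = x"
proof -
  obtain u where u: "x = (\<Sum>b\<in>C. u b *\<^sub>R b)"
    using assms(1,3) by (auto simp: span_finite)
  have "x \<bullet> b = u b * (b \<bullet> b)" if "b \<in> C" for b
  proof -
    have "x \<bullet> b = (\<Sum>c\<in>C. u c * (c \<bullet> b))" unfolding u by (simp add: inner_sum_left)
    also have "\<dots> = (\<Sum>c\<in>{b}. u c * (c \<bullet> b))"
      using assms(1,2) that by (intro sum.mono_neutral_right) (auto simp: pairwise_def orthogonal_def)
    finally show ?thesis by simp
  qed
  \<comment> \<open>A zero vector in \<open>C\<close> does no harm: division by 0 gives 0, and both
    terms vanish anyway.\<close>
  then have "(x \<bullet> b / (b \<bullet> b)) *\<^sub>R b = u b *\<^sub>R b" if "b \<in> C" for b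
    using that by (cases "b = 0") auto
  then have "(\<Sum>b\<in>C. (x \<bullet> b / (b \<bullet> b)) *\<^sub>R b) = (\<Sum>b\<in>C. u b *\<^sub>R b)"
    by (intro sum.cong refl) blast
  then show ?thesis using u by simp
qed

lemma finite_dim_inner_exists:
  assumes "finite B" "span B = (UNIV :: 'b::real_inner set)"
  shows "\<exists>E :: 'b set. finite_dim_inner E"
proof -
  obtain C where C: "finite C" "span C = span B" "pairwise orthogonal (C :: 'b set)"
    using basis_orthogonal[OF assms(1)] by blast
  have "(\<Sum>b\<in>(\<lambda>c. sgn c) ` C. (x \<bullet> b) *\<^sub>R b) = x" for x
  proof -
    \<comment> \<open>Distinct elements of \<open>C\<close> are orthogonal, so with equal
      normalisations they would have a normalisation orthogonal to itself, hence both would be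
      0.\<close>
    have inj: "inj_on sgn C"
    proof (rule inj_onI, rule ccontr)
      fix a b :: 'b assume ab: "a \<in> C" "b \<in> C" "sgn a = sgn b" "a \<noteq> b"
      then have "a \<bullet> b = 0" using C(3) by (auto simp: pairwise_def orthogonal_def)
      then have "sgn a \<bullet> sgn b = 0" by (simp add: sgn_div_norm)
      then have "sgn a = 0" using ab(3) by simp
      then show False using ab by (metis sgn_zero_iff)
    qed
    have "(x \<bullet> sgn c) *\<^sub>R sgn c = (x \<bullet> c / (c \<bullet> c)) *\<^sub>R c" for c
      by (simp add: sgn_div_norm dot_square_norm power2_eq_square divide_simps)
    then have "(\<Sum>b\<in>sgn ` C. (x \<bullet> b) *\<^sub>R b) = (\<Sum>c\<in>C. (x \<bullet> c / (c \<bullet> c)) *\<^sub>R c)"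
      by (simp add: sum.reindex[OF inj])
    also have "\<dots> = x"
      using C assms(2) by (intro pairwise_orthogonal_expand) auto
    finally show ?thesis by simp
  qed
  then have "finite_dim_inner (sgn ` C)"
    using C(1) by unfold_locales auto
  then show ?thesis by blast
qed

context finite_dim_inner
begin

text \<open>Orthogonal projection presents \<open>W\<close> as the solution set of an equation
  between continuous linear maps, a condition that survives differentiation.\<close>

lemma subspace_projection:
  assumes "subspace (W :: 'b set)"
  obtains P :: "'b \<Rightarrow> 'b" where "bounded_linear P" "W = {x. P x = x}"
proof -
  have "span E = UNIV"
  proof -
    have "(\<Sum>b\<in>E. (x \<bullet> b) *\<^sub>R b) \<in> span E" for x
      by (intro span_sum span_scale span_base)
    then show ?thesis unfolding expand_E by blast
  qed
  obtain B where B: "B \<subseteq> W" "independent B" "W \<subseteq> span B" "card B = dim W"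
    by (rule basis_exists)
  have "finite B"
    using independent_span_bound[OF finite_E B(2)] unfolding \<open>span E = UNIV\<close> by blast
  obtain C where C: "finite C" "span C = span B" "pairwise orthogonal (C :: 'b set)"
    using basis_orthogonal[OF \<open>finite B\<close>] by blast
  have W: "W = span C"
    using B C assms span_subspace by metis
  define P where "P x = (\<Sum>b\<in>C. (x \<bullet> b / (b \<bullet> b)) *\<^sub>R b)" for x
  have "W = {x. P x = x}"
  proof (intro set_eqI iffI CollectI)
    show "P x = x" if "x \<in> W" for x
      using pairwise_orthogonal_expand[OF C(1,3)] that W by (simp add: P_def)
    show "x \<in> W" if "x \<in> {x. P x = x}" for x
    proof -
      have "P x \<in> span C" unfolding P_def by (intro span_sum span_scale span_base)
      then show ?thesis using that W by simp
    qed
  qed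
  moreover have "bounded_linear P"
    unfolding P_def divide_inverse
    by (intro bounded_linear_sum bounded_linear_scaleR_const bounded_linear_mult_const bounded_linear_inner_left)
  ultimately show thesis using that by blast
qed

text \<open>The curve \<open>f (x + t *\<^sub>R w)\<close> stays in \<open>W\<close> near t = 0, so
  it is fixed by the projection, and therefore so is its velocity. Only the values of
  \<open>f\<close> at points of \<open>W\<close> enter, which is all that a slice chart
  controls.\<close>

lemma subspace_derivative_mem:
  fixes f :: "'b \<Rightarrow> 'b"
  assumes W: "subspace W" and S: "open S" "x \<in> S" "x \<in> W" and f: "f differentiable at x"
    and fW: "\<And>y. y \<in> S \<Longrightarrow> y \<in> W \<Longrightarrow> f y \<in> W" and w: "w \<in> W"
  shows "fd f x w \<in> W"
proof -
  have hd: "((\<lambda>t. f (x + t *\<^sub>R w)) has_vector_derivative fd f x w) (at 0)"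
  proof -
    have "((\<lambda>t. x + t *\<^sub>R w) has_derivative (\<lambda>h. h *\<^sub>R w)) (at 0)"
      by (auto intro!: derivative_eq_intros)
    moreover have "(f has_derivative fd f x) (at (x + 0 *\<^sub>R w))"
      using f[unfolded frechet_derivative_works] by simp
    ultimately have "((\<lambda>t. f (x + t *\<^sub>R w)) has_derivative (\<lambda>h. fd f x (h *\<^sub>R w))) (at 0)"
      by (rule has_derivative_compose)
    then show ?thesis
      by (simp add: has_vector_derivative_def linear_scale[OF linear_frechet_derivative[OF f]])
  qed
  obtain P where P: "bounded_linear P" "W = {x. P x = x}"
    using subspace_projection[OF W] .
  have "((\<lambda>t. P (f (x + t *\<^sub>R w))) has_vector_derivative P (fd f x w)) (at 0)"
    by (rule bounded_linear.has_vector_derivative[OF P(1) hd])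
  moreover have "((\<lambda>t. P (f (x + t *\<^sub>R w))) has_vector_derivative fd f x w) (at 0)"
  proof (rule has_vector_derivative_transform_within_open[OF hd])
    have "open ((\<lambda>t::real. x + t *\<^sub>R w) -` S)"
      by (intro open_vimage S continuous_intros)
    then show "open {t::real. x + t *\<^sub>R w \<in> S}" by (simp add: vimage_def)
    show "f (x + t *\<^sub>R w) = P (f (x + t *\<^sub>R w))" if "t \<in> {t. x + t *\<^sub>R w \<in> S}" for t
    proof -
      have "x + t *\<^sub>R w \<in> W" by (intro subspace_add[OF W] subspace_scale[OF W] S w)
      then have "f (x + t *\<^sub>R w) \<in> W" using fW that by blast
      then show ?thesis using P(2) by simp
    qed
  qed (use S in simp)
  ultimately have "P (fd f x w) = fd f x w"
    by (rule vector_derivative_unique_at)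
  then show ?thesis using P(2) by simp
qed

lemma smooth_bump:
  fixes x0 :: 'b
  assumes "r > 0"
  obtains f :: "'b \<Rightarrow> real" where "smooth_on UNIV f" "\<And>x. x \<in> ball x0 r \<Longrightarrow> f x = 1"
    "\<And>x. x \<notin> cball x0 (2 * r) \<Longrightarrow> f x = 0"
proof -
  \<comment> \<open>A smooth step: 0 for t at most 0 and 1 for t at least 1. The denominator is
    positive because t or 1 - t is.\<close>
  define g where "g t = flat 0 t * inverse (flat 0 t + flat 0 (1 - t))" for t
  \<comment> \<open>The squared distance keeps \<open>q\<close> smooth at the centre. The value is
    at least 1 within radius \<open>r\<close> and at most 0 from radius sqrt 2 times
    \<open>r\<close> on, hence beyond \<open>2 * r\<close>.\<close>
  define q where "q x = 2 - (x - x0) \<bullet> (x - x0) * inverse (r * r)" for x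
  have pos: "flat 0 t + flat 0 (1 - t) \<noteq> 0" for t
    by (auto simp: flat_def add_pos_pos less_imp_neq[symmetric] intro!: add_pos_pos)
  have fl: "smooth_on UNIV (\<lambda>t. flat 0 (1 - t))"
    by (rule real_fd.smooth_on_compose[OF smooth_on_flat[of UNIV]])
       (auto intro!: smooth_on_diff smooth_on_const smooth_on_ident)
  have g: "smooth_on UNIV g"
    unfolding g_def by (intro smooth_on_mult smooth_on_inverse smooth_on_add smooth_on_flat fl pos open_UNIV)
  have q: "smooth_on UNIV q"
    unfolding q_def
    by (intro smooth_on_mult smooth_on_diff smooth_on_inner smooth_on_const smooth_on_ident open_UNIV)
  have "smooth_on UNIV (\<lambda>x. g (q x))"
    by (rule real_fd.smooth_on_compose[OF g q]) auto
  moreover have "g (q x) = 1" if "x \<in> ball x0 r" for x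
  proof -
    have "norm (x - x0) * norm (x - x0) \<le> r * r"
      using that assms by (intro mult_mono) (auto simp: dist_norm norm_minus_commute)
    then have "q x \<ge> 1"
      using assms by (simp add: q_def dot_square_norm power2_eq_square field_simps)
    then show ?thesis by (simp add: g_def flat_def)
  qed
  moreover have "g (q x) = 0" if "x \<notin> cball x0 (2 * r)" for x
  proof -
    have "(2 * r) * (2 * r) \<le> norm (x - x0) * norm (x - x0)"
      using that assms by (intro mult_mono) (auto simp: dist_norm norm_minus_commute)
    moreover have "2 * (r * r) \<le> (2 * r) * (2 * r)" by simp
    ultimately have "2 * (r * r) \<le> norm (x - x0) * norm (x - x0)" by linarith
    then have "q x \<le> 0"
      using assms by (simp add: q_def dot_square_norm power2_eq_square field_simps)
    then show ?thesis by (simp add: g_def flat_def)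
  qed
  ultimately show thesis by (rule that)
qed

end

section \<open>Invariance of the coordinate formulas under a change of coordinates\<close>

lemma fd_compose:
  assumes "g differentiable at x" "f differentiable at (g x)"
  shows "fd (\<lambda>y. f (g y)) x h = fd f (g x) (fd g x h)"
  using fd_eq[OF has_derivative_compose[OF assms(1)[unfolded frechet_derivative_works]
      assms(2)[unfolded frechet_derivative_works]]] by simp

lemma fd_uminus: "f differentiable at x \<Longrightarrow> fd (\<lambda>y. - f y) x h = - fd f x h"
  using fd_eq[OF has_derivative_minus] by (metis frechet_derivative_works)

text \<open>The coordinate expressions of the Lie bracket, of the Lie derivative of a covector field, and of
  the exterior derivative in degrees 1 and 2.\<close>

definition ebracket :: "('b::real_normed_vector \<Rightarrow> 'b) \<Rightarrow> ('b \<Rightarrow> 'b) \<Rightarrow> 'b \<Rightarrow> 'b" where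
  "ebracket X Y x = fd Y x (X x) - fd X x (Y x)"

definition elie :: "('b::real_normed_vector \<Rightarrow> 'b) \<Rightarrow> ('b \<Rightarrow> 'b \<Rightarrow> real) \<Rightarrow> 'b \<Rightarrow> 'b \<Rightarrow> real" where
  "elie X b x v = fd (\<lambda>y. b y v) x (X x) + b x (fd X x v)"

definition ed1 :: "('b::real_normed_vector \<Rightarrow> 'b \<Rightarrow> real) \<Rightarrow> 'b \<Rightarrow> 'b \<Rightarrow> 'b \<Rightarrow> real" where
  "ed1 a x u v = fd (\<lambda>y. a y v) x u - fd (\<lambda>y. a y u) x v"

definition ed2 :: "('b::real_normed_vector \<Rightarrow> 'b \<Rightarrow> 'b \<Rightarrow> real) \<Rightarrow> 'b \<Rightarrow> 'b \<Rightarrow> 'b \<Rightarrow> 'b \<Rightarrow> real" where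
  "ed2 W x u v w = fd (\<lambda>y. W y v w) x u - fd (\<lambda>y. W y u w) x v + fd (\<lambda>y. W y u v) x w"

context finite_dim_inner
begin

text \<open>Differentiating the relation between \<open>X\<close> and its pushforward
  \<open>X'\<close> produces a second derivative of \<open>T\<close>. The naturality statements
  below hold because such terms cancel or match by symmetry.\<close>

lemma fd_pushforward:
  fixes X X' T :: "'b \<Rightarrow> 'b"
  assumes S: "open S" "x \<in> S" and T: "smooth_on S T"
    and X: "X differentiable at x" and X': "X' differentiable at (T x)"
    and XX': "\<And>y. y \<in> S \<Longrightarrow> X' (T y) = fd T y (X y)"
  shows "fd X' (T x) (fd T x h) = fd (\<lambda>y. fd T y (X x)) x h + fd T x (fd X x h)"
proof -
  have dT: "T differentiable at y" if "y \<in> S" for y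
    using T that by (rule smooth_on_imp_differentiable)
  have dX'T: "(\<lambda>y. X' (T y)) differentiable at x"
    using differentiable_chain_at[OF dT[OF S(2)] X'] by (simp add: comp_def)
  have "fd X' (T x) (fd T x h) = fd (\<lambda>y. X' (T y)) x h"
    by (rule fd_compose[OF dT[OF S(2)] X', symmetric])
  also have "fd (\<lambda>y. X' (T y)) x = fd (\<lambda>y. fd T y (X y)) x"
    by (rule fd_transform[OF dX'T S]) (rule XX')
  also have "\<dots> h = fd (\<lambda>y. fd T y (X x)) x h + fd T x (fd X x h)"
  proof (rule fd_eval[OF S _ _ X])
    show "linear (fd T y)" if "y \<in> S" for y
      using dT[OF that] by (rule linear_frechet_derivative)
    show "(\<lambda>y. fd T y v) differentiable at x" for v
      using smooth_on_fd[OF T] S(2) by (rule smooth_on_imp_differentiable)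
  qed
  finally show ?thesis .
qed

text \<open>The second derivatives of \<open>T\<close> contributed by the two fields are equal by
  symmetry, and the bracket subtracts them.\<close>

lemma ebracket_natural:
  fixes X Y X' Y' T :: "'b \<Rightarrow> 'b"
  assumes S: "open S" "x \<in> S" and T: "smooth_on S T"
    and X: "X differentiable at x" and X': "X' differentiable at (T x)"
    and Y: "Y differentiable at x" and Y': "Y' differentiable at (T x)"
    and XX': "\<And>y. y \<in> S \<Longrightarrow> X' (T y) = fd T y (X y)"
    and YY': "\<And>y. y \<in> S \<Longrightarrow> Y' (T y) = fd T y (Y y)"
  shows "ebracket X' Y' (T x) = fd T x (ebracket X Y x)"
proof -
  have lin: "linear (fd T x)"
    using T S(2) by (intro linear_frechet_derivative smooth_on_imp_differentiable)
  have "fd (\<lambda>y. fd T y (Y x)) x (X x) = fd (\<lambda>y. fd T y (X x)) x (Y x)"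
    by (rule second_derivative_symmetric[OF T S])
  moreover have "fd X' (T x) (fd T x h) = fd (\<lambda>y. fd T y (X x)) x h + fd T x (fd X x h)" for h
    by (rule fd_pushforward[OF S T X X' XX'])
  moreover have "fd Y' (T x) (fd T x h) = fd (\<lambda>y. fd T y (Y x)) x h + fd T x (fd Y x h)" for h
    by (rule fd_pushforward[OF S T Y Y' YY'])
  ultimately show ?thesis
    unfolding ebracket_def XX'[OF S(2)] YY'[OF S(2)] by (simp add: linear_diff[OF lin])
qed

text \<open>The covector counterpart of \<open>fd_pushforward\<close>: the last term, with the
  second derivative of \<open>T\<close>, is symmetric in \<open>v\<close> and \<open>h\<close> and
  so drops out of the antisymmetrised derivative.\<close>

lemma fd_pullback1:
  fixes T :: "'b \<Rightarrow> 'b" and b' :: "'b \<Rightarrow> 'b \<Rightarrow> real"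
  assumes S: "open S" "x \<in> S" and T: "smooth_on S T"
    and lin: "\<And>y. y \<in> S \<Longrightarrow> linear (b' (T y))" and b': "\<And>v. (\<lambda>z. b' z v) differentiable at (T x)"
    and bb': "\<And>y v. y \<in> S \<Longrightarrow> b y v = b' (T y) (fd T y v)"
  shows "fd (\<lambda>y. b y v) x h
    = fd (\<lambda>z. b' z (fd T x v)) (T x) (fd T x h) + b' (T x) (fd (\<lambda>y. fd T y v) x h)"
proof -
  have dT: "T differentiable at x" using T S(2) by (rule smooth_on_imp_differentiable)
  have dfT: "(\<lambda>y. fd T y v) differentiable at x"
    using smooth_on_fd[OF T] S(2) by (rule smooth_on_imp_differentiable)
  have d: "(\<lambda>y. b' (T y) v) differentiable at x" for v
    using differentiable_chain_at[OF dT b'] by (simp add: comp_def)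
  have "fd (\<lambda>y. b' (T y) (fd T y v)) x = fd (\<lambda>y. b y v) x"
  proof (rule fd_transform[OF _ S])
    show "(\<lambda>y. b' (T y) (fd T y v)) differentiable at x"
      by (rule differentiable_eval[where \<beta> = "\<lambda>y. b' (T y)", OF S lin d dfT])
  qed (rule bb'[symmetric])
  then have "fd (\<lambda>y. b y v) x h = fd (\<lambda>y. b' (T y) (fd T y v)) x h" by simp
  also have "\<dots> = fd (\<lambda>y. b' (T y) (fd T x v)) x h + b' (T x) (fd (\<lambda>y. fd T y v) x h)"
    by (rule fd_eval[where \<beta> = "\<lambda>y. b' (T y)", OF S lin d dfT])
  also have "fd (\<lambda>y. b' (T y) (fd T x v)) x h = fd (\<lambda>z. b' z (fd T x v)) (T x) (fd T x h)"
    by (rule fd_compose[where f = "\<lambda>z. b' z (fd T x v)", OF dT b'])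
  finally show ?thesis .
qed

lemma ed1_natural:
  fixes T :: "'b \<Rightarrow> 'b" and b' :: "'b \<Rightarrow> 'b \<Rightarrow> real"
  assumes S: "open S" "x \<in> S" and T: "smooth_on S T"
    and lin: "\<And>y. y \<in> S \<Longrightarrow> linear (b' (T y))" and b': "\<And>v. (\<lambda>z. b' z v) differentiable at (T x)"
    and bb': "\<And>y v. y \<in> S \<Longrightarrow> b y v = b' (T y) (fd T y v)"
  shows "ed1 b x u v = ed1 b' (T x) (fd T x u) (fd T x v)"
proof -
  have "fd (\<lambda>y. b y v) x h
      = fd (\<lambda>z. b' z (fd T x v)) (T x) (fd T x h) + b' (T x) (fd (\<lambda>y. fd T y v) x h)" for v h
    by (rule fd_pullback1[where b = b and b' = b', OF S T lin b' bb'])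
  then show ?thesis
    using second_derivative_symmetric[OF T S, of u v] by (simp add: ed1_def)
qed

text \<open>The second derivative of \<open>T\<close> occurs once on each side: on the left through
  the pullback of \<open>b'\<close>, on the right through the pushforward of
  \<open>X\<close>.\<close>

lemma elie_natural:
  fixes X X' T :: "'b \<Rightarrow> 'b" and b' :: "'b \<Rightarrow> 'b \<Rightarrow> real"
  assumes S: "open S" "x \<in> S" and T: "smooth_on S T"
    and lin: "\<And>y. y \<in> S \<Longrightarrow> linear (b' (T y))" and b': "\<And>v. (\<lambda>z. b' z v) differentiable at (T x)"
    and bb': "\<And>y v. y \<in> S \<Longrightarrow> b y v = b' (T y) (fd T y v)"
    and X: "X differentiable at x" and X': "X' differentiable at (T x)"
    and XX': "\<And>y. y \<in> S \<Longrightarrow> X' (T y) = fd T y (X y)"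
  shows "elie X b x v = elie X' b' (T x) (fd T x v)"
proof -
  have "fd (\<lambda>y. b y v) x h
      = fd (\<lambda>z. b' z (fd T x v)) (T x) (fd T x h) + b' (T x) (fd (\<lambda>y. fd T y v) x h)" for v h
    by (rule fd_pullback1[where b = b and b' = b', OF S T lin b' bb'])
  moreover have "fd X' (T x) (fd T x v) = fd (\<lambda>y. fd T y (X x)) x v + fd T x (fd X x v)"
    by (rule fd_pushforward[OF S T X X' XX'])
  ultimately show ?thesis
    using second_derivative_symmetric[OF T S, of "X x" v]
    unfolding elie_def bb'[OF S(2)] XX'[OF S(2)] by (simp add: linear_add[OF lin[OF S(2)]])
qed

lemma fd_pullback2:
  fixes T :: "'b \<Rightarrow> 'b" and W' :: "'b \<Rightarrow> 'b \<Rightarrow> 'b \<Rightarrow> real"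
  assumes S: "open S" "x \<in> S" and T: "smooth_on S T"
    and lin1: "\<And>y v. y \<in> S \<Longrightarrow> linear (\<lambda>u. W' (T y) u v)" and lin2: "\<And>y u. y \<in> S \<Longrightarrow> linear (W' (T y) u)"
    and W': "\<And>u v. (\<lambda>z. W' z u v) differentiable at (T x)"
    and WW': "\<And>y u v. y \<in> S \<Longrightarrow> W y u v = W' (T y) (fd T y u) (fd T y v)"
  shows "fd (\<lambda>y. W y u v) x h
    = fd (\<lambda>z. W' z (fd T x u) (fd T x v)) (T x) (fd T x h)
      + W' (T x) (fd (\<lambda>y. fd T y u) x h) (fd T x v) + W' (T x) (fd T x u) (fd (\<lambda>y. fd T y v) x h)"
proof -
  have dT: "T differentiable at x" using T S(2) by (rule smooth_on_imp_differentiable)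
  have dfT: "(\<lambda>y. fd T y v) differentiable at x" for v
    using smooth_on_fd[OF T] S(2) by (rule smooth_on_imp_differentiable)
  have d: "(\<lambda>y. W' (T y) u v) differentiable at x" for u v
    using differentiable_chain_at[OF dT W'] by (simp add: comp_def)
  have "fd (\<lambda>y. W' (T y) (fd T y u) (fd T y v)) x = fd (\<lambda>y. W y u v) x"
  proof (rule fd_transform[OF _ S])
    show "(\<lambda>y. W' (T y) (fd T y u) (fd T y v)) differentiable at x"
      by (rule differentiable_eval2[where W = "\<lambda>y. W' (T y)", OF S lin1 lin2 d dfT dfT])
  qed (rule WW'[symmetric])
  then have "fd (\<lambda>y. W y u v) x h = fd (\<lambda>y. W' (T y) (fd T y u) (fd T y v)) x h" by simp
  also have "\<dots> = fd (\<lambda>y. W' (T y) (fd T x u) (fd T x v)) x h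
      + W' (T x) (fd (\<lambda>y. fd T y u) x h) (fd T x v) + W' (T x) (fd T x u) (fd (\<lambda>y. fd T y v) x h)"
    by (rule fd_eval2[where W = "\<lambda>y. W' (T y)", OF S lin1 lin2 d dfT dfT])
  also have "fd (\<lambda>y. W' (T y) (fd T x u) (fd T x v)) x h
      = fd (\<lambda>z. W' z (fd T x u) (fd T x v)) (T x) (fd T x h)"
    by (rule fd_compose[where f = "\<lambda>z. W' z (fd T x u) (fd T x v)", OF dT W'])
  finally show ?thesis .
qed

text \<open>The pullback rule yields six terms with second derivatives of \<open>T\<close>. They
  form three pairs that cancel by symmetry of these derivatives together with skewness of
  \<open>W'\<close>.\<close>

lemma ed2_natural:
  fixes T :: "'b \<Rightarrow> 'b" and W' :: "'b \<Rightarrow> 'b \<Rightarrow> 'b \<Rightarrow> real"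
  assumes S: "open S" "x \<in> S" and T: "smooth_on S T"
    and lin1: "\<And>y v. y \<in> S \<Longrightarrow> linear (\<lambda>u. W' (T y) u v)" and lin2: "\<And>y u. y \<in> S \<Longrightarrow> linear (W' (T y) u)"
    and W': "\<And>u v. (\<lambda>z. W' z u v) differentiable at (T x)"
    and skew: "\<And>u v. W' (T x) u v = - W' (T x) v u"
    and WW': "\<And>y u v. y \<in> S \<Longrightarrow> W y u v = W' (T y) (fd T y u) (fd T y v)"
  shows "ed2 W x u v w = ed2 W' (T x) (fd T x u) (fd T x v) (fd T x w)"
proof -
  have 1: "fd (\<lambda>y. fd T y v) x u = fd (\<lambda>y. fd T y u) x v"
    "fd (\<lambda>y. fd T y w) x u = fd (\<lambda>y. fd T y u) x w"
    "fd (\<lambda>y. fd T y w) x v = fd (\<lambda>y. fd T y v) x w"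
    by (rule second_derivative_symmetric[OF T S])+
  have "fd (\<lambda>y. W y u v) x h
    = fd (\<lambda>z. W' z (fd T x u) (fd T x v)) (T x) (fd T x h)
      + W' (T x) (fd (\<lambda>y. fd T y u) x h) (fd T x v) + W' (T x) (fd T x u) (fd (\<lambda>y. fd T y v) x h)"
    for u v h
    by (rule fd_pullback2[where W = W and W' = W', OF S T lin1 lin2 W' WW'])
  then show ?thesis
    using skew[of "fd T x u" "fd (\<lambda>y. fd T y v) x w"] skew[of "fd T x v" "fd (\<lambda>y. fd T y u) x w"] by (simp add: ed2_def 1)
qed

end

section \<open>Charts\<close>

lemma is_chartD:
  assumes "is_chart c"
  shows "open (dom_of c)" "open (coord c ` dom_of c)"
    "p \<in> dom_of c \<Longrightarrow> param c (coord c p) = p"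
    "x \<in> coord c ` dom_of c \<Longrightarrow> coord c (param c x) = x"
    "x \<in> coord c ` dom_of c \<Longrightarrow> param c x \<in> dom_of c"
    "continuous_on (dom_of c) (coord c)" "continuous_on (coord c ` dom_of c) (param c)"
  using assms unfolding is_chart_def homeomorphism_def by auto

lemma open_coord_image:
  assumes "is_chart c" "open U"
  shows "open (coord c ` (dom_of c \<inter> U))"
proof -
  have "coord c ` (dom_of c \<inter> U) = coord c ` dom_of c \<inter> param c -` U"
    using is_chartD(3-5)[OF assms(1)] by force
  then show ?thesis
    using continuous_open_preimage[OF is_chartD(7,2)[OF assms(1)] assms(2)] by simp
qed

abbreviation chart_trans :: "('a, 'b) chart \<Rightarrow> ('a, 'b) chart \<Rightarrow> 'b \<Rightarrow> 'b" where
  "chart_trans c c' \<equiv> coord c' \<circ> param c"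

lemma smooth_transition_differentiable:
  assumes "smooth_transition c c'" "p \<in> dom_of c" "p \<in> dom_of c'"
  shows "chart_trans c c' differentiable at (coord c p)"
  using assms unfolding smooth_transition_def by (intro smooth_on_imp_differentiable) auto

text \<open>The chain rule for transition maps. Since \<open>dchart\<close> and
  \<open>dparam\<close> are derivatives of transitions out of and into \<open>chart_at A p\<close>,
  their inverse and change-of-chart rules are instances of this.\<close>

lemma fd_trans_cocycle:
  assumes c: "is_chart c" "is_chart c'" and s: "smooth_transition c c'" "smooth_transition c' c''"
    and p: "p \<in> dom_of c" "p \<in> dom_of c'" "p \<in> dom_of c''"
  shows "fd (chart_trans c c'') (coord c p) v = fd (chart_trans c' c'') (coord c' p) (fd (chart_trans c c') (coord c p) v)"
proof -
  have p': "chart_trans c c' (coord c p) = coord c' p" using is_chartD(3)[OF c(1) p(1)] by simp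
  have d: "chart_trans c c' differentiable at (coord c p)" "chart_trans c' c'' differentiable at (chart_trans c c' (coord c p))"
    unfolding p' using s p by (auto intro!: smooth_transition_differentiable)
  have "fd (\<lambda>y. chart_trans c' c'' (chart_trans c c' y)) (coord c p) = fd (chart_trans c c'') (coord c p)"
  proof (rule fd_transform)
    show "(\<lambda>y. chart_trans c' c'' (chart_trans c c' y)) differentiable at (coord c p)"
      using differentiable_chain_at[OF d] by (simp add: comp_def)
    show "open (coord c ` (dom_of c \<inter> dom_of c'))"
      using c by (intro open_coord_image is_chartD)
    show "coord c p \<in> coord c ` (dom_of c \<inter> dom_of c')" using p by blast
    show "chart_trans c' c'' (chart_trans c c' y) = chart_trans c c'' y" if "y \<in> coord c ` (dom_of c \<inter> dom_of c')" for y
      using that is_chartD(3)[OF c(1)] is_chartD(3)[OF c(2)] by auto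
  qed
  then show ?thesis
    using fd_compose[OF d] p' by metis
qed

lemma fd_trans_same:
  assumes c: "is_chart c" and p: "p \<in> dom_of c"
  shows "fd (chart_trans c c) (coord c p) v = v"
proof -
  have "fd (\<lambda>y. y) (coord c p) = fd (chart_trans c c) (coord c p)"
    by (rule fd_transform[OF _ is_chartD(2)[OF c]]) (use p is_chartD(4)[OF c] in auto)
  then show ?thesis by (metis frechet_derivative_ident)
qed

section \<open>Tangent maps, representatives of fields and the Lie bracket on a manifold\<close>

locale manifold = finite_dim_inner E for E :: "'b::real_inner set" +
  fixes A :: "('a::{t2_space,second_countable_topology}, 'b) chart set"
  assumes A: "smooth_manifold A"
begin

lemma A_is_chart: "c \<in> A \<Longrightarrow> is_chart c"
  using A by (simp add: smooth_manifold_def)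

lemma A_transition: "c \<in> A \<Longrightarrow> c' \<in> A \<Longrightarrow> smooth_transition c c'"
  using A by (simp add: smooth_manifold_def)

lemma A_compatible: "c \<in> A \<Longrightarrow> compatible_chart A c"
  using A by (auto simp: smooth_manifold_def compatible_chart_def)

lemma compatible_is_chart: "compatible_chart A c \<Longrightarrow> is_chart c"
  by (simp add: compatible_chart_def)

lemma compatible_transition:
  "compatible_chart A c' \<Longrightarrow> c \<in> A \<Longrightarrow> smooth_transition c c'"
  "compatible_chart A c' \<Longrightarrow> c \<in> A \<Longrightarrow> smooth_transition c' c"
  by (auto simp add: compatible_chart_def)

lemma chart_at: "chart_at A p \<in> A" "p \<in> dom_of (chart_at A p)"
proof -
  have "p \<in> (\<Union>c\<in>A. dom_of c)" using A by (simp add: smooth_manifold_def)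
  then have "\<exists>c. c \<in> A \<and> p \<in> dom_of c" by blast
  from someI_ex[OF this] show "chart_at A p \<in> A" "p \<in> dom_of (chart_at A p)"
    unfolding chart_at_def by auto
qed

lemma dparam_dchart:
  assumes "compatible_chart A c" "p \<in> dom_of c"
  shows "dparam A c p (dchart A c p v) = v" "dchart A c p (dparam A c p v) = v"
proof -
  note a = chart_at[of p] A_is_chart[OF chart_at(1)] compatible_is_chart[OF assms(1)]
    compatible_transition[OF assms(1) chart_at(1)]
  show "dparam A c p (dchart A c p v) = v" "dchart A c p (dparam A c p v) = v"
    unfolding dparam_def dchart_def
    using fd_trans_cocycle[of "chart_at A p" c "chart_at A p" p v, OF a(3,4,5,6) a(2) assms(2) a(2)]
      fd_trans_cocycle[of c "chart_at A p" c p v, OF a(4,3,6,5) assms(2) a(2) assms(2)]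
      fd_trans_same[OF a(3) a(2)] fd_trans_same[OF a(4) assms(2)]
    by simp_all
qed

lemma linear_dchart: "compatible_chart A c \<Longrightarrow> p \<in> dom_of c \<Longrightarrow> linear (dchart A c p)"
  unfolding dchart_def
  by (intro linear_frechet_derivative smooth_transition_differentiable compatible_transition chart_at)

lemma linear_dparam: "compatible_chart A c \<Longrightarrow> p \<in> dom_of c \<Longrightarrow> linear (dparam A c p)"
  unfolding dparam_def
  by (intro linear_frechet_derivative smooth_transition_differentiable compatible_transition chart_at)

lemma dchart_change:
  assumes "c \<in> A" "compatible_chart A c'" "p \<in> dom_of c" "p \<in> dom_of c'"
  shows "dchart A c' p v = fd (chart_trans c c') (coord c p) (dchart A c p v)"
  unfolding dchart_def
  by (intro fd_trans_cocycle A_is_chart compatible_transition A_transition chart_at assms)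

lemma dchart_chart_at: "dchart A (chart_at A p) p v = v"
  unfolding dchart_def by (intro fd_trans_same A_is_chart chart_at)

lemma dparam_chart_at: "dparam A (chart_at A p) p v = v"
  unfolding dparam_def by (intro fd_trans_same A_is_chart chart_at)

lemma dparam_change:
  assumes "c \<in> A" "compatible_chart A c'" "p \<in> dom_of c" "p \<in> dom_of c'"
  shows "dparam A c' p (fd (chart_trans c c') (coord c p) v) = dparam A c p v"
proof -
  have "fd (chart_trans c c') (coord c p) v = dchart A c' p (dparam A c p v)"
    using dchart_change[OF assms] dparam_dchart(2)[OF A_compatible[OF assms(1)] assms(3)] by simp
  then show ?thesis using dparam_dchart(1)[OF assms(2,4)] by simp
qed

lemma vec_rep_change:
  assumes "c \<in> A" "compatible_chart A c'" "x \<in> coord c ` (dom_of c \<inter> dom_of c')"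
  shows "vec_rep A c' X (chart_trans c c' x) = fd (chart_trans c c') x (vec_rep A c X x)"
proof -
  note a = A_is_chart[OF assms(1)] compatible_is_chart[OF assms(2)]
  obtain p where p: "p \<in> dom_of c" "p \<in> dom_of c'" "x = coord c p" using assms(3) by blast
  then show ?thesis
    unfolding vec_rep_def using dchart_change[OF assms(1,2) p(1,2)] is_chartD(3)[OF a(1)] is_chartD(3)[OF a(2)]
    by simp
qed

lemma form_rep_change:
  assumes "c \<in> A" "compatible_chart A c'" "x \<in> coord c ` (dom_of c \<inter> dom_of c')"
  shows "form_rep A c \<omega> x vs = form_rep A c' \<omega> (chart_trans c c' x) (map (fd (chart_trans c c') x) vs)"
proof -
  note a = A_is_chart[OF assms(1)] compatible_is_chart[OF assms(2)]
  obtain p where p: "p \<in> dom_of c" "p \<in> dom_of c'" "x = coord c p" using assms(3) by blast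
  have 1: "map (dparam A c' p) (map (fd (chart_trans c c') x) vs) = map (dparam A c p) vs"
    using dparam_change[OF assms(1,2) p(1,2)] p(3) by simp
  have 2: "param c x = p" "param c' (chart_trans c c' x) = p"
    using p is_chartD(3)[OF a(1)] is_chartD(3)[OF a(2)] by simp_all
  show ?thesis unfolding form_rep_def 2 1 ..
qed

lemma vec_rep_chart_at: "vec_rep A (chart_at A p) X (coord (chart_at A p) p) = X p"
  using is_chartD(3)[OF A_is_chart[OF chart_at(1)] chart_at(2)]
  by (simp add: vec_rep_def dchart_chart_at)

lemma form_rep_chart_at: "form_rep A (chart_at A p) \<omega> (coord (chart_at A p) p) vs = \<omega> p vs"
proof -
  have "map (dparam A (chart_at A p) p) vs = vs"
    by (simp add: dparam_chart_at map_idI)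
  then show ?thesis
    using is_chartD(3)[OF A_is_chart[OF chart_at(1)] chart_at(2)] by (simp add: form_rep_def)
qed

text \<open>Smoothness of a field is tested only in charts of \<open>A\<close>, but slice charts of
  integral manifolds merely belong to the maximal atlas. Near each point the representative is
  transported from a chart of \<open>A\<close> by the transition maps.\<close>

lemma smooth_vec_on_compatible:
  assumes U: "open U" and X: "smooth_vec_on A U X" and c': "compatible_chart A c'"
  shows "smooth_on (coord c' ` (dom_of c' \<inter> U)) (vec_rep A c' X)"
proof (rule smooth_on_local)
  note ch' = compatible_is_chart[OF c']
  fix x assume "x \<in> coord c' ` (dom_of c' \<inter> U)"
  then obtain p where p: "p \<in> dom_of c'" "p \<in> U" "x = coord c' p" by blast
  define c where "c = chart_at A p"
  have c: "c \<in> A" "p \<in> dom_of c" unfolding c_def by (rule chart_at)+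
  note ch = A_is_chart[OF c(1)]
  define S where "S = coord c' ` (dom_of c' \<inter> (dom_of c \<inter> U))"
  have S: "open S" "x \<in> S" unfolding S_def
    using p c U by (auto intro!: open_coord_image[OF ch'] open_Int is_chartD(1)[OF ch])
  have T: "smooth_on S (chart_trans c' c)"
    using compatible_transition(2)[OF c' c(1)] unfolding smooth_transition_def S_def
    by (rule smooth_on_subset) auto
  have T': "smooth_on (coord c ` (dom_of c \<inter> dom_of c')) (chart_trans c c')"
    using compatible_transition(1)[OF c' c(1)] unfolding smooth_transition_def .
  define O1 where "O1 = coord c ` (dom_of c \<inter> (dom_of c' \<inter> U))"
  have TS: "chart_trans c' c ` S \<subseteq> O1"
    unfolding S_def O1_def using is_chartD(3)[OF ch'] by auto
  have O1: "open O1" unfolding O1_def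
    by (intro open_coord_image[OF ch] open_Int is_chartD(1)[OF ch'] U)
  have "smooth_on (coord c ` (dom_of c \<inter> U)) (vec_rep A c X)"
    using X c(1) by (simp add: smooth_vec_on_def)
  then have X1: "smooth_on O1 (vec_rep A c X)"
    by (rule smooth_on_subset) (auto simp: O1_def)
  have T1: "smooth_on O1 (chart_trans c c')"
    using T' by (rule smooth_on_subset) (auto simp: O1_def)
  have "smooth_on S (\<lambda>z. fd (chart_trans c c') (chart_trans c' c z) (vec_rep A c X (chart_trans c' c z)))"
    by (rule smooth_on_compose[OF smooth_on_fd_eval[OF T1 X1 O1] T S(1) TS])
  then have "smooth_on S (vec_rep A c' X)"
  proof (rule smooth_on_cong[OF _ S(1)])
    fix z assume "z \<in> S"
    then obtain q where q: "q \<in> dom_of c'" "q \<in> dom_of c" "q \<in> U" "z = coord c' q"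
      unfolding S_def by blast
    have "chart_trans c' c z = coord c q" using q is_chartD(3)[OF ch'] by simp
    moreover have "vec_rep A c' X (chart_trans c c' (coord c q)) = fd (chart_trans c c') (coord c q) (vec_rep A c X (coord c q))"
      using q by (intro vec_rep_change c(1) c') auto
    moreover have "chart_trans c c' (coord c q) = z" using q is_chartD(3)[OF ch] by simp
    ultimately show "fd (chart_trans c c') (chart_trans c' c z) (vec_rep A c X (chart_trans c' c z)) = vec_rep A c' X z" by metis
  qed
  then show "\<exists>T. open T \<and> x \<in> T \<and> smooth_on T (vec_rep A c' X)" using S by blast
qed

lemma lie_bracket_chart_at:
  "lie_bracket A X Y p = ebracket (vec_rep A (chart_at A p) X) (vec_rep A (chart_at A p) Y) (coord (chart_at A p) p)"
  by (simp add: lie_bracket_def ebracket_def vec_rep_chart_at Let_def)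

text \<open>The bracket at \<open>p\<close> is computed in \<open>chart_at A p\<close>, a chart that
  may jump with \<open>p\<close>. Naturality gives one formula valid throughout a fixed chart, which
  both smoothness and the slice argument require.\<close>

lemma dchart_lie_bracket:
  assumes U: "open U" "p \<in> U" and X: "smooth_vec_on A U X" and Y: "smooth_vec_on A U Y"
    and c': "compatible_chart A c'" "p \<in> dom_of c'"
  shows "dchart A c' p (lie_bracket A X Y p) = ebracket (vec_rep A c' X) (vec_rep A c' Y) (coord c' p)"
proof -
  define c where "c = chart_at A p"
  have c: "c \<in> A" "p \<in> dom_of c" unfolding c_def by (rule chart_at)+
  note ch = A_is_chart[OF c(1)] and ch' = compatible_is_chart[OF c'(1)]
  have S: "open (coord c ` (dom_of c \<inter> dom_of c'))" "coord c p \<in> coord c ` (dom_of c \<inter> dom_of c')"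
    using c c' by (auto intro!: open_coord_image[OF ch] is_chartD(1)[OF ch'])
  have T: "smooth_on (coord c ` (dom_of c \<inter> dom_of c')) (chart_trans c c')"
    using compatible_transition(1)[OF c'(1) c(1)] unfolding smooth_transition_def .
  have Tp: "chart_trans c c' (coord c p) = coord c' p" using is_chartD(3)[OF ch c(2)] by simp
  have d: "vec_rep A d Z differentiable at (coord d p)"
    if "compatible_chart A d" "p \<in> dom_of d" "smooth_vec_on A U Z" for d Z
    using smooth_vec_on_compatible[OF U(1) that(3,1)]
    by (rule smooth_on_imp_differentiable) (use that U in blast)
  have "ebracket (vec_rep A c' X) (vec_rep A c' Y) (chart_trans c c' (coord c p))
    = fd (chart_trans c c') (coord c p) (ebracket (vec_rep A c X) (vec_rep A c Y) (coord c p))"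
    by (intro ebracket_natural[OF S T] d X Y A_compatible c vec_rep_change c' |
      (subst Tp, intro d X Y c'))+
  also have "\<dots> = fd (chart_trans c c') (coord c p) (dchart A c p (lie_bracket A X Y p))"
    unfolding c_def lie_bracket_chart_at dchart_chart_at ..
  also have "\<dots> = dchart A c' p (lie_bracket A X Y p)"
    by (rule dchart_change[OF c(1) c'(1) c(2) c'(2), symmetric])
  finally show ?thesis unfolding Tp by simp
qed

lemma smooth_vec_lie_bracket:
  assumes U: "open U" and X: "smooth_vec_on A U X" and Y: "smooth_vec_on A U Y"
  shows "smooth_vec_on A U (lie_bracket A X Y)"
  unfolding smooth_vec_on_def
proof
  fix c assume c: "c \<in> A"
  note ch = A_is_chart[OF c]
  let ?S = "coord c ` (dom_of c \<inter> U)"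
  have S: "open ?S" by (rule open_coord_image[OF ch U])
  have r: "smooth_on ?S (vec_rep A c X)" "smooth_on ?S (vec_rep A c Y)"
    using X Y c by (simp_all add: smooth_vec_on_def)
  have "smooth_on ?S (ebracket (vec_rep A c X) (vec_rep A c Y))"
    unfolding ebracket_def by (intro smooth_on_diff smooth_on_fd_eval r S)
  then show "smooth_on ?S (vec_rep A c (lie_bracket A X Y))"
  proof (rule smooth_on_cong[OF _ S])
    fix x assume "x \<in> ?S"
    then obtain p where p: "p \<in> dom_of c" "p \<in> U" "x = coord c p" by blast
    show "ebracket (vec_rep A c X) (vec_rep A c Y) x = vec_rep A c (lie_bracket A X Y) x"
      using dchart_lie_bracket[OF U p(2) X Y A_compatible[OF c] p(1)] is_chartD(3)[OF ch p(1)] p(3)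
      by (simp add: vec_rep_def)
  qed
qed

end

section \<open>Forms and the Courant bracket in charts\<close>

lemma alternating_multilinear_2_iff:
  "alternating_multilinear 2 \<mu> \<longleftrightarrow>
    (\<forall>v. linear (\<lambda>u. \<mu> [u, v])) \<and> (\<forall>u. linear (\<lambda>v. \<mu> [u, v])) \<and> (\<forall>u. \<mu> [u, u] = 0)"
  (is "?L \<longleftrightarrow> ?R")
proof
  assume L: ?L
  have 1: "linear (\<lambda>v. \<mu> ([a, b][i := v]))" if "i < 2" for a b i
    using L that unfolding alternating_multilinear_def by (elim allE[of _ "[a, b]"]) simp
  have 2: "\<mu> [a, b] = 0" if "i < 2" "j < 2" "i \<noteq> j" "[a, b] ! i = [a, b] ! j" for a b i j
    using L that unfolding alternating_multilinear_def by (elim allE[of _ "[a, b]"]) auto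
  have "linear (\<lambda>u. \<mu> [u, v])" for v
    using 1[of 0] by simp
  moreover have "linear (\<lambda>v. \<mu> [u, v])" for u
    using 1[of 1] by simp
  moreover have "\<mu> [u, u] = 0" for u
    by (rule 2[of 0 1]) simp_all
  ultimately show ?R by blast
next
  assume R: ?R
  show ?L
    unfolding alternating_multilinear_def
  proof (intro allI impI)
    fix vs :: "'a list" assume "length vs = 2"
    then obtain a b where vs: "vs = [a, b]" by (auto simp: numeral_2_eq_2 length_Suc_conv)
    show "(\<forall>i<2. linear (\<lambda>v. \<mu> (vs[i := v]))) \<and>
      (\<forall>i<2. \<forall>j<2. i \<noteq> j \<and> vs ! i = vs ! j \<longrightarrow> \<mu> vs = 0)"
      using R by (auto simp: vs less_2_cases_iff)
  qed
qed

lemma alternating_multilinear_3I: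
  assumes "\<And>b c. linear (\<lambda>a. \<mu> [a, b, c])" "\<And>a c. linear (\<lambda>b. \<mu> [a, b, c])" "\<And>a b. linear (\<lambda>c. \<mu> [a, b, c])"
    and "\<And>a b. \<mu> [a, a, b] = 0" "\<And>a b. \<mu> [a, b, a] = 0" "\<And>a b. \<mu> [b, a, a] = 0"
  shows "alternating_multilinear 3 \<mu>"
  unfolding alternating_multilinear_def
proof (intro allI impI)
  fix vs :: "'a list" assume "length vs = 3"
  then obtain a b c where vs: "vs = [a, b, c]" by (auto simp: numeral_3_eq_3 length_Suc_conv)
  have less_3: "i < 3 \<longleftrightarrow> i = 0 \<or> i = 1 \<or> i = 2" for i :: nat by auto
  show "(\<forall>i<3. linear (\<lambda>v. \<mu> (vs[i := v]))) \<and>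
      (\<forall>i<3. \<forall>j<3. i \<noteq> j \<and> vs ! i = vs ! j \<longrightarrow> \<mu> vs = 0)"
    unfolding vs less_3 using assms by auto
qed

lemma fd_add:
  assumes "f differentiable at x" "g differentiable at x"
  shows "fd (\<lambda>y. f y + g y) x h = fd f x h + fd g x h"
  using fd_eq[OF has_derivative_add[OF assms[unfolded frechet_derivative_works]]] by simp

lemma fd_diff:
  assumes "f differentiable at x" "g differentiable at x"
  shows "fd (\<lambda>y. f y - g y) x h = fd f x h - fd g x h"
  using fd_eq[OF has_derivative_diff[OF assms[unfolded frechet_derivative_works]]] by simp

text \<open>Differentiation in the base point commutes with sums and multiples in the argument, so
  the derivative of a form remains linear in the arguments of the form.\<close>

lemma linear_fd_param:
  fixes a :: "'b::real_normed_vector \<Rightarrow> 'c::real_vector \<Rightarrow> real"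
  assumes S: "open S" "x \<in> S" and lin: "\<And>y. y \<in> S \<Longrightarrow> linear (a y)"
    and d: "\<And>u. (\<lambda>y. a y u) differentiable at x"
  shows "linear (\<lambda>u. fd (\<lambda>y. a y u) x h)"
proof (rule linearI)
  fix u v and r :: real
  have "fd (\<lambda>y. a y (u + v)) x = fd (\<lambda>y. a y u + a y v) x"
    by (rule fd_transform[OF d S]) (simp add: linear_add[OF lin])
  then show "fd (\<lambda>y. a y (u + v)) x h = fd (\<lambda>y. a y u) x h + fd (\<lambda>y. a y v) x h"
    by (simp add: fd_add d)
  have "((\<lambda>y. r *\<^sub>R a y u) has_derivative (\<lambda>h. r *\<^sub>R fd (\<lambda>y. a y u) x h)) (at x)"
    using has_derivative_scaleR_right[OF d[unfolded frechet_derivative_works]] by simp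
  then have "fd (\<lambda>y. r *\<^sub>R a y u) x = (\<lambda>h. r *\<^sub>R fd (\<lambda>y. a y u) x h)" by (rule fd_eq)
  moreover have "fd (\<lambda>y. a y (r *\<^sub>R u)) x = fd (\<lambda>y. r *\<^sub>R a y u) x"
    by (rule fd_transform[OF d S]) (simp add: linear_scale[OF lin])
  ultimately show "fd (\<lambda>y. a y (r *\<^sub>R u)) x h = r *\<^sub>R fd (\<lambda>y. a y u) x h" by simp
qed

text \<open>The coordinate form of d d = 0: expanding gives twelve second derivatives of
  \<open>W\<close>, which cancel in six pairs by symmetry in the two directions of
  differentiation.\<close>

lemma ed2_closed:
  fixes W :: "'b::real_normed_vector \<Rightarrow> 'b \<Rightarrow> 'b \<Rightarrow> real"
  assumes S: "open S" "x \<in> S" and W: "\<And>u v. smooth_on S (\<lambda>y. W y u v)"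
  shows "fd (\<lambda>y. ed2 W y b c d) x a - fd (\<lambda>y. ed2 W y a c d) x b
    + fd (\<lambda>y. ed2 W y a b d) x c - fd (\<lambda>y. ed2 W y a b c) x d = 0"
proof -
  define H where "H u v h k = fd (\<lambda>y. fd (\<lambda>z. W z u v) y h) x k" for u v h k
  have d: "(\<lambda>y. fd (\<lambda>z. W z u v) y h) differentiable at x" for u v h
    by (rule smooth_on_imp_differentiable[OF smooth_on_fd[OF W] S(2)])
  have H: "H u v h k = H u v k h" for u v h k
    unfolding H_def by (rule second_derivative_symmetric[OF W S])
  have "fd (\<lambda>y. ed2 W y u v w) x k = H v w u k - H u w v k + H u v w k" for u v w k
    unfolding ed2_def H_def by (simp add: fd_add fd_diff d)
  then show ?thesis
    using H[of c d a b] H[of b d a c] H[of b c a d] H[of a d b c] H[of a c b d] H[of a b c d]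
    by simp
qed

lemma linear_form_of_covec: "linear (\<lambda>v. form_of_covec \<alpha> p [v])"
  by (simp add: form_of_covec_def bounded_linear.linear[OF blinfun.bounded_linear_right])

context manifold
begin

abbreviation rep1 :: "('a, 'b) chart \<Rightarrow> ('a, 'b) form \<Rightarrow> 'b \<Rightarrow> 'b \<Rightarrow> real" where
  "rep1 c \<omega> x v \<equiv> form_rep A c \<omega> x [v]"

abbreviation rep2 :: "('a, 'b) chart \<Rightarrow> ('a, 'b) form \<Rightarrow> 'b \<Rightarrow> 'b \<Rightarrow> 'b \<Rightarrow> real" where
  "rep2 c \<omega> x u v \<equiv> form_rep A c \<omega> x [u, v]"

lemma open_chart_image: "c \<in> A \<Longrightarrow> open (coord c ` dom_of c)"
  using A_is_chart is_chartD(2) by blast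

lemma smooth_form_rep:
  "smooth_form_on A k UNIV \<omega> \<Longrightarrow> c \<in> A \<Longrightarrow> length vs = k \<Longrightarrow>
    smooth_on (coord c ` dom_of c) (\<lambda>x. form_rep A c \<omega> x vs)"
  unfolding smooth_form_on_def Int_UNIV_right by blast

lemma smooth_vec_rep:
  "smooth_vec_on A UNIV X \<Longrightarrow> c \<in> A \<Longrightarrow> smooth_on (coord c ` dom_of c) (vec_rep A c X)"
  unfolding smooth_vec_on_def Int_UNIV_right by blast

lemma linear_rep1:
  assumes "\<And>q. linear (\<lambda>v. \<omega> q [v])" "c \<in> A" "x \<in> coord c ` dom_of c"
  shows "linear (rep1 c \<omega> x)"
proof -
  have eq: "rep1 c \<omega> x = (\<lambda>v. \<omega> (param c x) [v]) \<circ> dparam A c (param c x)"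
    by (simp add: form_rep_def fun_eq_iff)
  show ?thesis
    unfolding eq
    using linear_dparam[OF A_compatible[OF assms(2)] is_chartD(5)[OF A_is_chart[OF assms(2)] assms(3)]]
    by (rule linear_compose[OF _ assms(1)])
qed

lemma rep2_linear_alt:
  assumes "\<And>q. alternating_multilinear 2 (\<omega> q)" "c \<in> A" "x \<in> coord c ` dom_of c"
  shows "linear (\<lambda>u. rep2 c \<omega> x u v)" "linear (rep2 c \<omega> x u)" "rep2 c \<omega> x u v = - rep2 c \<omega> x v u"
    "rep2 c \<omega> x u u = 0"
proof -
  let ?d = "dparam A c (param c x)"
  have lin: "linear ?d"
    using linear_dparam[OF A_compatible[OF assms(2)]] is_chartD(5)[OF A_is_chart[OF assms(2)] assms(3)] .
  have w: "linear (\<lambda>u. \<omega> q [u, v])" "linear (\<lambda>v. \<omega> q [u, v])" "\<omega> q [u, u] = 0" for q u v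
    using assms(1)[of q] by (simp_all add: alternating_multilinear_2_iff)
  show "linear (\<lambda>u. rep2 c \<omega> x u v)" "linear (rep2 c \<omega> x u)" "rep2 c \<omega> x u u = 0"
    using linear_compose[OF lin w(1)] linear_compose[OF lin w(2)] w(3) by (simp_all add: form_rep_def comp_def)
  \<comment> \<open>Polarisation: vanishing on equal arguments makes the left side 0, which is
    skewness.\<close>
  have "\<omega> q [u + v, u + v] = \<omega> q [u, v] + \<omega> q [v, u]" for q u v
    using w(3)[of q u] w(3)[of q v] by (simp add: linear_add[OF w(1)] linear_add[OF w(2)])
  then show "rep2 c \<omega> x u v = - rep2 c \<omega> x v u"
    using w(3) by (simp add: form_rep_def eq_neg_iff_add_eq_0)
qed

lemma ext_deriv_1: "ext_deriv A \<omega> p [u, v] = ed1 (rep1 (chart_at A p) \<omega>) (coord (chart_at A p) p) u v"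
  by (simp add: ext_deriv_def ed1_def Let_def lessThan_Suc numeral_2_eq_2)

lemma ext_deriv_2: "ext_deriv A \<omega> p [u, v, w] = ed2 (rep2 (chart_at A p) \<omega>) (coord (chart_at A p) p) u v w"
  by (simp add: ext_deriv_def ed2_def Let_def lessThan_Suc numeral_3_eq_3)

text \<open>Everything that the naturality lemmas ask for when an arbitrary chart \<open>c\<close>
  around \<open>p\<close> is compared with the preferred chart at \<open>p\<close>, collected once
  for the one-form, Lie derivative and two-form cases.\<close>

lemma chart_change_setup:
  assumes c: "c \<in> A" "p \<in> dom_of c"
  defines "a \<equiv> chart_at A p"
  defines "S \<equiv> coord c ` (dom_of c \<inter> dom_of a)"
  shows "open S" "coord c p \<in> S" "smooth_on S (chart_trans c a)" "chart_trans c a (coord c p) = coord a p"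
    "fd (chart_trans c a) (coord c p) v = dparam A c p v" "y \<in> S \<Longrightarrow> chart_trans c a y \<in> coord a ` dom_of a"
    "coord a p \<in> coord a ` dom_of a"
    "smooth_form_on A k UNIV \<omega> \<Longrightarrow> length vs = k \<Longrightarrow> (\<lambda>z. form_rep A a \<omega> z vs) differentiable at (coord a p)"
    "y \<in> S \<Longrightarrow> form_rep A c \<omega> y vs = form_rep A a \<omega> (chart_trans c a y) (map (fd (chart_trans c a) y) vs)"
    "y \<in> S \<Longrightarrow> vec_rep A a X (chart_trans c a y) = fd (chart_trans c a) y (vec_rep A c X y)"
proof -
  have a: "a \<in> A" "p \<in> dom_of a" unfolding a_def by (rule chart_at)+
  note ch = A_is_chart[OF c(1)] A_is_chart[OF a(1)]
  show "open S" unfolding S_def by (intro open_coord_image[OF ch(1)] is_chartD(1)[OF ch(2)])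
  show "coord c p \<in> S" unfolding S_def using c a by blast
  show "smooth_on S (chart_trans c a)"
    using A_transition[OF c(1) a(1)] unfolding S_def smooth_transition_def .
  show "chart_trans c a (coord c p) = coord a p" using is_chartD(3)[OF ch(1) c(2)] by simp
  show "fd (chart_trans c a) (coord c p) v = dparam A c p v" unfolding dparam_def a_def ..
  show "y \<in> S \<Longrightarrow> chart_trans c a y \<in> coord a ` dom_of a"
    unfolding S_def using is_chartD(3)[OF ch(1)] by auto
  show p: "coord a p \<in> coord a ` dom_of a" using a by blast
  show "smooth_form_on A k UNIV \<omega> \<Longrightarrow> length vs = k \<Longrightarrow> (\<lambda>z. form_rep A a \<omega> z vs) differentiable at (coord a p)"
    using smooth_on_imp_differentiable[OF smooth_form_rep p] a by blast
  show "y \<in> S \<Longrightarrow> form_rep A c \<omega> y vs = form_rep A a \<omega> (chart_trans c a y) (map (fd (chart_trans c a) y) vs)"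
    unfolding S_def by (rule form_rep_change[OF c(1) A_compatible[OF a(1)]])
  show "y \<in> S \<Longrightarrow> vec_rep A a X (chart_trans c a y) = fd (chart_trans c a) y (vec_rep A c X y)"
    unfolding S_def by (rule vec_rep_change[OF c(1) A_compatible[OF a(1)]])
qed

text \<open>Frees the exterior derivative from the preferred chart: at all points of
  \<open>c\<close> it is computed by the same formula in \<open>c\<close>, so that smoothness in the
  base point can be discussed.\<close>

lemma ed1_rep:
  assumes c: "c \<in> A" "p \<in> dom_of c" and lin: "\<And>q. linear (\<lambda>v. \<omega> q [v])" and \<omega>: "smooth_form_on A 1 UNIV \<omega>"
  shows "ed1 (rep1 c \<omega>) (coord c p) u v = ext_deriv A \<omega> p [dparam A c p u, dparam A c p v]"
proof -
  note cs = chart_change_setup[OF c]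
  have "ed1 (rep1 c \<omega>) (coord c p) u v
    = ed1 (rep1 (chart_at A p) \<omega>) (chart_trans c (chart_at A p) (coord c p))
        (fd (chart_trans c (chart_at A p)) (coord c p) u) (fd (chart_trans c (chart_at A p)) (coord c p) v)"
  proof (rule ed1_natural[OF cs(1-3)])
    show "linear (rep1 (chart_at A p) \<omega> (chart_trans c (chart_at A p) y))"
      if "y \<in> coord c ` (dom_of c \<inter> dom_of (chart_at A p))" for y
      by (rule linear_rep1[OF lin chart_at(1) cs(6)[OF that]])
    show "(\<lambda>z. rep1 (chart_at A p) \<omega> z v) differentiable at (chart_trans c (chart_at A p) (coord c p))" for v
      unfolding cs(4) by (rule cs(8)[OF \<omega>]) simp
  qed (simp add: cs(9))
  then show ?thesis unfolding cs(4,5) ext_deriv_1 .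
qed

lemma elie_rep:
  assumes c: "c \<in> A" "p \<in> dom_of c" and X: "smooth_vec_on A UNIV X"
    and \<beta>: "smooth_form_on A 1 UNIV (form_of_covec \<beta>)"
  shows "elie (vec_rep A c X) (rep1 c (form_of_covec \<beta>)) (coord c p) v = lie_deriv_covec A X \<beta> p (dparam A c p v)"
proof -
  note cs = chart_change_setup[OF c]
  have "elie (vec_rep A c X) (rep1 c (form_of_covec \<beta>)) (coord c p) v
    = elie (vec_rep A (chart_at A p) X) (rep1 (chart_at A p) (form_of_covec \<beta>)) (chart_trans c (chart_at A p) (coord c p))
        (fd (chart_trans c (chart_at A p)) (coord c p) v)"
  proof (rule elie_natural[OF cs(1-3)])
    show "linear (rep1 (chart_at A p) (form_of_covec \<beta>) (chart_trans c (chart_at A p) y))"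
      if "y \<in> coord c ` (dom_of c \<inter> dom_of (chart_at A p))" for y
      by (rule linear_rep1[OF linear_form_of_covec chart_at(1) cs(6)[OF that]])
    show "(\<lambda>z. rep1 (chart_at A p) (form_of_covec \<beta>) z v) differentiable at (chart_trans c (chart_at A p) (coord c p))" for v
      unfolding cs(4) by (rule cs(8)[OF \<beta>]) simp
    show "vec_rep A (chart_at A p) X differentiable at (chart_trans c (chart_at A p) (coord c p))"
      unfolding cs(4) by (rule smooth_on_imp_differentiable[OF smooth_vec_rep[OF X chart_at(1)] cs(7)])
    show "vec_rep A c X differentiable at (coord c p)"
      by (rule smooth_on_imp_differentiable[OF smooth_vec_rep[OF X c(1)]]) (use c in blast)
  qed (simp_all add: cs(9,10) del: comp_apply)
  also have "\<dots> = lie_deriv_covec A X \<beta> p (dparam A c p v)"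
  proof -
    have 1: "\<beta> p w = rep1 (chart_at A p) (form_of_covec \<beta>) (coord (chart_at A p) p) w" for w
      unfolding form_rep_chart_at by (simp add: form_of_covec_def)
    show ?thesis unfolding cs(4,5) lie_deriv_covec_def elie_def Let_def 1 vec_rep_chart_at ..
  qed
  finally show ?thesis .
qed

lemma ed2_rep:
  assumes c: "c \<in> A" "p \<in> dom_of c" and \<omega>: "differential_form A 2 \<omega>"
  shows "ed2 (rep2 c \<omega>) (coord c p) u v w = ext_deriv A \<omega> p [dparam A c p u, dparam A c p v, dparam A c p w]"
proof -
  note cs = chart_change_setup[OF c]
  have alt: "alternating_multilinear 2 (\<omega> q)" for q
    using \<omega> by (simp add: differential_form_def)
  have "ed2 (rep2 c \<omega>) (coord c p) u v w
    = ed2 (rep2 (chart_at A p) \<omega>) (chart_trans c (chart_at A p) (coord c p))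
        (fd (chart_trans c (chart_at A p)) (coord c p) u) (fd (chart_trans c (chart_at A p)) (coord c p) v)
        (fd (chart_trans c (chart_at A p)) (coord c p) w)"
  proof (rule ed2_natural[OF cs(1-3)])
    fix y u v assume "y \<in> coord c ` (dom_of c \<inter> dom_of (chart_at A p))"
    then show "linear (\<lambda>u. rep2 (chart_at A p) \<omega> (chart_trans c (chart_at A p) y) u v)"
      "linear (rep2 (chart_at A p) \<omega> (chart_trans c (chart_at A p) y) u)"
      by (intro rep2_linear_alt alt chart_at cs(6); assumption)+
  next
    show "(\<lambda>z. rep2 (chart_at A p) \<omega> z u v) differentiable at (chart_trans c (chart_at A p) (coord c p))" for u v
      unfolding cs(4) using \<omega> by (intro cs(8)[of 2]) (auto simp: differential_form_def)
    show "rep2 (chart_at A p) \<omega> (chart_trans c (chart_at A p) (coord c p)) u v =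
      - rep2 (chart_at A p) \<omega> (chart_trans c (chart_at A p) (coord c p)) v u" for u v
      unfolding cs(4) by (rule rep2_linear_alt(3)[OF alt chart_at(1) cs(7)])
  qed (simp add: cs(9))
  then show ?thesis unfolding cs(4,5) ext_deriv_2 .
qed

text \<open>Within a single chart the representative of the exterior derivative is a fixed
  differential expression in the coefficients. This makes it possible to differentiate it once
  more.\<close>

lemma form_rep_ext_deriv_2:
  assumes c: "c \<in> A" "x \<in> coord c ` dom_of c" and \<omega>: "differential_form A 2 \<omega>"
  shows "form_rep A c (ext_deriv A \<omega>) x [u, v, w] = ed2 (rep2 c \<omega>) x u v w"
proof -
  obtain p where p: "p \<in> dom_of c" "x = coord c p" using c by blast
  then show ?thesis
    using ed2_rep[OF c(1) p(1) \<omega>] is_chartD(3)[OF A_is_chart[OF c(1)] p(1)] by (simp add: form_rep_def)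
qed

lemma smooth_rep2:
  "differential_form A 2 \<omega> \<Longrightarrow> c \<in> A \<Longrightarrow> smooth_on (coord c ` dom_of c) (\<lambda>x. rep2 c \<omega> x u v)"
  by (rule smooth_form_rep[of 2]) (auto simp: differential_form_def)

lemma differential_form_ext_deriv_2:
  assumes \<omega>: "differential_form A 2 \<omega>"
  shows "differential_form A 3 (ext_deriv A \<omega>)"
  unfolding differential_form_def
proof
  have alt: "alternating_multilinear 2 (\<omega> q)" for q
    using \<omega> by (simp add: differential_form_def)
  show "\<forall>p. alternating_multilinear 3 (ext_deriv A \<omega> p)"
  proof
    fix p
    define c where "c = chart_at A p"
    define x where "x = coord c p"
    define S where "S = coord c ` dom_of c"
    have c: "c \<in> A" "p \<in> dom_of c" unfolding c_def by (rule chart_at)+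
    have S: "open S" "x \<in> S" unfolding S_def x_def using c open_chart_image by auto
    have d: "(\<lambda>y. rep2 c \<omega> y u v) differentiable at x" for u v
      using smooth_rep2[OF \<omega> c(1)] S(2) unfolding S_def by (rule smooth_on_imp_differentiable)
    have lfd: "linear (fd (\<lambda>y. rep2 c \<omega> y u v) x)" for u v
      using d by (rule linear_frechet_derivative)
    have l1: "linear (\<lambda>u. fd (\<lambda>y. rep2 c \<omega> y u v) x h)" for v h
      by (rule linear_fd_param[OF S _ d]) (rule rep2_linear_alt(1)[OF alt c(1)], simp add: S_def)
    have l2: "linear (\<lambda>v. fd (\<lambda>y. rep2 c \<omega> y u v) x h)" for u h
      by (rule linear_fd_param[OF S _ d]) (rule rep2_linear_alt(2)[OF alt c(1)], simp add: S_def)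
    \<comment> \<open>Skewness of the coefficients holds on a neighbourhood and therefore passes to
      their derivatives.\<close>
    have skew: "fd (\<lambda>y. rep2 c \<omega> y u v) x h = - fd (\<lambda>y. rep2 c \<omega> y v u) x h" for u v h
    proof -
      have "fd (\<lambda>y. rep2 c \<omega> y u v) x = fd (\<lambda>y. - rep2 c \<omega> y v u) x"
        by (rule fd_transform[OF d S]) (rule rep2_linear_alt(3)[OF alt c(1)], simp add: S_def)
      then show ?thesis using fd_uminus[OF d] by simp
    qed
    have zero: "fd (\<lambda>y. rep2 c \<omega> y u u) x h = 0" for u h
      using skew[of u u h] by simp
    have ed: "ext_deriv A \<omega> p [u, v, w] = fd (\<lambda>y. rep2 c \<omega> y v w) x u - fd (\<lambda>y. rep2 c \<omega> y u w) x v
        + fd (\<lambda>y. rep2 c \<omega> y u v) x w" for u v w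
      unfolding ext_deriv_2 ed2_def c_def x_def ..
    show "alternating_multilinear 3 (ext_deriv A \<omega> p)"
    proof (rule alternating_multilinear_3I)
      show "linear (\<lambda>a. ext_deriv A \<omega> p [a, b, d])" "linear (\<lambda>a. ext_deriv A \<omega> p [b, a, d])"
        "linear (\<lambda>a. ext_deriv A \<omega> p [b, d, a])" for b d
        unfolding ed by (intro linear_compose_add linear_compose_sub lfd l1 l2)+
      show "ext_deriv A \<omega> p [a, a, b] = 0" "ext_deriv A \<omega> p [a, b, a] = 0" "ext_deriv A \<omega> p [b, a, a] = 0" for a b
        unfolding ed zero using skew[of a b a] skew[of b a a] by simp_all
    qed
  qed
  show "smooth_form_on A 3 UNIV (ext_deriv A \<omega>)"
    unfolding smooth_form_on_def
  proof (intro ballI allI impI)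
    fix c and vs :: "'b list" assume c: "c \<in> A" and "length vs = 3"
    then obtain u v w where vs: "vs = [u, v, w]" by (auto simp: numeral_3_eq_3 length_Suc_conv)
    have S: "open (coord c ` dom_of c)" using c by (rule open_chart_image)
    have "smooth_on (coord c ` dom_of c) (\<lambda>x. ed2 (rep2 c \<omega>) x u v w)"
      unfolding ed2_def
      by (rule smooth_on_add[OF smooth_on_diff[OF smooth_on_fd[OF smooth_rep2[OF \<omega> c]]
        smooth_on_fd[OF smooth_rep2[OF \<omega> c]] S] smooth_on_fd[OF smooth_rep2[OF \<omega> c]] S])
    then have "smooth_on (coord c ` dom_of c) (\<lambda>x. form_rep A c (ext_deriv A \<omega>) x vs)"
      by (rule smooth_on_cong[OF _ S]) (simp add: vs form_rep_ext_deriv_2[OF c _ \<omega>])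
    then show "smooth_on (coord c ` (dom_of c \<inter> UNIV)) (\<lambda>x. form_rep A c (ext_deriv A \<omega>) x vs)" by simp
  qed
qed

lemma closed_form_ext_deriv_2:
  assumes \<omega>: "differential_form A 2 \<omega>"
  shows "closed_form A 3 (ext_deriv A \<omega>)"
  unfolding closed_form_def
proof (intro conjI allI impI)
  show "differential_form A 3 (ext_deriv A \<omega>)" by (rule differential_form_ext_deriv_2[OF \<omega>])
  fix p and vs :: "'b list" assume "length vs = Suc 3"
  then obtain v0 v1 v2 v3 where vs: "vs = [v0, v1, v2, v3]"
    by (auto simp: numeral_3_eq_3 length_Suc_conv)
  define c where "c = chart_at A p"
  define x where "x = coord c p"
  define S where "S = coord c ` dom_of c"
  have c: "c \<in> A" "p \<in> dom_of c" unfolding c_def by (rule chart_at)+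
  have S: "open S" "x \<in> S" unfolding S_def x_def using c open_chart_image by auto
  \<comment> \<open>At points other than \<open>p\<close> the exterior derivative is defined through
    other charts. Replacing it near \<open>x\<close> by the formula in \<open>c\<close> is what
    permits the outer derivative to be expanded.\<close>
  have "fd (\<lambda>y. form_rep A c (ext_deriv A \<omega>) y [u, v, w]) x = fd (\<lambda>y. ed2 (rep2 c \<omega>) y u v w) x" for u v w
  proof (rule fd_transform[OF _ S])
    show "(\<lambda>y. form_rep A c (ext_deriv A \<omega>) y [u, v, w]) differentiable at x"
      using smooth_form_rep[OF _ c(1), of 3 "ext_deriv A \<omega>" "[u, v, w]"] differential_form_ext_deriv_2[OF \<omega>] S(2)
      unfolding S_def differential_form_def by (intro smooth_on_imp_differentiable) auto
  qed (simp add: form_rep_ext_deriv_2[OF c(1) _ \<omega>] S_def)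
  moreover have "fd (\<lambda>y. ed2 (rep2 c \<omega>) y v1 v2 v3) x v0 - fd (\<lambda>y. ed2 (rep2 c \<omega>) y v0 v2 v3) x v1
    + fd (\<lambda>y. ed2 (rep2 c \<omega>) y v0 v1 v3) x v2 - fd (\<lambda>y. ed2 (rep2 c \<omega>) y v0 v1 v2) x v3 = 0"
    by (rule ed2_closed[OF S]) (unfold S_def, rule smooth_rep2[OF \<omega> c(1)])
  ultimately show "ext_deriv A (ext_deriv A \<omega>) p vs = 0"
    unfolding vs ext_deriv_def[of A "ext_deriv A \<omega>"] Let_def c_def[symmetric] x_def[symmetric]
    by (simp add: lessThan_Suc)
qed

text \<open>The covector part of the bracket as a bare function. \<open>Blinfun\<close> may be
  unfolded only after this function has been shown bounded linear.\<close>

definition bracket_covec :: "('a, 'b) form \<Rightarrow> ('a \<Rightarrow> 'b gen_vec) \<Rightarrow> ('a \<Rightarrow> 'b gen_vec) \<Rightarrow> 'a \<Rightarrow> 'b \<Rightarrow> real" where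
  "bracket_covec \<phi> s t p v = lie_deriv_covec A (fst \<circ> s) (snd \<circ> t) p v
    - ext_deriv A (form_of_covec (snd \<circ> s)) p [fst (t p), v] + \<phi> p [fst (s p), fst (t p), v]"

lemma courant_bracket_eq:
  "courant_bracket A \<phi> s t p = (lie_bracket A (fst \<circ> s) (fst \<circ> t) p, Blinfun (bracket_covec \<phi> s t p))"
  by (simp add: courant_bracket_def bracket_covec_def[abs_def] Let_def)

lemma bracket_covec_rep:
  assumes s: "smooth_section_on A UNIV s" and t: "smooth_section_on A UNIV t"
    and c: "c \<in> A" "p \<in> dom_of c"
  shows "bracket_covec \<phi> s t p (dparam A c p v)
    = elie (vec_rep A c (fst \<circ> s)) (rep1 c (form_of_covec (snd \<circ> t))) (coord c p) v
      - ed1 (rep1 c (form_of_covec (snd \<circ> s))) (coord c p) (vec_rep A c (fst \<circ> t) (coord c p)) v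
      + form_rep A c \<phi> (coord c p) [vec_rep A c (fst \<circ> s) (coord c p), vec_rep A c (fst \<circ> t) (coord c p), v]"
proof -
  have st: "smooth_vec_on A UNIV (fst \<circ> s)" "smooth_form_on A 1 UNIV (form_of_covec (snd \<circ> s))"
    "smooth_vec_on A UNIV (fst \<circ> t)" "smooth_form_on A 1 UNIV (form_of_covec (snd \<circ> t))"
    using s t by (simp_all add: smooth_section_on_def)
  have pc: "param c (coord c p) = p" using is_chartD(3)[OF A_is_chart[OF c(1)] c(2)] .
  have d: "dparam A c p (vec_rep A c Z (coord c p)) = Z p" for Z
    using dparam_dchart(1)[OF A_compatible[OF c(1)] c(2)] by (simp add: vec_rep_def pc)
  have "form_rep A c \<phi> (coord c p) [vec_rep A c (fst \<circ> s) (coord c p), vec_rep A c (fst \<circ> t) (coord c p), v]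
    = \<phi> p [fst (s p), fst (t p), dparam A c p v]"
    by (simp add: form_rep_def pc d)
  then show ?thesis
    unfolding bracket_covec_def elie_rep[OF c st(1,4)] ed1_rep[OF c linear_form_of_covec st(2)] d
    by simp
qed

lemma linear_bracket_covec:
  assumes s: "smooth_section_on A UNIV s" and t: "smooth_section_on A UNIV t"
    and \<phi>: "differential_form A 3 \<phi>"
  shows "linear (bracket_covec \<phi> s t p)"
proof -
  define c where "c = chart_at A p"
  define x where "x = coord c p"
  define S where "S = coord c ` dom_of c"
  have c: "c \<in> A" "p \<in> dom_of c" unfolding c_def by (rule chart_at)+
  have S: "open S" "x \<in> S" unfolding S_def x_def using c open_chart_image by auto
  have X: "vec_rep A c (fst \<circ> s) differentiable at x"
    using smooth_vec_rep[OF _ c(1)] s S(2) unfolding S_def smooth_section_on_def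
    by (blast intro: smooth_on_imp_differentiable)
  have d: "(\<lambda>y. rep1 c (form_of_covec (snd \<circ> r)) y v) differentiable at x"
    if "smooth_section_on A UNIV r" for r v
  proof -
    have "smooth_on S (\<lambda>y. rep1 c (form_of_covec (snd \<circ> r)) y v)"
      unfolding S_def using that by (intro smooth_form_rep[of 1] c) (auto simp: smooth_section_on_def)
    then show ?thesis using S(2) by (rule smooth_on_imp_differentiable)
  qed
  have lin: "linear (rep1 c (form_of_covec \<alpha>) y)" if "y \<in> S" for \<alpha> y
    using that unfolding S_def by (rule linear_rep1[OF linear_form_of_covec c(1)])
  have "linear (\<lambda>v. rep1 c (form_of_covec (snd \<circ> t)) x (fd (vec_rep A c (fst \<circ> s)) x v))"
    using linear_compose[OF linear_frechet_derivative[OF X] lin[OF S(2)]] by (simp add: comp_def)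
  then have 1: "linear (\<lambda>v. elie (vec_rep A c (fst \<circ> s)) (rep1 c (form_of_covec (snd \<circ> t))) x v)"
    unfolding elie_def
    by (intro linear_compose_add linear_fd_param[OF S lin d[OF t]])
  have 2: "linear (ed1 (rep1 c (form_of_covec (snd \<circ> s))) x u)" for u
    unfolding ed1_def
    by (intro linear_compose_sub linear_fd_param[OF S lin d[OF s]] linear_frechet_derivative[OF d[OF s]])
  have "alternating_multilinear 3 (\<phi> p)" using \<phi> by (simp add: differential_form_def)
  then have "\<And>vs i. length vs = 3 \<Longrightarrow> i < 3 \<Longrightarrow> linear (\<lambda>u. \<phi> p (vs[i := u]))"
    by (simp add: alternating_multilinear_def)
  \<comment> \<open>The entry 0 is a placeholder: index 2 is the slot that gets overwritten by the
    variable.\<close>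
  from this[of "[_, _, 0]" 2] have 3: "linear (\<lambda>v. \<phi> p [a, b, v])" for a b by simp
  have 4: "form_rep A c \<phi> x [vec_rep A c (fst \<circ> s) x, vec_rep A c (fst \<circ> t) x, v] = \<phi> p [fst (s p), fst (t p), v]" for v
    unfolding c_def x_def form_rep_chart_at vec_rep_chart_at by simp
  have "linear (\<lambda>v. bracket_covec \<phi> s t p (dparam A c p v))"
    unfolding bracket_covec_rep[OF s t c] x_def[symmetric] 4
    by (intro linear_compose_add linear_compose_sub 1 2 3)
  then show ?thesis unfolding c_def dparam_chart_at .
qed

lemma Blinfun_bracket_covec:
  assumes "smooth_section_on A UNIV s" "smooth_section_on A UNIV t" "differential_form A 3 \<phi>"
  shows "blinfun_apply (Blinfun (bracket_covec \<phi> s t p)) = bracket_covec \<phi> s t p"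
  by (rule bounded_linear_Blinfun_apply[OF linear_imp_bounded_linear[OF linear_bracket_covec[OF assms]]])

lemma smooth_courant_bracket:
  assumes s: "smooth_section_on A UNIV s" and t: "smooth_section_on A UNIV t"
    and \<phi>: "differential_form A 3 \<phi>"
  shows "smooth_section_on A UNIV (courant_bracket A \<phi> s t)"
proof -
  have st: "smooth_vec_on A UNIV (fst \<circ> s)" "smooth_form_on A 1 UNIV (form_of_covec (snd \<circ> s))"
    "smooth_vec_on A UNIV (fst \<circ> t)" "smooth_form_on A 1 UNIV (form_of_covec (snd \<circ> t))"
    using s t by (simp_all add: smooth_section_on_def)
  have "fst \<circ> courant_bracket A \<phi> s t = lie_bracket A (fst \<circ> s) (fst \<circ> t)"
    by (rule ext) (simp add: courant_bracket_eq)
  moreover have "smooth_vec_on A UNIV (lie_bracket A (fst \<circ> s) (fst \<circ> t))"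
    by (rule smooth_vec_lie_bracket[OF open_UNIV st(1,3)])
  moreover have "smooth_form_on A 1 UNIV (form_of_covec (snd \<circ> courant_bracket A \<phi> s t))"
    unfolding smooth_form_on_def
  proof (intro ballI allI impI)
    fix c and vs :: "'b list" assume c: "c \<in> A" and "length vs = 1"
    then obtain v where vs: "vs = [v]" by (cases vs) auto
    define S where "S = coord c ` dom_of c"
    have S: "open S" unfolding S_def using c by (rule open_chart_image)
    let ?X = "vec_rep A c (fst \<circ> s)" and ?Y = "vec_rep A c (fst \<circ> t)"
    let ?a = "rep1 c (form_of_covec (snd \<circ> s))" and ?b = "rep1 c (form_of_covec (snd \<circ> t))"
    have X: "smooth_on S ?X" and Y: "smooth_on S ?Y"
      unfolding S_def by (intro smooth_vec_rep st c)+
    have a: "smooth_on S (\<lambda>x. ?a x v)" and b: "smooth_on S (\<lambda>x. ?b x v)" for v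
      unfolding S_def by (intro smooth_form_rep[of 1] st c; simp)+
    have lin: "linear (rep1 c (form_of_covec \<alpha>) y)" if "y \<in> S" for \<alpha> y
      using that unfolding S_def by (rule linear_rep1[OF linear_form_of_covec c])
    have da: "(\<lambda>x. ?a x v) differentiable at x" if "x \<in> S" for x v
      using a that by (rule smooth_on_imp_differentiable)
    have "smooth_on S (\<lambda>x. elie ?X ?b x v)"
      unfolding elie_def
      by (intro smooth_on_add[OF smooth_on_fd_eval[OF b X S] smooth_on_eval[where \<beta> = ?b, OF lin b smooth_on_fd[OF X] S] S])
    moreover have "smooth_on S (\<lambda>x. ed1 ?a x (?Y x) v)"
    proof -
      have "smooth_on S (\<lambda>x. fd (\<lambda>y. ?a y (?Y x)) x v)"
      proof (rule smooth_on_eval[where \<beta> = "\<lambda>x u. fd (\<lambda>y. ?a y u) x v", OF _ _ Y S])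
        show "linear (\<lambda>u. fd (\<lambda>y. ?a y u) x v)" if "x \<in> S" for x
          by (rule linear_fd_param[OF S that lin da[OF that]])
        show "smooth_on S (\<lambda>x. fd (\<lambda>y. ?a y u) x v)" for u
          by (rule smooth_on_fd[OF a])
      qed
      then show ?thesis
        unfolding ed1_def by (intro smooth_on_diff[OF smooth_on_fd_eval[OF a Y S] _ S])
    qed
    moreover have "smooth_on S (\<lambda>x. form_rep A c \<phi> x [?X x, ?Y x, v])"
    proof -
      have alt: "\<And>vs i. length vs = 3 \<Longrightarrow> i < 3 \<Longrightarrow> linear (\<lambda>u. \<phi> q (vs[i := u]))" for q
        using \<phi> by (simp add: differential_form_def alternating_multilinear_def)
      have "linear (\<lambda>u. \<phi> q [u, w, v])" "linear (\<lambda>u. \<phi> q [w, u, v])" for q w v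
        using alt[of "[w, w, v]" 0 q] alt[of "[w, w, v]" 1 q] by simp_all
      from linear_compose[OF linear_dparam[OF A_compatible[OF c]] this(1)]
        linear_compose[OF linear_dparam[OF A_compatible[OF c]] this(2)]
      have lin3: "linear (\<lambda>u. form_rep A c \<phi> x [u, w, v])" "linear (\<lambda>u. form_rep A c \<phi> x [w, u, v])"
        if "x \<in> S" for x w
        using is_chartD(5)[OF A_is_chart[OF c] that[unfolded S_def]]
        unfolding form_rep_def by (simp_all add: comp_def)
      have sm: "smooth_on S (\<lambda>x. form_rep A c \<phi> x [u, w, v])" for u w
        using \<phi> unfolding S_def by (intro smooth_form_rep[of 3] c) (auto simp: differential_form_def)
      have "smooth_on S (\<lambda>x. form_rep A c \<phi> x [?X x, w, v])" for w
        by (rule smooth_on_eval[where \<beta> = "\<lambda>x u. form_rep A c \<phi> x [u, w, v]", OF lin3(1) sm X S])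
      from smooth_on_eval[where \<beta> = "\<lambda>x w. form_rep A c \<phi> x [?X x, w, v]", OF lin3(2) this Y S]
      show ?thesis .
    qed
    ultimately have "smooth_on S (\<lambda>x. elie ?X ?b x v - ed1 ?a x (?Y x) v + form_rep A c \<phi> x [?X x, ?Y x, v])"
      by (intro smooth_on_add smooth_on_diff S)
    then have "smooth_on S (\<lambda>x. form_rep A c (form_of_covec (snd \<circ> courant_bracket A \<phi> s t)) x vs)"
    proof (rule smooth_on_cong[OF _ S])
      fix x assume "x \<in> S"
      then obtain p where p: "p \<in> dom_of c" "x = coord c p" unfolding S_def by blast
      have pc: "param c (coord c p) = p" using is_chartD(3)[OF A_is_chart[OF c] p(1)] .
      have "form_rep A c (form_of_covec (snd \<circ> courant_bracket A \<phi> s t)) x vs = bracket_covec \<phi> s t p (dparam A c p v)"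
        by (simp add: form_rep_def form_of_covec_def courant_bracket_eq vs p(2) pc Blinfun_bracket_covec[OF s t \<phi>])
      then show "elie ?X ?b x v - ed1 ?a x (?Y x) v + form_rep A c \<phi> x [?X x, ?Y x, v]
        = form_rep A c (form_of_covec (snd \<circ> courant_bracket A \<phi> s t)) x vs"
        unfolding bracket_covec_rep[OF s t c p(1)] p(2) by simp
    qed
    then show "smooth_on (coord c ` (dom_of c \<inter> UNIV))
      (\<lambda>x. form_rep A c (form_of_covec (snd \<circ> courant_bracket A \<phi> s t)) x vs)" unfolding S_def by simp
  qed
  ultimately show ?thesis by (simp add: smooth_section_on_def)
qed

end

section \<open>Extension of the leafwise 2-form\<close>

lemma span_image_finite_explicit:
  assumes "finite I" "inj_on f I" "x \<in> span (f ` I)"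
  obtains u where "x = (\<Sum>i\<in>I. u i *\<^sub>R f i)"
proof -
  obtain w where "x = (\<Sum>v\<in>f ` I. w v *\<^sub>R v)"
    using assms by (auto simp: span_finite)
  also have "\<dots> = (\<Sum>i\<in>I. w (f i) *\<^sub>R f i)"
    using assms(2) by (simp add: sum.reindex)
  finally show thesis by (rule that)
qed

text \<open>Each summand is the amount by which the partial product of the \<open>1 - f j\<close>
  drops when its next factor is included.\<close>

lemma sum_telescope_one_minus:
  fixes f :: "nat \<Rightarrow> 'c::comm_ring_1"
  shows "(\<Sum>n\<le>m. (\<Prod>j<n. 1 - f j) * f n) = 1 - (\<Prod>j<Suc m. 1 - f j)"
proof (induction m)
  case 0
  show ?case by simp
next
  case (Suc m)
  show ?case
    unfolding sum.atMost_Suc Suc prod.lessThan_Suc[of _ "Suc m"] by (simp only: algebra_simps mult_1_left mult_1_right)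
qed

context finite_dim_inner
begin

lemma finite_basis_exists:
  fixes V :: "'b set"
  obtains B where "B \<subseteq> V" "independent B" "V \<subseteq> span B" "card B = dim V" "finite B"
proof -
  have "(\<Sum>b\<in>E. (x \<bullet> b) *\<^sub>R b) \<in> span E" for x
    by (intro span_sum span_scale span_base)
  then have E: "x \<in> span E" for x unfolding expand_E .
  obtain B where B: "B \<subseteq> V" "independent B" "V \<subseteq> span B" "card B = dim V"
    by (rule basis_exists)
  have "finite B"
    using independent_span_bound[OF finite_E B(2)] E by blast
  with B show thesis by (rule that)
qed

lemma dim_le_card_finite_dim:
  fixes V :: "'b set"
  assumes "V \<subseteq> span C" "finite C"
  shows "dim V \<le> card C"
proof -
  obtain B where B: "B \<subseteq> V" "independent B" "V \<subseteq> span B" "card B = dim V" "finite B"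
    by (rule finite_basis_exists)
  have "B \<subseteq> span C" using B(1) assms(1) by blast
  from independent_span_bound[OF assms(2) B(2) this] show ?thesis using B(4) by simp
qed

text \<open>A vector of \<open>V\<close> outside the span could be added to \<open>C\<close>, giving
  an independent set with more elements than a basis of \<open>V\<close>.\<close>

lemma independent_spans:
  fixes V :: "'b set"
  assumes "C \<subseteq> V" "independent C" "finite C" "dim V \<le> card C"
  shows "V \<subseteq> span C"
proof (rule ccontr)
  assume "\<not> ?thesis"
  then obtain v where v: "v \<in> V" "v \<notin> span C" by blast
  obtain B where B: "B \<subseteq> V" "independent B" "V \<subseteq> span B" "card B = dim V" "finite B"
    by (rule finite_basis_exists)
  have "independent (insert v C)"
    using assms(2) v(2) by (simp add: independent_insert)
  moreover have "insert v C \<subseteq> span B" using assms(1) v(1) B(3) by blast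
  ultimately have "card (insert v C) \<le> card B"
    using independent_span_bound[OF B(5)] by blast
  moreover have "v \<notin> C" using v(2) span_base by blast
  ultimately show False using assms(3,4) B(4) by simp
qed

end

context manifold
begin

section \<open>Smooth functions and sections over open sets\<close>

definition smooth_fun_on :: "'a set \<Rightarrow> ('a \<Rightarrow> real) \<Rightarrow> bool" where
  "smooth_fun_on U f \<longleftrightarrow> (\<forall>c\<in>A. smooth_on (coord c ` (dom_of c \<inter> U)) (\<lambda>x. f (param c x)))"

lemma smooth_fun_onI:
  "(\<And>c. c \<in> A \<Longrightarrow> smooth_on (coord c ` (dom_of c \<inter> U)) (\<lambda>x. f (param c x))) \<Longrightarrow> smooth_fun_on U f"
  by (simp add: smooth_fun_on_def)

lemma smooth_fun_onD:
  "smooth_fun_on U f \<Longrightarrow> c \<in> A \<Longrightarrow> smooth_on (coord c ` (dom_of c \<inter> U)) (\<lambda>x. f (param c x))"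
  by (simp add: smooth_fun_on_def)

lemma open_A_image: "c \<in> A \<Longrightarrow> open U \<Longrightarrow> open (coord c ` (dom_of c \<inter> U))"
  using open_coord_image A_is_chart by blast

lemma A_param:
  assumes "c \<in> A" "x \<in> coord c ` (dom_of c \<inter> U)"
  shows "param c x \<in> dom_of c" "param c x \<in> U" "coord c (param c x) = x"
  using assms is_chartD(3)[OF A_is_chart[OF assms(1)]] by auto

lemma smooth_fun_on_const: "smooth_fun_on U (\<lambda>q. a)"
  by (simp add: smooth_fun_on_def smooth_on_const)

lemma smooth_fun_on_mult:
  assumes "open U" "smooth_fun_on U f" "smooth_fun_on U g"
  shows "smooth_fun_on U (\<lambda>q. f q * g q)"
  by (rule smooth_fun_onI)
     (rule smooth_on_mult[OF smooth_fun_onD[OF assms(2)] smooth_fun_onD[OF assms(3)] open_A_image[OF _ assms(1)]])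

lemma smooth_fun_on_diff:
  assumes "open U" "smooth_fun_on U f" "smooth_fun_on U g"
  shows "smooth_fun_on U (\<lambda>q. f q - g q)"
  by (rule smooth_fun_onI)
     (rule smooth_on_diff[OF smooth_fun_onD[OF assms(2)] smooth_fun_onD[OF assms(3)] open_A_image[OF _ assms(1)]])

lemma smooth_fun_on_prod:
  assumes "open U" "\<And>i. i \<in> I \<Longrightarrow> smooth_fun_on U (f i)"
  shows "smooth_fun_on U (\<lambda>q. \<Prod>i\<in>I. f i q)"
  using assms(2)
  by (induction I rule: infinite_finite_induct) (simp_all add: smooth_fun_on_const smooth_fun_on_mult[OF assms(1)])

lemma smooth_fun_on_divide:
  assumes "open U" "smooth_fun_on U f" "smooth_fun_on U g" "\<And>q. q \<in> U \<Longrightarrow> g q \<noteq> 0"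
  shows "smooth_fun_on U (\<lambda>q. f q / g q)"
  unfolding divide_inverse
proof (rule smooth_fun_on_mult[OF assms(1,2)], rule smooth_fun_onI)
  fix c assume c: "c \<in> A"
  show "smooth_on (coord c ` (dom_of c \<inter> U)) (\<lambda>x. inverse (g (param c x)))"
    by (rule smooth_on_inverse[OF smooth_fun_onD[OF assms(3) c] open_A_image[OF c assms(1)]])
       (rule assms(4), rule A_param(2)[OF c])
qed

lemma smooth_fun_on_imp_continuous_on:
  assumes "smooth_fun_on U f" "c \<in> A" "U \<subseteq> dom_of c"
  shows "continuous_on U f"
proof -
  have "continuous_on (coord c ` (dom_of c \<inter> U)) (\<lambda>x. f (param c x))"
    using smooth_fun_onD[OF assms(1,2)] by (rule smooth_on_imp_continuous_on)
  moreover have "continuous_on U (coord c)"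
    using is_chartD(6)[OF A_is_chart[OF assms(2)]] assms(3) by (rule continuous_on_subset)
  ultimately have "continuous_on U (\<lambda>q. f (param c (coord c q)))"
    by (rule continuous_on_compose2) (use assms(3) in blast)
  moreover have "f (param c (coord c q)) = f q" if "q \<in> U" for q
    using is_chartD(3)[OF A_is_chart[OF assms(2)]] assms(3) that by auto
  ultimately show ?thesis using continuous_on_cong by force
qed

lemma smooth_form_onI:
  "(\<And>c vs. c \<in> A \<Longrightarrow> length vs = k \<Longrightarrow> smooth_on (coord c ` (dom_of c \<inter> U)) (\<lambda>x. form_rep A c \<omega> x vs)) \<Longrightarrow>
    smooth_form_on A k U \<omega>"
  by (simp add: smooth_form_on_def)

lemma smooth_form_onD:
  "smooth_form_on A k U \<omega> \<Longrightarrow> c \<in> A \<Longrightarrow> length vs = k \<Longrightarrow>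
    smooth_on (coord c ` (dom_of c \<inter> U)) (\<lambda>x. form_rep A c \<omega> x vs)"
  by (simp add: smooth_form_on_def)

lemma smooth_vec_onD:
  "smooth_vec_on A U X \<Longrightarrow> c \<in> A \<Longrightarrow> smooth_on (coord c ` (dom_of c \<inter> U)) (vec_rep A c X)"
  by (simp add: smooth_vec_on_def)

lemma smooth_section_onD:
  assumes "smooth_section_on A U s" "c \<in> A"
  shows "smooth_on (coord c ` (dom_of c \<inter> U)) (vec_rep A c (fst \<circ> s))"
    "smooth_on (coord c ` (dom_of c \<inter> U)) (\<lambda>x. rep1 c (form_of_covec (snd \<circ> s)) x v)"
  using assms unfolding smooth_section_on_def
  by (auto intro: smooth_vec_onD smooth_form_onD)

lemma smooth_section_onI:
  assumes "\<And>c. c \<in> A \<Longrightarrow> smooth_on (coord c ` (dom_of c \<inter> U)) (vec_rep A c (fst \<circ> s))"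
    "\<And>c v. c \<in> A \<Longrightarrow> smooth_on (coord c ` (dom_of c \<inter> U)) (\<lambda>x. rep1 c (form_of_covec (snd \<circ> s)) x v)"
  shows "smooth_section_on A U s"
  unfolding smooth_section_on_def smooth_vec_on_def smooth_form_on_def
proof (intro conjI ballI allI impI)
  fix c and vs :: "'b list" assume c: "c \<in> A" and "length vs = 1"
  then obtain v where "vs = [v]" by (cases vs) auto
  then show "smooth_on (coord c ` (dom_of c \<inter> U)) (\<lambda>x. form_rep A c (form_of_covec (snd \<circ> s)) x vs)"
    using assms(2)[OF c] by simp
qed (rule assms(1))

lemma smooth_section_on_subset:
  assumes "smooth_section_on A U s" "V \<subseteq> U"
  shows "smooth_section_on A V s"
proof (rule smooth_section_onI)
  fix c v assume c: "c \<in> A"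
  have sub: "coord c ` (dom_of c \<inter> V) \<subseteq> coord c ` (dom_of c \<inter> U)" using assms(2) by blast
  show "smooth_on (coord c ` (dom_of c \<inter> V)) (vec_rep A c (fst \<circ> s))"
    "smooth_on (coord c ` (dom_of c \<inter> V)) (\<lambda>x. rep1 c (form_of_covec (snd \<circ> s)) x v)"
    by (rule smooth_on_subset[OF smooth_section_onD(1)[OF assms(1) c] sub],
        rule smooth_on_subset[OF smooth_section_onD(2)[OF assms(1) c] sub])
qed

lemma rep1_covec: "rep1 c (form_of_covec \<alpha>) x v = blinfun_apply (\<alpha> (param c x)) (dparam A c (param c x) v)"
  by (simp add: form_rep_def form_of_covec_def)

text \<open>Shaped for a Gram-Schmidt step; with the zero section for \<open>s\<close> it also
  yields arbitrary linear combinations.\<close>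

lemma smooth_section_on_diff_scale:
  assumes U: "open U" and s: "smooth_section_on A U s"
    and f: "\<And>i. i \<in> I \<Longrightarrow> smooth_fun_on U (f i)" and t: "\<And>i. i \<in> I \<Longrightarrow> smooth_section_on A U (t i)"
  shows "smooth_section_on A U (\<lambda>q. s q - (\<Sum>i\<in>I. f i q *\<^sub>R t i q))"
proof (rule smooth_section_onI)
  fix c v assume c: "c \<in> A"
  let ?S = "coord c ` (dom_of c \<inter> U)"
  have S: "open ?S" by (rule open_A_image[OF c U])
  note fr = smooth_fun_onD[OF f c]
  have "smooth_on ?S (\<lambda>x. vec_rep A c (fst \<circ> s) x - (\<Sum>i\<in>I. f i (param c x) *\<^sub>R vec_rep A c (fst \<circ> t i) x))"
    by (intro smooth_on_diff smooth_on_sum smooth_on_scaleR smooth_section_onD(1) fr s t c S)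
  then show "smooth_on ?S (vec_rep A c (fst \<circ> (\<lambda>q. s q - (\<Sum>i\<in>I. f i q *\<^sub>R t i q))))"
  proof (rule smooth_on_cong[OF _ S])
    fix x assume "x \<in> ?S"
    then have lin: "linear (dchart A c (param c x))"
      by (intro linear_dchart A_compatible c A_param(1)[OF c])
    show "vec_rep A c (fst \<circ> s) x - (\<Sum>i\<in>I. f i (param c x) *\<^sub>R vec_rep A c (fst \<circ> t i) x)
      = vec_rep A c (fst \<circ> (\<lambda>q. s q - (\<Sum>i\<in>I. f i q *\<^sub>R t i q))) x"
      by (simp add: vec_rep_def linear_diff[OF lin] linear_sum[OF lin] linear_scale[OF lin] fst_sum)
  qed
  have "smooth_on ?S (\<lambda>x. rep1 c (form_of_covec (snd \<circ> s)) x v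
      - (\<Sum>i\<in>I. f i (param c x) * rep1 c (form_of_covec (snd \<circ> t i)) x v))"
    by (intro smooth_on_diff smooth_on_sum smooth_on_mult smooth_section_onD(2) fr s t c S)
  moreover have "rep1 c (form_of_covec (snd \<circ> s)) x v
      - (\<Sum>i\<in>I. f i (param c x) * rep1 c (form_of_covec (snd \<circ> t i)) x v)
    = rep1 c (form_of_covec (snd \<circ> (\<lambda>q. s q - (\<Sum>i\<in>I. f i q *\<^sub>R t i q)))) x v" for x
    by (simp add: rep1_covec blinfun.diff_left blinfun.sum_left blinfun.scaleR_left snd_sum)
  ultimately show "smooth_on ?S (\<lambda>x. rep1 c (form_of_covec (snd \<circ> (\<lambda>q. s q - (\<Sum>i\<in>I. f i q *\<^sub>R t i q)))) x v)"
    by simp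
qed

lemma dparam_vec_rep:
  assumes "c \<in> A" "x \<in> coord c ` (dom_of c \<inter> U)"
  shows "dparam A c (param c x) (vec_rep A c X x) = X (param c x)"
  unfolding vec_rep_def by (rule dparam_dchart(1)[OF A_compatible[OF assms(1)] A_param(1)[OF assms]])

lemma smooth_fun_on_covec_apply:
  assumes U: "open U" and s: "smooth_section_on A U s" and t: "smooth_section_on A U t"
  shows "smooth_fun_on U (\<lambda>q. blinfun_apply (snd (s q)) (fst (t q)))"
proof (rule smooth_fun_onI)
  fix c assume c: "c \<in> A"
  let ?S = "coord c ` (dom_of c \<inter> U)"
  have S: "open ?S" by (rule open_A_image[OF c U])
  have "smooth_on ?S (\<lambda>x. rep1 c (form_of_covec (snd \<circ> s)) x (vec_rep A c (fst \<circ> t) x))"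
  proof (rule smooth_on_eval[where \<beta> = "rep1 c (form_of_covec (snd \<circ> s))",
        OF _ smooth_section_onD(2)[OF s c] smooth_section_onD(1)[OF t c] S])
    show "linear (rep1 c (form_of_covec (snd \<circ> s)) x)" if "x \<in> ?S" for x
      by (rule linear_rep1[OF linear_form_of_covec c]) (use that in blast)
  qed
  then show "smooth_on ?S (\<lambda>x. blinfun_apply (snd (s (param c x))) (fst (t (param c x))))"
  proof (rule smooth_on_cong[OF _ S])
    show "rep1 c (form_of_covec (snd \<circ> s)) x (vec_rep A c (fst \<circ> t) x)
      = blinfun_apply (snd (s (param c x))) (fst (t (param c x)))"
      if "x \<in> ?S" for x
      unfolding rep1_covec dparam_vec_rep[OF c that] by simp
  qed
qed

text \<open>The Euclidean metric of the chart \<open>c\<close>, pulled back to tangent spaces over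
  its domain. The inner product of the model space itself would not do: at \<open>q\<close> it
  refers to \<open>chart_at A q\<close> and need not vary continuously.\<close>

definition chart_metric :: "('a, 'b) chart \<Rightarrow> 'a \<Rightarrow> 'b \<Rightarrow> 'b \<Rightarrow> real" where
  "chart_metric c q u v = dchart A c q u \<bullet> dchart A c q v"

lemma linear_chart_metric: "c \<in> A \<Longrightarrow> q \<in> dom_of c \<Longrightarrow> linear (chart_metric c q u)"
  unfolding chart_metric_def
  using linear_compose[OF linear_dchart[OF A_compatible] bounded_linear.linear[OF bounded_linear_inner_right]]
  by (simp add: comp_def)

lemma chart_metric_commute: "chart_metric c q u v = chart_metric c q v u"
  by (simp add: chart_metric_def inner_commute)

lemma chart_metric_eq_0:
  assumes "c \<in> A" "q \<in> dom_of c"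
  shows "chart_metric c q u u = 0 \<longleftrightarrow> u = 0"
  using dparam_dchart(1)[OF A_compatible[OF assms(1)] assms(2)]
    linear_0[OF linear_dchart[OF A_compatible[OF assms(1)] assms(2)]]
    linear_0[OF linear_dparam[OF A_compatible[OF assms(1)] assms(2)]]
  unfolding chart_metric_def inner_eq_zero_iff by metis

lemma smooth_trans_subset:
  assumes "c \<in> A" "c' \<in> A" "U \<subseteq> dom_of c'"
  shows "smooth_on (coord c ` (dom_of c \<inter> U)) (chart_trans c c')"
  using A_transition[OF assms(1,2)] unfolding smooth_transition_def
  by (rule smooth_on_subset) (use assms(3) in blast)

lemma dchart_param:
  assumes "c \<in> A" "c' \<in> A" "U \<subseteq> dom_of c'" "x \<in> coord c ` (dom_of c \<inter> U)"
  shows "dchart A c' (param c x) v = fd (chart_trans c c') x (dchart A c (param c x) v)"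
  using dchart_change[OF assms(1) A_compatible[OF assms(2)] A_param(1)[OF assms(1,4)], of v]
    A_param(2,3)[OF assms(1,4)] assms(3) by auto

lemma smooth_fun_on_chart_metric:
  assumes U: "open U" "U \<subseteq> dom_of c'" and c': "c' \<in> A" and X: "smooth_vec_on A U X" and Y: "smooth_vec_on A U Y"
  shows "smooth_fun_on U (\<lambda>q. chart_metric c' q (X q) (Y q))"
proof (rule smooth_fun_onI)
  fix c assume c: "c \<in> A"
  let ?S = "coord c ` (dom_of c \<inter> U)"
  have S: "open ?S" by (rule open_A_image[OF c U(1)])
  have "smooth_on ?S (\<lambda>x. fd (chart_trans c c') x (vec_rep A c X x) \<bullet> fd (chart_trans c c') x (vec_rep A c Y x))"
    by (rule smooth_on_inner[OF smooth_on_fd_eval[OF smooth_trans_subset[OF c c' U(2)] smooth_vec_onD[OF X c] S]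
      smooth_on_fd_eval[OF smooth_trans_subset[OF c c' U(2)] smooth_vec_onD[OF Y c] S] S])
  then show "smooth_on ?S (\<lambda>x. chart_metric c' (param c x) (X (param c x)) (Y (param c x)))"
    by (rule smooth_on_cong[OF _ S]) (simp only: chart_metric_def dchart_param[OF c c' U(2)] vec_rep_def)
qed

lemma smooth_form_on_chart_metric:
  assumes U: "open U" "U \<subseteq> dom_of c'" and c': "c' \<in> A" and X: "smooth_vec_on A U X"
  shows "smooth_form_on A 1 U (\<lambda>q vs. chart_metric c' q (X q) (vs ! 0))"
proof (rule smooth_form_onI)
  fix c and vs :: "'b list" assume c: "c \<in> A" and vs: "length vs = 1"
  let ?S = "coord c ` (dom_of c \<inter> U)"
  have S: "open ?S" by (rule open_A_image[OF c U(1)])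
  have "smooth_on ?S (\<lambda>x. fd (chart_trans c c') x (vec_rep A c X x) \<bullet> fd (chart_trans c c') x (vs ! 0))"
    by (rule smooth_on_inner[OF smooth_on_fd_eval[OF smooth_trans_subset[OF c c' U(2)] smooth_vec_onD[OF X c] S]
      smooth_on_fd[OF smooth_trans_subset[OF c c' U(2)]] S])
  then show "smooth_on ?S (\<lambda>x. form_rep A c (\<lambda>q vs. chart_metric c' q (X q) (vs ! 0)) x vs)"
  proof (rule smooth_on_cong[OF _ S])
    fix x assume x: "x \<in> ?S"
    have "dchart A c (param c x) (dparam A c (param c x) v) = v" for v
      by (rule dparam_dchart(2)[OF A_compatible[OF c] A_param(1)[OF c x]])
    then show "fd (chart_trans c c') x (vec_rep A c X x) \<bullet> fd (chart_trans c c') x (vs ! 0)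
      = form_rep A c (\<lambda>q vs. chart_metric c' q (X q) (vs ! 0)) x vs"
      using vs by (simp only: form_rep_def chart_metric_def dchart_param[OF c c' U(2) x] vec_rep_def nth_map One_nat_def zero_less_Suc)
  qed
qed

text \<open>Gram--Schmidt for the anchors of sections of \<open>L\<close>, with respect to the inner product
  of a single chart.\<close>

lemma orthogonal_sections:
  assumes L: "almost_dirac A L" and k: "\<And>q. dim (pr1 L q) = k" and m: "m \<le> k"
  shows "\<exists>V s. open V \<and> p \<in> V \<and> V \<subseteq> dom_of (chart_at A p) \<and>
    (\<forall>i<m. smooth_section_on A V (s i) \<and> (\<forall>q\<in>V. s i q \<in> L q \<and> fst (s i q) \<noteq> 0)) \<and>
    (\<forall>i<m. \<forall>j<m. i \<noteq> j \<longrightarrow> (\<forall>q\<in>V. chart_metric (chart_at A p) q (fst (s i q)) (fst (s j q)) = 0))"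
  using m
proof (induction m)
  case 0
  show ?case
    using chart_at is_chartD(1)[OF A_is_chart[OF chart_at(1)]] by (intro exI[of _ "dom_of (chart_at A p)"]) auto
next
  case (Suc m)
  define c where "c = chart_at A p"
  have c: "c \<in> A" "p \<in> dom_of c" unfolding c_def by (rule chart_at)+
  obtain V s where V: "open V" "p \<in> V" "V \<subseteq> dom_of c"
    and s0: "\<forall>i<m. smooth_section_on A V (s i) \<and> (\<forall>q\<in>V. s i q \<in> L q \<and> fst (s i q) \<noteq> 0)"
    and orth0: "\<forall>i<m. \<forall>j<m. i \<noteq> j \<longrightarrow> (\<forall>q\<in>V. chart_metric c q (fst (s i q)) (fst (s j q)) = 0)"
    using Suc.IH[OF Suc_leD[OF Suc.prems], folded c_def] by (elim exE conjE)
  have s: "\<And>i. i < m \<Longrightarrow> smooth_section_on A V (s i)" "\<And>i q. i < m \<Longrightarrow> q \<in> V \<Longrightarrow> s i q \<in> L q"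
      "\<And>i q. i < m \<Longrightarrow> q \<in> V \<Longrightarrow> fst (s i q) \<noteq> 0"
    using s0 by simp_all
  have orth: "chart_metric c q (fst (s i q)) (fst (s j q)) = 0" if "i < m" "j < m" "i \<noteq> j" "q \<in> V" for i j q
    using orth0 that by simp
  obtain r where r: "\<And>p. \<exists>U (e :: nat \<Rightarrow> 'a \<Rightarrow> 'b gen_vec).
     open U \<and> p \<in> U \<and> (\<forall>i<r. smooth_section_on A U (e i)) \<and>
     (\<forall>q\<in>U. inj_on (\<lambda>i. e i q) {..<r} \<and> independent ((\<lambda>i. e i q) ` {..<r}) \<and>
            span ((\<lambda>i. e i q) ` {..<r}) = L q)"
    using L unfolding almost_dirac_def subbundle_def by blast
  obtain U e where U: "open U" "p \<in> U" and e: "\<And>i. i < r \<Longrightarrow> smooth_section_on A U (e i)"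
    and span: "\<And>q. q \<in> U \<Longrightarrow> span ((\<lambda>i. e i q) ` {..<r}) = L q"
    using r[of p] by blast
  have subsp: "subspace (L q)" for q
    using L by (simp add: almost_dirac_def maximal_isotropic_def isotropic_def)
  \<comment> \<open>The anchors of a frame of \<open>L\<close> span the distribution at
    \<open>p\<close>, whose dimension exceeds \<open>m\<close>, so one of them escapes the span of
    the \<open>m\<close> anchors found so far.\<close>
  have "\<exists>j<r. fst (e j p) \<notin> span ((\<lambda>i. fst (s i p)) ` {..<m})"
  proof (rule ccontr)
    assume "\<not> ?thesis"
    then have sub: "fst ` (\<lambda>i. e i p) ` {..<r} \<subseteq> span ((\<lambda>i. fst (s i p)) ` {..<m})" by auto
    have "pr1 L p = span (fst ` (\<lambda>i. e i p) ` {..<r})"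
      unfolding pr1_def span[OF U(2), symmetric] using linear_span_image[OF linear_fst] by metis
    also have "\<dots> \<subseteq> span ((\<lambda>i. fst (s i p)) ` {..<m})"
      using sub by (rule span_minimal) (rule subspace_span)
    finally have "dim (pr1 L p) \<le> card ((\<lambda>i. fst (s i p)) ` {..<m})"
      by (rule dim_le_card_finite_dim) simp
    also have "\<dots> \<le> m" using card_image_le[of "{..<m}"] by simp
    finally show False using k[of p] Suc.prems by simp
  qed
  then obtain j where j: "j < r" "fst (e j p) \<notin> span ((\<lambda>i. fst (s i p)) ` {..<m})" by blast
  define V' where "V' = V \<inter> U"
  have V': "open V'" "p \<in> V'" "V' \<subseteq> dom_of c" unfolding V'_def using U V by auto
  \<comment> \<open>The orthogonal projection coefficients of the anchor. They are applied to the
    full sections, not just to anchors, so the result stays in \<open>L\<close>.\<close>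
  define f where "f i q = chart_metric c q (fst (s i q)) (fst (e j q)) / chart_metric c q (fst (s i q)) (fst (s i q))" for i q
  define t where "t q = e j q - (\<Sum>i<m. f i q *\<^sub>R s i q)" for q
  have sV': "smooth_section_on A V' (s i)" if "i < m" for i
    using s(1)[OF that] by (rule smooth_section_on_subset) (auto simp: V'_def)
  have eV': "smooth_section_on A V' (e j)"
    using e[OF j(1)] by (rule smooth_section_on_subset) (auto simp: V'_def)
  have vec: "smooth_vec_on A V' (\<lambda>q. fst (s i q))" if "i < m" for i
    using sV'[OF that] by (simp add: smooth_section_on_def comp_def)
  have vece: "smooth_vec_on A V' (\<lambda>q. fst (e j q))"
    using eV' by (simp add: smooth_section_on_def comp_def)
  have pos: "chart_metric c q (fst (s i q)) (fst (s i q)) \<noteq> 0" if "i < m" "q \<in> V'" for i q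
    using chart_metric_eq_0[OF c(1)] s(3)[OF that(1)] that(2) V'(3) unfolding V'_def by blast
  have f: "smooth_fun_on V' (f i)" if "i < m" for i
    unfolding f_def
    by (intro smooth_fun_on_divide smooth_fun_on_chart_metric V' c vec vece that pos)
  have t: "smooth_section_on A V' t"
    unfolding t_def by (rule smooth_section_on_diff_scale[OF V'(1) eV' f sV']) auto
  have tL: "t q \<in> L q" if "q \<in> V'" for q
  proof -
    have "e j q \<in> L q" using span[of q] that j(1) span_base[of "e j q" "(\<lambda>i. e i q) ` {..<r}"] unfolding V'_def by blast
    moreover have "(\<Sum>i<m. f i q *\<^sub>R s i q) \<in> L q"
      using s(2) that unfolding V'_def by (intro subspace_sum[OF subsp] subspace_scale[OF subsp]) auto
    ultimately show ?thesis unfolding t_def by (rule subspace_diff[OF subsp])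
  qed
  have fst_t: "fst (t q) = fst (e j q) - (\<Sum>i<m. f i q *\<^sub>R fst (s i q))" for q
    by (simp add: t_def fst_sum)
  have tp: "fst (t p) \<noteq> 0"
  proof
    assume "fst (t p) = 0"
    then have "fst (e j p) = (\<Sum>i<m. f i p *\<^sub>R fst (s i p))" by (simp add: fst_t)
    also have "\<dots> \<in> span ((\<lambda>i. fst (s i p)) ` {..<m})"
      by (intro span_sum span_scale span_base) auto
    finally show False using j(2) by simp
  qed
  have torth: "chart_metric c q (fst (s i q)) (fst (t q)) = 0" if i: "i < m" and q: "q \<in> V'" for i q
  proof -
    have lin: "linear (chart_metric c q (fst (s i q)))" using linear_chart_metric[OF c(1)] q V'(3) by blast
    have "chart_metric c q (fst (s i q)) (fst (t q)) = chart_metric c q (fst (s i q)) (fst (e j q))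
        - (\<Sum>l<m. f l q * chart_metric c q (fst (s i q)) (fst (s l q)))"
      by (simp add: fst_t linear_diff[OF lin] linear_sum[OF lin] linear_scale[OF lin])
    also have "(\<Sum>l<m. f l q * chart_metric c q (fst (s i q)) (fst (s l q)))
        = (\<Sum>l\<in>{i}. f l q * chart_metric c q (fst (s i q)) (fst (s l q)))"
      using i q orth[of i _ q] by (intro sum.mono_neutral_right) (auto simp: V'_def)
    finally show ?thesis using pos[OF i q] by (simp add: f_def)
  qed
  \<comment> \<open>The new anchor is known to be nonzero only at \<open>p\<close>; continuity of
    its squared length provides a neighbourhood.\<close>
  define W where "W = {q \<in> V'. chart_metric c q (fst (t q)) (fst (t q)) \<noteq> 0}"
  have "smooth_fun_on V' (\<lambda>q. chart_metric c q (fst (t q)) (fst (t q)))"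
    using t by (intro smooth_fun_on_chart_metric V' c) (simp_all add: smooth_section_on_def comp_def)
  then have "continuous_on V' (\<lambda>q. chart_metric c q (fst (t q)) (fst (t q)))"
    by (rule smooth_fun_on_imp_continuous_on[OF _ c(1) V'(3)])
  then have "open (V' \<inter> (\<lambda>q. chart_metric c q (fst (t q)) (fst (t q))) -` (- {0}))"
    using V'(1) by (rule continuous_open_preimage) auto
  moreover have "V' \<inter> (\<lambda>q. chart_metric c q (fst (t q)) (fst (t q))) -` (- {0}) = W"
    unfolding W_def by auto
  ultimately have W: "open W" "p \<in> W" "W \<subseteq> V'"
    using V' tp chart_metric_eq_0[OF c] unfolding W_def by auto
  define s' where "s' i = (if i = m then t else s i)" for i
  have "smooth_section_on A W (s' i)" if "i < Suc m" for i
  proof -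
    have "smooth_section_on A V' (s' i)"
      using that t sV'[of i] by (cases "i = m") (simp_all add: s'_def)
    then show ?thesis using W(3) by (rule smooth_section_on_subset)
  qed
  moreover have "s' i q \<in> L q" if "i < Suc m" "q \<in> W" for i q
    using that tL s(2)[of i q] W(3) by (cases "i = m") (auto simp: s'_def V'_def)
  moreover have "fst (s' i q) \<noteq> 0" if "i < Suc m" "q \<in> W" for i q
  proof (cases "i = m")
    case True
    have "q \<in> dom_of c" using that(2) W(3) V'(3) by blast
    then have "fst (t q) \<noteq> 0" using that(2) chart_metric_eq_0[OF c(1)] unfolding W_def by auto
    then show ?thesis using True by (simp add: s'_def)
  next
    case False
    then show ?thesis using that s(3)[of i q] W(3) by (auto simp: s'_def V'_def)
  qed
  moreover have "chart_metric c q (fst (s' i q)) (fst (s' l q)) = 0"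
    if "i < Suc m" "l < Suc m" "i \<noteq> l" "q \<in> W" for i l q
  proof -
    have q: "q \<in> V'" using that(4) W(3) by blast
    then have "q \<in> V" by (simp add: V'_def)
    have "i < m \<and> l < m \<or> i = m \<and> l < m \<or> l = m \<and> i < m" using that(1-3) by linarith
    then consider "i < m" "l < m" | "i = m" "l < m" | "l = m" "i < m" by blast
    then show ?thesis
    proof cases
      case 1
      then show ?thesis using orth[OF 1 that(3) \<open>q \<in> V\<close>] by (simp add: s'_def)
    next
      case 2
      then show ?thesis using torth[OF 2(2) q] by (simp add: s'_def chart_metric_commute)
    next
      case 3
      then show ?thesis using torth[OF 3(2) q] by (simp add: s'_def)
    qed
  qed
  ultimately show ?case
    using W V'(3) unfolding c_def by (intro exI[of _ W] exI[of _ s']) auto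
qed

text \<open>The factor \<open>a\<close> is 1 for a genuine extension, the value of a cutoff function
  while gluing, and -1 for the form whose exterior derivative is the twist.\<close>

definition extends_to_form :: "('a \<Rightarrow> 'b gen_vec set) \<Rightarrow> 'a \<Rightarrow> real \<Rightarrow> ('b list \<Rightarrow> real) \<Rightarrow> bool" where
  "extends_to_form L q a \<mu> \<longleftrightarrow> (\<forall>l\<in>L q. \<forall>y\<in>pr1 L q. \<mu> [fst l, y] = a * blinfun_apply (snd l) y)"

text \<open>With \<theta> the coframe dual to the orthogonal anchors, the form is the sum of
  \<open>F i j\<close> times the tensor product of \<open>\<theta> i\<close> and
  \<open>\<theta> j\<close>, where \<open>F i j\<close> evaluates the covector of the i-th section
  on the j-th anchor. Isotropy of \<open>L\<close> makes these coefficients skew, and the coframe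
  annihilates the metric complement of the distribution.\<close>

lemma local_form:
  assumes L: "almost_dirac A L" and k: "\<And>q. dim (pr1 L q) = k"
  shows "\<exists>V \<omega>. open V \<and> p \<in> V \<and> (\<forall>q\<in>V. alternating_multilinear 2 (\<omega> q)) \<and> smooth_form_on A 2 V \<omega> \<and>
    (\<forall>q\<in>V. extends_to_form L q 1 (\<omega> q))"
proof -
  define c where "c = chart_at A p"
  have c: "c \<in> A" "p \<in> dom_of c" unfolding c_def by (rule chart_at)+
  obtain V s where V: "open V" "p \<in> V" "V \<subseteq> dom_of c"
    and s0: "\<forall>i<k. smooth_section_on A V (s i) \<and> (\<forall>q\<in>V. s i q \<in> L q \<and> fst (s i q) \<noteq> 0)"
    and orth0: "\<forall>i<k. \<forall>j<k. i \<noteq> j \<longrightarrow> (\<forall>q\<in>V. chart_metric c q (fst (s i q)) (fst (s j q)) = 0)"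
    using orthogonal_sections[OF L k order_refl, of p, folded c_def] by (elim exE conjE)
  have s: "\<And>i. i < k \<Longrightarrow> smooth_section_on A V (s i)" "\<And>i q. i < k \<Longrightarrow> q \<in> V \<Longrightarrow> s i q \<in> L q"
      "\<And>i q. i < k \<Longrightarrow> q \<in> V \<Longrightarrow> fst (s i q) \<noteq> 0"
    using s0 by simp_all
  have orth: "chart_metric c q (fst (s i q)) (fst (s j q)) = 0" if "i < k" "j < k" "i \<noteq> j" "q \<in> V" for i j q
    using orth0 that by simp
  have iso: "pairing a b = 0" if "a \<in> L q" "b \<in> L q" for a b q
    using L that by (simp add: almost_dirac_def maximal_isotropic_def isotropic_def)
  have subsp: "subspace (L q)" for q
    using L by (simp add: almost_dirac_def maximal_isotropic_def isotropic_def)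
  have pos: "chart_metric c q (fst (s i q)) (fst (s i q)) \<noteq> 0" if "i < k" "q \<in> V" for i q
    using chart_metric_eq_0[OF c(1), of q "fst (s i q)"] s(3)[OF that] that(2) V(3) by blast
  define \<theta> where "\<theta> i q v = chart_metric c q (fst (s i q)) v / chart_metric c q (fst (s i q)) (fst (s i q))" for i q v
  define F where "F i j q = blinfun_apply (snd (s i q)) (fst (s j q))" for i j q
  define \<omega> where "\<omega> q vs = (\<Sum>i<k. \<Sum>j<k. F i j q * (\<theta> i q (vs ! 0) * \<theta> j q (vs ! 1)))" for q and vs :: "'b list"
  have lin\<theta>: "linear (\<theta> i q)" if "q \<in> V" for i q
  proof -
    have lin: "linear (chart_metric c q (fst (s i q)))" using linear_chart_metric[OF c(1)] that V(3) by blast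
    show ?thesis
      by (rule linearI) (simp_all add: \<theta>_def linear_add[OF lin] linear_scale[OF lin] add_divide_distrib)
  qed
  have \<theta>s: "\<theta> i q (fst (s j q)) = (if i = j then 1 else 0)" if "i < k" "j < k" "q \<in> V" for i j q
    using orth[OF that(1,2) _ that(3)] pos[OF that(1,3)] by (cases "i = j") (simp_all add: \<theta>_def)
  have skew: "F i j q = - F j i q" if "i < k" "j < k" "q \<in> V" for i j q
    using iso[OF s(2)[OF that(1,3)] s(2)[OF that(2,3)]] by (simp add: F_def pairing_def)
  \<comment> \<open>Constant rank is used here: the \<open>k\<close> orthogonal anchors remain a
    basis of the distribution at every point of \<open>V\<close>.\<close>
  have expand: "x = (\<Sum>i<k. \<theta> i q x *\<^sub>R fst (s i q))" if x: "x \<in> pr1 L q" and q: "q \<in> V" for x q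
  proof -
    let ?f = "\<lambda>i. fst (s i q)" and ?d = "dchart A c q" and ?e = "dparam A c q"
    have qc: "q \<in> dom_of c" using q V(3) by blast
    have de: "?e (?d v) = v" "?d (?e v) = v" for v using dparam_dchart[OF A_compatible[OF c(1)] qc] by simp_all
    have "inj_on ?f {..<k}"
    proof (rule inj_onI, rule ccontr)
      fix i j assume ij: "i \<in> {..<k}" "j \<in> {..<k}" "?f i = ?f j" "i \<noteq> j"
      then show False using orth[of i j q] pos[of i q] q by simp
    qed
    have d0: "?d 0 = 0" by (rule linear_0[OF linear_dchart[OF A_compatible[OF c(1)] qc]])
    \<comment> \<open>Orthogonality is available in chart coordinates, so independence is obtained
      there and carried back by the inverse isomorphism \<open>?e\<close>.\<close>
    have "independent (?d ` ?f ` {..<k})"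
    proof (rule pairwise_orthogonal_independent)
      show "pairwise orthogonal (?d ` ?f ` {..<k})"
        using orth q by (auto simp: pairwise_def orthogonal_def chart_metric_def[symmetric])
      show "0 \<notin> ?d ` ?f ` {..<k}"
      proof
        assume "0 \<in> ?d ` ?f ` {..<k}"
        then obtain i where i: "i < k" "?d (?f i) = 0" by auto
        then show False using pos[OF i(1) q] by (simp add: chart_metric_def)
      qed
    qed
    then have "independent (?e ` ?d ` ?f ` {..<k})"
      by (rule linear_independent_injective_image[OF linear_dparam[OF A_compatible[OF c(1)] qc]])
         (rule inj_on_inverseI, rule de(2))
    moreover have "?e ` ?d ` ?f ` {..<k} = ?f ` {..<k}" by (simp add: image_image de(1))
    ultimately have ind: "independent (?f ` {..<k})" by simp
    have "pr1 L q \<subseteq> span (?f ` {..<k})"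
    proof (rule independent_spans[OF _ ind])
      show "?f ` {..<k} \<subseteq> pr1 L q" using s(2)[OF _ q] by (auto simp: pr1_def)
      show "dim (pr1 L q) \<le> card (?f ` {..<k})"
        using card_image[OF \<open>inj_on ?f {..<k}\<close>] k by simp
    qed simp
    then have "x \<in> span (?f ` {..<k})" using x by blast
    then obtain u where u: "x = (\<Sum>i<k. u i *\<^sub>R ?f i)"
      using span_image_finite_explicit[OF finite_lessThan \<open>inj_on ?f {..<k}\<close>] by blast
    have "\<theta> i q x = u i" if "i < k" for i
    proof -
      have "\<theta> i q x = (\<Sum>j<k. u j * \<theta> i q (?f j))"
        unfolding u by (simp add: linear_sum[OF lin\<theta>[OF q]] linear_scale[OF lin\<theta>[OF q]])
      also have "\<dots> = (\<Sum>j<k. if i = j then u j else 0)"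
        using \<theta>s[OF that _ q] by (intro sum.cong refl) simp
      also have "\<dots> = u i" using that by simp
      finally show ?thesis .
    qed
    then have "(\<Sum>i<k. \<theta> i q x *\<^sub>R ?f i) = (\<Sum>i<k. u i *\<^sub>R ?f i)"
      by (intro sum.cong refl) simp
    then show ?thesis using u by simp
  qed
  have "alternating_multilinear 2 (\<omega> q)" if q: "q \<in> V" for q
    unfolding alternating_multilinear_2_iff
  proof (intro conjI allI)
    show "linear (\<lambda>u. \<omega> q [u, v])" "linear (\<lambda>u. \<omega> q [v, u])" for v
      by (rule linearI; simp add: \<omega>_def linear_add[OF lin\<theta>[OF q]] linear_scale[OF lin\<theta>[OF q]]
        algebra_simps sum.distrib sum_distrib_left)+
    \<comment> \<open>Skewness of the coefficients combined with an interchange of the two summation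
      indices.\<close>
    have "\<omega> q [u, u] = - \<omega> q [u, u]" for u
    proof -
      have "\<omega> q [u, u] = (\<Sum>i<k. \<Sum>j<k. - (F j i q * (\<theta> j q u * \<theta> i q u)))"
        unfolding \<omega>_def
      proof (intro sum.cong refl)
        fix i j assume "i \<in> {..<k}" "j \<in> {..<k}"
        then have F: "F i j q = - F j i q" by (intro skew q) simp_all
        show "F i j q * (\<theta> i q ([u, u] ! 0) * \<theta> j q ([u, u] ! 1)) = - (F j i q * (\<theta> j q u * \<theta> i q u))"
          unfolding F by simp
      qed
      also have "\<dots> = - (\<Sum>j<k. \<Sum>i<k. F j i q * (\<theta> j q u * \<theta> i q u))"
        unfolding sum_negf by (subst sum.swap) (rule refl)
      also have "\<dots> = - \<omega> q [u, u]" by (simp add: \<omega>_def)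
      finally show ?thesis .
    qed
    then show "\<omega> q [u, u] = 0" for u by (simp add: eq_neg_iff_add_eq_0)
  qed
  moreover have "smooth_form_on A 2 V \<omega>"
  proof (rule smooth_form_onI)
    fix c' and vs :: "'b list" assume c': "c' \<in> A" and vs: "length vs = 2"
    let ?S = "coord c' ` (dom_of c' \<inter> V)"
    have S: "open ?S" by (rule open_A_image[OF c' V(1)])
    have vec: "smooth_vec_on A V (\<lambda>q. fst (s i q))" if "i < k" for i
      using s(1)[OF that] by (simp add: smooth_section_on_def comp_def)
    have Fs: "smooth_on ?S (\<lambda>x. F i j (param c' x))" if "i < k" "j < k" for i j
      unfolding F_def by (intro smooth_fun_onD[OF _ c'] smooth_fun_on_covec_apply V s that)
    have \<theta>r: "smooth_on ?S (\<lambda>x. \<theta> i (param c' x) (dparam A c' (param c' x) v))" if "i < k" for i v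
    proof -
      have "smooth_on ?S (\<lambda>x. form_rep A c' (\<lambda>q vs. chart_metric c q (fst (s i q)) (vs ! 0)) x [v])"
        by (rule smooth_form_onD[OF smooth_form_on_chart_metric[OF V(1,3) c(1) vec[OF that]] c']) simp
      moreover have "smooth_on ?S (\<lambda>x. inverse (chart_metric c (param c' x) (fst (s i (param c' x))) (fst (s i (param c' x)))))"
        by (intro smooth_on_inverse smooth_fun_onD[OF _ c'] smooth_fun_on_chart_metric V c vec that S pos A_param[OF c'])
      ultimately show ?thesis
        unfolding \<theta>_def divide_inverse by (simp add: form_rep_def smooth_on_mult S)
    qed
    have "smooth_on ?S (\<lambda>x. \<Sum>i<k. \<Sum>j<k. F i j (param c' x) *
      (\<theta> i (param c' x) (dparam A c' (param c' x) (vs ! 0)) * \<theta> j (param c' x) (dparam A c' (param c' x) (vs ! 1))))"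
      using Fs \<theta>r by (intro smooth_on_sum smooth_on_mult S) simp_all
    then show "smooth_on ?S (\<lambda>x. form_rep A c' \<omega> x vs)"
      using vs by (simp add: form_rep_def \<omega>_def)
  qed
  moreover have "extends_to_form L q 1 (\<omega> q)" if q: "q \<in> V" for q
    unfolding extends_to_form_def
  proof (intro ballI)
    fix l y assume l: "l \<in> L q" and y: "y \<in> pr1 L q"
    define t where "t = (\<Sum>i<k. \<theta> i q (fst l) *\<^sub>R s i q)"
    have x: "fst l \<in> pr1 L q" using l by (auto simp: pr1_def)
    have t: "t \<in> L q" unfolding t_def
      by (intro subspace_sum[OF subsp] subspace_scale[OF subsp] s(2) q) simp
    have ft: "fst t = fst l" using expand[OF x q, symmetric] by (simp add: t_def fst_sum)
    obtain m where m: "m \<in> L q" "y = fst m" using y by (auto simp: pr1_def)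
    \<comment> \<open>By isotropy both \<open>l\<close> and \<open>t\<close> pair to 0 with
      \<open>m\<close>. As their anchors agree, so do their covectors on \<open>y\<close>: the
      covector on the distribution is determined by the anchor.\<close>
    have "snd l y = snd t y"
      using iso[OF l m(1)] iso[OF t m(1)] ft m(2) by (simp add: pairing_def)
    also have "\<dots> = (\<Sum>i<k. \<theta> i q (fst l) * snd (s i q) y)"
      by (simp add: t_def snd_sum blinfun.sum_left blinfun.scaleR_left)
    also have "\<dots> = (\<Sum>i<k. \<theta> i q (fst l) * (\<Sum>j<k. \<theta> j q y * F i j q))"
    proof (intro sum.cong refl)
      fix i
      have "snd (s i q) y = snd (s i q) (\<Sum>j<k. \<theta> j q y *\<^sub>R fst (s j q))"
        by (rule arg_cong[OF expand[OF y q]])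
      then show "\<theta> i q (fst l) * snd (s i q) y = \<theta> i q (fst l) * (\<Sum>j<k. \<theta> j q y * F i j q)"
        by (simp add: F_def blinfun.sum_right blinfun.scaleR_right)
    qed
    also have "\<dots> = \<omega> q [fst l, y]"
      by (simp add: \<omega>_def sum_distrib_left ac_simps)
    finally show "\<omega> q [fst l, y] = 1 * snd l y" by simp
  qed
  ultimately show ?thesis using V by blast
qed

text \<open>A bump in coordinates, extended by 0 beyond the chart. The support set \<open>K\<close>
  is the image of a compact ball, hence closed in a Hausdorff space; this is what makes the
  extension smooth across the boundary of the chart domain.\<close>

lemma smooth_cutoff:
  assumes W: "open W" "p \<in> W"
  obtains F N K where "smooth_fun_on UNIV F" "open N" "p \<in> N" "\<And>q. q \<in> N \<Longrightarrow> F q = 1"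
    "closed K" "K \<subseteq> W" "\<And>q. q \<notin> K \<Longrightarrow> F q = 0"
proof -
  define c where "c = chart_at A p"
  have c: "c \<in> A" "p \<in> dom_of c" unfolding c_def by (rule chart_at)+
  note ch = A_is_chart[OF c(1)]
  have O: "open (coord c ` (dom_of c \<inter> W))" by (rule open_A_image[OF c(1) W(1)])
  have "coord c p \<in> coord c ` (dom_of c \<inter> W)" using c W by blast
  then obtain d where d: "d > 0" "ball (coord c p) d \<subseteq> coord c ` (dom_of c \<inter> W)"
    using O open_contains_ball by blast
  \<comment> \<open>One third, so that the closed ball of radius \<open>2 * r\<close> still fits
    into the open ball of radius \<open>d\<close>.\<close>
  define r where "r = d / 3"
  have r: "r > 0" "cball (coord c p) (2 * r) \<subseteq> coord c ` (dom_of c \<inter> W)"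
    using d unfolding r_def by (auto simp: subset_iff)
  obtain f :: "'b \<Rightarrow> real" where f: "smooth_on UNIV f" "\<And>x. x \<in> ball (coord c p) r \<Longrightarrow> f x = 1"
    "\<And>x. x \<notin> cball (coord c p) (2 * r) \<Longrightarrow> f x = 0"
    using smooth_bump[OF r(1)] by blast
  define F where "F q = (if q \<in> dom_of c then f (coord c q) else 0)" for q
  define K where "K = param c ` cball (coord c p) (2 * r)"
  define N where "N = dom_of c \<inter> coord c -` ball (coord c p) r"
  have "compact K"
    unfolding K_def
    by (intro compact_continuous_image compact_cball_finite_dim continuous_on_subset[OF is_chartD(7)[OF ch]])
       (use r(2) in blast)
  then have K: "closed K" by (rule compact_imp_closed)
  have KW: "q \<in> dom_of c" "q \<in> W" if "q \<in> K" for q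
  proof -
    obtain z where z: "z \<in> cball (coord c p) (2 * r)" "q = param c z"
      using \<open>q \<in> K\<close> unfolding K_def by (rule imageE)
    have "z \<in> coord c ` (dom_of c \<inter> W)" by (rule subsetD[OF r(2) z(1)])
    from A_param(1,2)[OF c(1) this] show "q \<in> dom_of c" "q \<in> W" unfolding z(2) .
  qed
  have F0: "F q = 0" if "q \<notin> K" for q
  proof (cases "q \<in> dom_of c")
    case True
    have "coord c q \<notin> cball (coord c p) (2 * r)"
    proof
      assume "coord c q \<in> cball (coord c p) (2 * r)"
      then have "param c (coord c q) \<in> K" unfolding K_def by (rule imageI)
      then show False using that is_chartD(3)[OF ch True] by simp
    qed
    then show ?thesis using f(3) by (simp add: F_def)
  qed (simp add: F_def)
  have N: "open N" unfolding N_def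
    using is_chartD(6)[OF ch] is_chartD(1)[OF ch] open_ball by (rule continuous_open_preimage)
  have "smooth_fun_on UNIV F"
  proof (rule smooth_fun_onI, rule smooth_on_local)
    fix c' x assume c': "c' \<in> A" and x: "x \<in> coord c' ` (dom_of c' \<inter> UNIV)"
    have px: "param c' x \<in> dom_of c'" "coord c' (param c' x) = x" using A_param[OF c' x] by blast+
    show "\<exists>T. open T \<and> x \<in> T \<and> smooth_on T (\<lambda>x. F (param c' x))"
    proof (cases "param c' x \<in> dom_of c")
      case True
      let ?T = "coord c' ` (dom_of c' \<inter> dom_of c)"
      have T: "open ?T" by (rule open_A_image[OF c' is_chartD(1)[OF ch]])
      have "smooth_on ?T (\<lambda>x. f (chart_trans c' c x))"
        using smooth_on_compose[OF f(1) smooth_trans_subset[OF c' c(1) order_refl] T] by simp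
      then have "smooth_on ?T (\<lambda>x. F (param c' x))"
        by (rule smooth_on_cong[OF _ T]) (use A_param(2)[OF c'] in \<open>simp add: F_def\<close>)
      moreover have "x \<in> ?T" using px True by (metis IntI imageI)
      ultimately show ?thesis using T by blast
    next
      case False
      \<comment> \<open>A point outside the chart has the open complement of \<open>K\<close> as a
        neighbourhood, and there the function is constantly 0.\<close>
      then have nK: "param c' x \<notin> K" using KW(1) by blast
      let ?T = "coord c' ` (dom_of c' \<inter> - K)"
      have T: "open ?T" by (rule open_A_image[OF c' open_Compl[OF K]])
      have "smooth_on ?T (\<lambda>x. F (param c' x))"
      proof (rule smooth_on_cong[OF smooth_on_const[of _ 0] T])
        fix x assume "x \<in> ?T"
        then have "param c' x \<in> - K" by (rule A_param(2)[OF c'])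
        then show "0 = F (param c' x)" using F0 by simp
      qed
      moreover have "x \<in> ?T" using px nK by (metis ComplI IntI imageI)
      ultimately show ?thesis using T by blast
    qed
  qed
  moreover have "p \<in> N" using c r(1) by (simp add: N_def)
  moreover have "F q = 1" if "q \<in> N" for q using that f(2) by (simp add: N_def F_def)
  moreover have "K \<subseteq> W" using KW(2) by (rule subsetI)
  ultimately show thesis using N K F0 by (intro that)
qed

lemma alternating_multilinear_2_sum:
  assumes "\<And>i. i \<in> I \<Longrightarrow> alternating_multilinear 2 (\<mu> i)"
  shows "alternating_multilinear 2 (\<lambda>vs. \<Sum>i\<in>I. a i * \<mu> i vs)"
proof -
  have \<mu>: "linear (\<lambda>u. \<mu> i [u, v])" "linear (\<lambda>u. \<mu> i [v, u])" "\<mu> i [v, v] = 0" if "i \<in> I" for i v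
    using assms[OF that] by (simp_all add: alternating_multilinear_2_iff)
  show ?thesis
    unfolding alternating_multilinear_2_iff
  proof (intro conjI allI)
    fix v
    have "linear (\<lambda>u. a i * \<mu> i [u, v])" "linear (\<lambda>u. a i * \<mu> i [v, u])" if "i \<in> I" for i
      using \<mu>(1,2)[OF that, of v] by (auto simp: linear_iff algebra_simps)
    then show "linear (\<lambda>u. \<Sum>i\<in>I. a i * \<mu> i [u, v])" "linear (\<lambda>u. \<Sum>i\<in>I. a i * \<mu> i [v, u])"
      by (auto intro: linear_compose_sum)
    show "(\<Sum>i\<in>I. a i * \<mu> i [v, v]) = 0" using \<mu>(3) by simp
  qed
qed

text \<open>Outside \<open>V\<close> the local form has arbitrary values, but the cutoff multiplies
  them by 0. Since the support \<open>K\<close> is closed and inside \<open>V\<close>, the product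
  is a global smooth form.\<close>

lemma local_form_cutoff:
  assumes L: "almost_dirac A L" and k: "\<And>q. dim (pr1 L q) = k"
  shows "\<exists>F N \<Omega>. smooth_fun_on UNIV F \<and> open N \<and> p \<in> N \<and> (\<forall>q\<in>N. F q = 1) \<and>
    smooth_form_on A 2 UNIV \<Omega> \<and> (\<forall>q. alternating_multilinear 2 (\<Omega> q)) \<and> (\<forall>q. extends_to_form L q (F q) (\<Omega> q))"
proof -
  obtain V \<omega> where V: "open V" "p \<in> V" and alt: "\<And>q. q \<in> V \<Longrightarrow> alternating_multilinear 2 (\<omega> q)"
    and sm: "smooth_form_on A 2 V \<omega>" and ext: "\<And>q. q \<in> V \<Longrightarrow> extends_to_form L q 1 (\<omega> q)"
    using local_form[OF L k, of p] by blast
  obtain F N K where F: "smooth_fun_on UNIV F" "open N" "p \<in> N" "\<And>q. q \<in> N \<Longrightarrow> F q = 1"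
    and K: "closed K" "K \<subseteq> V" "\<And>q. q \<notin> K \<Longrightarrow> F q = 0"
    using smooth_cutoff[OF V] by blast
  define \<Omega> where "\<Omega> q vs = F q * \<omega> q vs" for q vs
  have 0: "\<Omega> q = (\<lambda>vs. 0)" if "q \<notin> V" for q
  proof -
    have "F q = 0" using K(2,3) that by blast
    then show ?thesis by (simp add: \<Omega>_def fun_eq_iff)
  qed
  have "alternating_multilinear 2 (\<Omega> q)" for q
  proof (cases "q \<in> V")
    case True
    \<comment> \<open>A sum over a one-element index set expresses multiplication by a
      scalar.\<close>
    from alternating_multilinear_2_sum[of "{()}" "\<lambda>_. \<omega> q" "\<lambda>_. F q"] alt[OF True]
    show ?thesis by (simp add: \<Omega>_def[abs_def])
  next
    case False
    then show ?thesis by (simp add: 0 alternating_multilinear_def linear_zero)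
  qed
  moreover have "extends_to_form L q (F q) (\<Omega> q)" for q
  proof (cases "q \<in> V")
    case True
    then show ?thesis using ext[OF True] by (simp add: extends_to_form_def \<Omega>_def)
  next
    case False
    then have "F q = 0" using K by blast
    then show ?thesis by (simp add: extends_to_form_def \<Omega>_def)
  qed
  moreover have "smooth_form_on A 2 UNIV \<Omega>"
  proof (rule smooth_form_onI, rule smooth_on_local)
    fix c x and vs :: "'b list" assume c: "c \<in> A" and vs: "length vs = 2" and x: "x \<in> coord c ` (dom_of c \<inter> UNIV)"
    have px: "param c x \<in> dom_of c" "coord c (param c x) = x" using A_param[OF c x] by blast+
    show "\<exists>T. open T \<and> x \<in> T \<and> smooth_on T (\<lambda>x. form_rep A c \<Omega> x vs)"
    proof (cases "param c x \<in> V")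
      case True
      let ?T = "coord c ` (dom_of c \<inter> V)"
      have T: "open ?T" by (rule open_A_image[OF c V(1)])
      have "smooth_on ?T (\<lambda>x. F (param c x))"
        using smooth_fun_onD[OF F(1) c] by (rule smooth_on_subset) blast
      from smooth_on_mult[OF this smooth_form_onD[OF sm c vs] T]
      have "smooth_on ?T (\<lambda>x. form_rep A c \<Omega> x vs)" by (simp add: form_rep_def \<Omega>_def)
      moreover have "x \<in> ?T" using px True by (metis IntI imageI)
      ultimately show ?thesis using T by blast
    next
      case False
      let ?T = "coord c ` (dom_of c \<inter> - K)"
      have T: "open ?T" by (rule open_A_image[OF c open_Compl[OF K(1)]])
      have "smooth_on ?T (\<lambda>x. form_rep A c \<Omega> x vs)"
      proof (rule smooth_on_cong[OF smooth_on_const[of _ 0] T])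
        fix x assume "x \<in> ?T"
        then have "param c x \<in> - K" by (rule A_param(2)[OF c])
        then have "F (param c x) = 0" using K(3) by blast
        then show "0 = form_rep A c \<Omega> x vs" by (simp add: form_rep_def \<Omega>_def)
      qed
      moreover have "x \<in> ?T" using px False K(2) by (metis ComplI IntI imageI subsetD)
      ultimately show ?thesis using T by blast
    qed
  qed
  ultimately show ?thesis using F by blast
qed

text \<open>The weights \<open>\<rho>\<^sub>n = F\<^sub>n \<Prod>\<^bsub>j<n\<^esub> (1 - F\<^sub>j)\<close> telescope: on the open set where \<open>F\<^sub>m = 1\<close> they sum to 1 over
  \<open>n \<le> m\<close>, and the later ones vanish. So a countable cover suffices, and no locally finite
  refinement is needed. (Below, \<open>\<rho>\<close> denotes the product without the factor \<open>F\<^sub>n\<close>.)\<close>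

lemma global_form:
  assumes L: "almost_dirac A L" and reg: "regular L"
  shows "\<exists>\<omega>. differential_form A 2 \<omega> \<and> (\<forall>q. extends_to_form L q 1 (\<omega> q))"
proof -
  obtain k where k: "\<And>q. dim (pr1 L q) = k" using reg by (auto simp: regular_def)
  from local_form_cutoff[OF L k] obtain F N \<Omega> where
    F: "\<And>p. smooth_fun_on UNIV (F p)" and N: "\<And>p. open (N p)" "\<And>p. p \<in> N p" and FN: "\<And>p q. q \<in> N p \<Longrightarrow> F p q = 1"
    and \<Omega>: "\<And>p. smooth_form_on A 2 UNIV (\<Omega> p)" "\<And>p q. alternating_multilinear 2 (\<Omega> p q)"
      "\<And>p q. extends_to_form L q (F p q) (\<Omega> p q)"
    by metis
  \<comment> \<open>Second countability of the manifold enters here, through the Lindelof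
    property.\<close>
  obtain \<F> where \<F>: "\<F> \<subseteq> range N" "countable \<F>" "\<Union>\<F> = \<Union>(range N)"
    using Lindelof[of "range N"] N(1) by blast
  have UN: "\<Union>\<F> = UNIV" using \<F>(3) N(2) by blast
  then have "\<F> \<noteq> {}" by blast
  from range_from_nat_into[OF this \<F>(2)] have rng: "range (from_nat_into \<F>) = \<F>" .
  have "\<exists>p. from_nat_into \<F> n = N p" for n
    using rng \<F>(1) by blast
  then obtain P where P: "\<And>n. from_nat_into \<F> n = N (P n)" by metis
  have cover: "\<exists>n. q \<in> N (P n)" for q
  proof -
    have "q \<in> \<Union>\<F>" by (simp add: UN)
    then obtain B where B: "q \<in> B" "B \<in> \<F>" by (rule UnionE)
    have "B \<in> range (from_nat_into \<F>)" unfolding rng by (rule B(2))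
    then obtain n where "B = from_nat_into \<F> n" by (rule rangeE)
    then show ?thesis using B(1) P by auto
  qed
  define M where "M q = (LEAST n. q \<in> N (P n))" for q
  have M: "q \<in> N (P (M q))" "q \<in> N (P n) \<Longrightarrow> M q \<le> n" for q n
    unfolding M_def by (rule LeastI_ex[OF cover], rule Least_le)
  define \<rho> where "\<rho> n q = (\<Prod>j<n. 1 - F (P j) q)" for n q
  define \<omega> where "\<omega> q vs = (\<Sum>n\<le>M q. \<rho> n q * \<Omega> (P n) q vs)" for q vs
  \<comment> \<open>The product then contains the factor belonging to index \<open>M q\<close>, and
    at \<open>q\<close> that factor is 1 - 1.\<close>
  have \<rho>0: "\<rho> n q = 0" if "M q < n" for n q
    using that FN[OF M(1)] unfolding \<rho>_def by (auto intro!: prod_zero)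
  \<comment> \<open>The number of summands in the definition depends on the point. On a member of
    the cover it may be replaced by a fixed one, and smoothness is that of a finite sum.\<close>
  have \<omega>_eq: "\<omega> q vs = (\<Sum>n\<le>m. \<rho> n q * \<Omega> (P n) q vs)" if "q \<in> N (P m)" for q m vs
    unfolding \<omega>_def using M(2)[OF that] \<rho>0 by (intro sum.mono_neutral_left) auto
  have "alternating_multilinear 2 (\<omega> q)" for q
    unfolding \<omega>_def[abs_def] by (intro alternating_multilinear_2_sum \<Omega>)
  moreover have "smooth_form_on A 2 UNIV \<omega>"
  proof (rule smooth_form_onI, rule smooth_on_local)
    fix c x and vs :: "'b list" assume c: "c \<in> A" and vs: "length vs = 2" and x: "x \<in> coord c ` (dom_of c \<inter> UNIV)"
    have px: "param c x \<in> dom_of c" "coord c (param c x) = x" using A_param[OF c x] by blast+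
    define m where "m = M (param c x)"
    let ?T = "coord c ` (dom_of c \<inter> N (P m))"
    have T: "open ?T" by (rule open_A_image[OF c N(1)])
    have "smooth_on ?T (\<lambda>x. \<rho> n (param c x))" for n
    proof -
      have "smooth_fun_on UNIV (\<rho> n)"
        unfolding \<rho>_def by (intro smooth_fun_on_prod smooth_fun_on_diff smooth_fun_on_const F open_UNIV)
      from smooth_fun_onD[OF this c] show ?thesis by (rule smooth_on_subset) blast
    qed
    moreover have "smooth_on ?T (\<lambda>x. form_rep A c (\<Omega> (P n)) x vs)" for n
      using smooth_form_onD[OF \<Omega>(1) c vs] by (rule smooth_on_subset) blast
    ultimately have "smooth_on ?T (\<lambda>x. \<Sum>n\<le>m. \<rho> n (param c x) * form_rep A c (\<Omega> (P n)) x vs)"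
      by (intro smooth_on_sum smooth_on_mult T)
    then have "smooth_on ?T (\<lambda>x. form_rep A c \<omega> x vs)"
    proof (rule smooth_on_cong[OF _ T])
      show "(\<Sum>n\<le>m. \<rho> n (param c x) * form_rep A c (\<Omega> (P n)) x vs) = form_rep A c \<omega> x vs" if "x \<in> ?T" for x
        unfolding form_rep_def \<omega>_eq[OF A_param(2)[OF c that]] ..
    qed
    moreover have "x \<in> ?T" using px M(1)[of "param c x"] unfolding m_def by (metis IntI imageI)
    ultimately show "\<exists>T. open T \<and> x \<in> T \<and> smooth_on T (\<lambda>x. form_rep A c \<omega> x vs)" using T by blast
  qed
  moreover have "extends_to_form L q 1 (\<omega> q)" for q
    unfolding extends_to_form_def
  proof (intro ballI)
    fix l y assume "l \<in> L q" "y \<in> pr1 L q"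
    then have "\<omega> q [fst l, y] = (\<Sum>n\<le>M q. \<rho> n q * F (P n) q) * snd l y"
      using \<Omega>(3) by (simp add: \<omega>_def extends_to_form_def sum_distrib_right mult.assoc)
    also have "(\<Sum>n\<le>M q. \<rho> n q * F (P n) q) = 1 - \<rho> (Suc (M q)) q"
      unfolding \<rho>_def by (rule sum_telescope_one_minus)
    finally show "\<omega> q [fst l, y] = 1 * snd l y" using \<rho>0[of q "Suc (M q)"] by simp
  qed
  ultimately show ?thesis unfolding differential_form_def by blast
qed

end

section \<open>Closure under the twisted bracket\<close>

text \<open>Elements of \<open>V\<close> over the same anchor have covectors agreeing on the anchor
  space, so subtracting one such covector from \<open>\<xi>\<close> leaves a vector that pairs to 0
  with all of \<open>V\<close>. Adjoining it keeps the space isotropic, and maximality puts it into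
  \<open>V\<close>.\<close>

lemma maximal_isotropic_memI:
  assumes V: "maximal_isotropic V" and x: "x \<in> fst ` V"
    and \<mu>: "\<And>l y. l \<in> V \<Longrightarrow> y \<in> fst ` V \<Longrightarrow> blinfun_apply (snd l) y = \<mu> (fst l) y"
    and \<xi>: "\<And>y. y \<in> fst ` V \<Longrightarrow> blinfun_apply \<xi> y = \<mu> x y"
  shows "(x, \<xi>) \<in> V"
proof -
  have iso: "isotropic V" and max: "\<And>W. isotropic W \<Longrightarrow> V \<subseteq> W \<Longrightarrow> W = V"
    using V by (auto simp: maximal_isotropic_def)
  have subsp: "subspace V" and pair: "\<And>v w. v \<in> V \<Longrightarrow> w \<in> V \<Longrightarrow> pairing v w = 0"
    using iso by (auto simp: isotropic_def)
  obtain l where l: "l \<in> V" "fst l = x" using x by blast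
  \<comment> \<open>Its anchor is 0, so it also pairs to 0 with itself.\<close>
  define z where "z = (0 :: 'a, \<xi> - snd l)"
  have z0: "blinfun_apply (snd z) (fst v) = 0" if "v \<in> V" for v
    using \<xi>[of "fst v"] \<mu>[OF l(1), of "fst v"] that l(2) by (simp add: z_def blinfun.diff_left)
  define W where "W = {v + a *\<^sub>R z | v a. v \<in> V}"
  have "subspace W"
  proof (rule subspaceI)
    have "0 + 0 *\<^sub>R z \<in> W" unfolding W_def using subspace_0[OF subsp] by blast
    then show "0 \<in> W" by simp
  next
    fix v w assume "v \<in> W" "w \<in> W"
    then obtain v' a w' b where "v = v' + a *\<^sub>R z" "w = w' + b *\<^sub>R z" "v' \<in> V" "w' \<in> V"
      unfolding W_def by blast
    then have "v + w = (v' + w') + (a + b) *\<^sub>R z" "v' + w' \<in> V"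
      using subspace_add[OF subsp] by (auto simp: algebra_simps)
    then show "v + w \<in> W" unfolding W_def by blast
  next
    fix c :: real and v assume "v \<in> W"
    then obtain v' a where "v = v' + a *\<^sub>R z" "v' \<in> V"
      unfolding W_def by blast
    then have "c *\<^sub>R v = c *\<^sub>R v' + (c * a) *\<^sub>R z" "c *\<^sub>R v' \<in> V"
      using subspace_scale[OF subsp] by (auto simp: algebra_simps)
    then show "c *\<^sub>R v \<in> W" unfolding W_def by blast
  qed
  moreover have "pairing v w = 0" if vwW: "v \<in> W" "w \<in> W" for v w
  proof -
    obtain v' a w' b where vw: "v = v' + a *\<^sub>R z" "w = w' + b *\<^sub>R z" "v' \<in> V" "w' \<in> V"
      using vwW unfolding W_def by blast
    have "pairing v w = pairing v' w' + b * blinfun_apply (snd z) (fst v') + a * blinfun_apply (snd z) (fst w')"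
      unfolding vw(1,2) by (simp add: pairing_def z_def blinfun.add_left blinfun.scaleR_left)
    then show ?thesis using pair vw z0 by simp
  qed
  ultimately have "isotropic W" by (simp add: isotropic_def)
  moreover have "V \<subseteq> W"
  proof
    fix v assume "v \<in> V"
    then have "v + 0 *\<^sub>R z \<in> W" unfolding W_def by blast
    then show "v \<in> W" by simp
  qed
  ultimately have "W = V" by (rule max)
  moreover have "l + 1 *\<^sub>R z \<in> W" unfolding W_def using l(1) by blast
  moreover have "l + 1 *\<^sub>R z = (x, \<xi>)" using l(2) by (simp add: z_def prod_eq_iff)
  ultimately show ?thesis by simp
qed

context finite_dim_inner
begin

text \<open>Cartan's formula \<open>\<L>\<^sub>X \<iota>\<^sub>Y W - \<iota>\<^sub>Y d \<iota>\<^sub>X W = \<iota>\<^bsub>[X,Y]\<^esub> W + \<iota>\<^sub>Y \<iota>\<^sub>X dW\<close> (for \<open>-W\<close>), but the covectors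
  \<open>a\<close> and \<open>b\<close> agree with the contractions of the 2-form only on the distribution; hence the
  evaluation on a vector field \<open>Z\<close> of the distribution and the hypotheses on brackets.\<close>

lemma courant_bracket_identity:
  fixes X Y Z :: "'b \<Rightarrow> 'b" and a b :: "'b \<Rightarrow> 'b \<Rightarrow> real" and W :: "'b \<Rightarrow> 'b \<Rightarrow> 'b \<Rightarrow> real"
  assumes S: "open S" "x \<in> S"
    and d: "X differentiable at x" "Y differentiable at x" "Z differentiable at x"
      "\<And>v. (\<lambda>y. a y v) differentiable at x" "\<And>v. (\<lambda>y. b y v) differentiable at x"
      "\<And>u v. (\<lambda>y. W y u v) differentiable at x"
    and lin: "\<And>y. y \<in> S \<Longrightarrow> linear (a y)" "\<And>y. y \<in> S \<Longrightarrow> linear (b y)"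
      "\<And>y v. y \<in> S \<Longrightarrow> linear (\<lambda>u. W y u v)" "\<And>y u. y \<in> S \<Longrightarrow> linear (W y u)"
    and skew: "\<And>u v. W x u v = - W x v u"
    and bZ: "\<And>y. y \<in> S \<Longrightarrow> W y (Y y) (Z y) = - b y (Z y)"
    and aZ: "\<And>y. y \<in> S \<Longrightarrow> W y (X y) (Z y) = - a y (Z y)"
    and aY: "\<And>y. y \<in> S \<Longrightarrow> W y (X y) (Y y) = - a y (Y y)"
    and bXZ: "W x (Y x) (ebracket X Z x) = - b x (ebracket X Z x)"
    and aYZ: "W x (X x) (ebracket Y Z x) = - a x (ebracket Y Z x)"
  shows "elie X b x (Z x) - ed1 a x (Y x) (Z x) + ed2 W x (X x) (Y x) (Z x) = - W x (ebracket X Y x) (Z x)"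
proof -
  \<comment> \<open>The relation between \<open>W\<close> and a covector field along two moving
    fields, differentiated in direction \<open>h\<close> by the product rule on both sides.\<close>
  have deriv: "fd (\<lambda>y. W y (f x) (g x)) x h + W x (fd f x h) (g x) + W x (f x) (fd g x h)
      = - (fd (\<lambda>y. k y (g x)) x h + k x (fd g x h))"
    if f: "f differentiable at x" and g: "g differentiable at x" and dk: "\<And>v. (\<lambda>y. k y v) differentiable at x"
      and k: "\<And>y. y \<in> S \<Longrightarrow> linear (k y)" and eq: "\<And>y. y \<in> S \<Longrightarrow> W y (f y) (g y) = - k y (g y)"
    for f g :: "'b \<Rightarrow> 'b" and k :: "'b \<Rightarrow> 'b \<Rightarrow> real" and h
  proof -
    have "fd (\<lambda>y. W y (f y) (g y)) x = fd (\<lambda>y. - k y (g y)) x"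
      by (rule fd_transform[OF differentiable_eval2[where W = W, OF S lin(3,4) d(6) f g] S eq])
    then have "fd (\<lambda>y. W y (f y) (g y)) x h = fd (\<lambda>y. - k y (g y)) x h" by simp
    also have "\<dots> = - fd (\<lambda>y. k y (g y)) x h"
      by (rule fd_uminus[OF differentiable_eval[where \<beta> = k, OF S k dk g]])
    also have "fd (\<lambda>y. k y (g y)) x h = fd (\<lambda>y. k y (g x)) x h + k x (fd g x h)"
      by (rule fd_eval[where \<beta> = k, OF S k dk g])
    also have "fd (\<lambda>y. W y (f y) (g y)) x h
        = fd (\<lambda>y. W y (f x) (g x)) x h + W x (fd f x h) (g x) + W x (f x) (fd g x h)"
      by (rule fd_eval2[where W = W, OF S lin(3,4) d(6) f g])
    finally show ?thesis .
  qed
  \<comment> \<open>The relations are differentiated along \<open>X\<close>, \<open>Y\<close> and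
    \<open>Z\<close> in turn; the first terms are precisely the three derivatives of
    \<open>W\<close> that make up \<open>ed2\<close>.\<close>
  have 1: "fd (\<lambda>y. W y (Y x) (Z x)) x (X x) + W x (fd Y x (X x)) (Z x) + W x (Y x) (fd Z x (X x))
      = - (fd (\<lambda>y. b y (Z x)) x (X x) + b x (fd Z x (X x)))"
    by (rule deriv[OF d(2,3,5) lin(2) bZ])
  have 2: "fd (\<lambda>y. W y (X x) (Z x)) x (Y x) + W x (fd X x (Y x)) (Z x) + W x (X x) (fd Z x (Y x))
      = - (fd (\<lambda>y. a y (Z x)) x (Y x) + a x (fd Z x (Y x)))"
    by (rule deriv[OF d(1,3,4) lin(1) aZ])
  have 3: "fd (\<lambda>y. W y (X x) (Y x)) x (Z x) + W x (fd X x (Z x)) (Y x) + W x (X x) (fd Y x (Z x))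
      = - (fd (\<lambda>y. a y (Y x)) x (Z x) + a x (fd Y x (Z x)))"
    by (rule deriv[OF d(1,2,4) lin(1) aY])
  note l = linear_diff[OF lin(1)[OF S(2)]] linear_diff[OF lin(2)[OF S(2)]]
    linear_diff[OF lin(3)[OF S(2)]] linear_diff[OF lin(4)[OF S(2)]]
  \<comment> \<open>Derivatives of \<open>Z\<close> appear in the first two equations but not in the
    claim. The bracket hypotheses trade them for derivatives of \<open>X\<close> and
    \<open>Y\<close> along \<open>Z\<close>.\<close>
  have 4: "W x (Y x) (fd Z x (X x)) - W x (Y x) (fd X x (Z x)) = - (b x (fd Z x (X x)) - b x (fd X x (Z x)))"
    using bXZ unfolding ebracket_def l .
  have 5: "W x (X x) (fd Z x (Y x)) - W x (X x) (fd Y x (Z x)) = - (a x (fd Z x (Y x)) - a x (fd Y x (Z x)))"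
    using aYZ unfolding ebracket_def l .
  show ?thesis
    using 1 2 3 4 5 skew[of "fd X x (Z x)" "Y x"]
    unfolding elie_def ed1_def ed2_def ebracket_def[of X Y] l by linarith
qed

end

context manifold
begin

text \<open>Stated over an open set because it will be applied to a field that prolongs a single
  vector and exists only near \<open>p\<close>.\<close>

lemma lie_bracket_mem_distribution:
  assumes D: "integrable_distribution A D" and U: "open U" "p \<in> U"
    and X: "smooth_vec_on A U X" "\<And>q. q \<in> U \<Longrightarrow> X q \<in> D q"
    and Y: "smooth_vec_on A U Y" "\<And>q. q \<in> U \<Longrightarrow> Y q \<in> D q"
  shows "lie_bracket A X Y p \<in> D p"
proof -
  obtain N where "p \<in> N" and int: "integral_manifold A D N"
    using D unfolding integrable_distribution_def by blast
  obtain c W where c: "compatible_chart A c" "p \<in> dom_of c" and W: "subspace W"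
    and N: "coord c ` (dom_of c \<inter> N) = coord c ` dom_of c \<inter> W"
    and DW: "\<forall>q\<in>dom_of c \<inter> N. dchart A c q ` D q = W"
    using bspec[OF int[unfolded integral_manifold_def] \<open>p \<in> N\<close>] by (elim exE conjE)
  note ch = compatible_is_chart[OF c(1)]
  let ?S = "coord c ` (dom_of c \<inter> U)" and ?x = "coord c p"
  have S: "open ?S" "?x \<in> ?S" using open_coord_image[OF ch U(1)] c(2) U(2) by auto
  have "?x \<in> coord c ` (dom_of c \<inter> N)" using c(2) \<open>p \<in> N\<close> by blast
  then have xW: "?x \<in> W" unfolding N by blast
  have deriv: "fd (vec_rep A c Z) ?x w \<in> W" "vec_rep A c Z ?x \<in> W"
    if Z: "smooth_vec_on A U Z" "\<And>q. q \<in> U \<Longrightarrow> Z q \<in> D q" and w: "w \<in> W" for Z w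
  proof -
    \<comment> \<open>A point of the chart image lying in \<open>W\<close> comes from a point of the
      integral manifold, where the distribution is mapped onto \<open>W\<close>.\<close>
    have ZW: "vec_rep A c Z y \<in> W" if y: "y \<in> ?S" "y \<in> W" for y
    proof -
      obtain q where q: "q \<in> dom_of c" "q \<in> U" "y = coord c q" using y(1) by blast
      have "y \<in> coord c ` (dom_of c \<inter> N)" unfolding N using q(1,3) y(2) by blast
      then obtain q' where q': "q' \<in> dom_of c" "q' \<in> N" "y = coord c q'" by blast
      have "q = q'" using is_chartD(3)[OF ch q(1)] is_chartD(3)[OF ch q'(1)] q(3) q'(3) by simp
      then have "dchart A c q ` D q = W" using DW q(1) q'(2) by simp
      then have "dchart A c q (Z q) \<in> W" using Z(2)[OF q(2)] by blast
      then show ?thesis unfolding vec_rep_def q(3) is_chartD(3)[OF ch q(1)] .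
    qed
    then show "vec_rep A c Z ?x \<in> W" using S(2) xW .
    have "vec_rep A c Z differentiable at ?x"
      using smooth_vec_on_compatible[OF U(1) Z(1) c(1)] S(2) by (rule smooth_on_imp_differentiable)
    then show "fd (vec_rep A c Z) ?x w \<in> W"
      by (rule subspace_derivative_mem[OF W S xW _ ZW w])
  qed
  have "0 \<in> W" using W by (rule subspace_0)
  have "ebracket (vec_rep A c X) (vec_rep A c Y) ?x \<in> W"
    unfolding ebracket_def
    by (intro subspace_diff[OF W] deriv(1) X Y deriv(2)[OF X \<open>0 \<in> W\<close>] deriv(2)[OF Y \<open>0 \<in> W\<close>])
  then have "dchart A c p (lie_bracket A X Y p) \<in> dchart A c p ` D p"
    unfolding dchart_lie_bracket[OF U X(1) Y(1) c] using DW c(2) \<open>p \<in> N\<close> by simp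
  then obtain d where "d \<in> D p" "dchart A c p (lie_bracket A X Y p) = dchart A c p d" by blast
  then show ?thesis using dparam_dchart(1)[OF c] by metis
qed

text \<open>The coefficients of \<open>l\<close> in a local frame are kept constant.\<close>

lemma local_section_through:
  assumes L: "almost_dirac A L" and l: "l \<in> L p"
  obtains U s where "open U" "p \<in> U" "smooth_section_on A U s" "\<And>q. q \<in> U \<Longrightarrow> s q \<in> L q" "s p = l"
proof -
  obtain r U e where U: "open U" "p \<in> U" and e: "\<And>i. i < (r::nat) \<Longrightarrow> smooth_section_on A U (e i)"
    and fr: "\<And>q. q \<in> U \<Longrightarrow> inj_on (\<lambda>i. e i q) {..<r} \<and> span ((\<lambda>i. e i q) ` {..<r}) = L q"
    using L unfolding almost_dirac_def subbundle_def by metis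
  have "l \<in> span ((\<lambda>i. e i p) ` {..<r})" using fr[OF U(2)] l by simp
  with fr[OF U(2)] obtain u where u: "l = (\<Sum>i<r. u i *\<^sub>R e i p)"
    using span_image_finite_explicit[of "{..<r}" "\<lambda>i. e i p" l] by blast
  have zero: "smooth_section_on A U (\<lambda>q. 0)"
  proof (rule smooth_section_onI)
    fix c v assume c: "c \<in> A"
    let ?S = "coord c ` (dom_of c \<inter> U)"
    show "smooth_on ?S (vec_rep A c (fst \<circ> (\<lambda>q. 0)))"
    proof (rule smooth_on_cong[OF smooth_on_const[of _ 0] open_A_image[OF c U(1)]])
      fix x assume "x \<in> ?S"
      from linear_0[OF linear_dchart[OF A_compatible[OF c] A_param(1)[OF c this]]]
      show "0 = vec_rep A c (fst \<circ> (\<lambda>q. 0)) x" by (simp add: vec_rep_def)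
    qed
    show "smooth_on ?S (\<lambda>x. rep1 c (form_of_covec (snd \<circ> (\<lambda>q. 0))) x v)"
      by (simp add: rep1_covec smooth_on_const)
  qed
  \<comment> \<open>Written as a difference to fit \<open>smooth_section_on_diff_scale\<close>,
    whence the doubled sign.\<close>
  define s where "s q = 0 - (\<Sum>i<r. (- u i) *\<^sub>R e i q)" for q
  have "smooth_section_on A U s"
    unfolding s_def using e
    by (intro smooth_section_on_diff_scale U zero smooth_fun_on_const) simp
  moreover have s: "s q = (\<Sum>i<r. u i *\<^sub>R e i q)" for q by (simp add: s_def sum_negf)
  moreover have "s q \<in> L q" if "q \<in> U" for q
  proof -
    have "(\<Sum>i<r. u i *\<^sub>R e i q) \<in> span ((\<lambda>i. e i q) ` {..<r})"
      by (intro span_sum span_scale span_base) auto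
    then show ?thesis using fr[OF that] s by simp
  qed
  ultimately show thesis using U u that by metis
qed

text \<open>Involutivity is used twice: it puts the anchor of the bracket into the distribution, and
  it supplies the bracket hypotheses of \<open>courant_bracket_identity\<close>. That identity then
  determines the covector on the distribution, which is all that maximality asks for.\<close>

lemma courant_bracket_mem:
  assumes L: "almost_dirac A L" and D: "integrable_distribution A (pr1 L)"
    and \<omega>: "differential_form A 2 \<omega>" and ext: "\<And>q. extends_to_form L q (- 1) (\<omega> q)"
    and s: "s \<in> sections A L" and t: "t \<in> sections A L"
  shows "courant_bracket A (ext_deriv A \<omega>) s t p \<in> L p"
proof -
  let ?\<phi> = "ext_deriv A \<omega>"
  have \<phi>: "differential_form A 3 ?\<phi>" by (rule differential_form_ext_deriv_2[OF \<omega>])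
  have sm: "smooth_section_on A UNIV s" "smooth_section_on A UNIV t"
    and sL: "\<And>q. s q \<in> L q" "\<And>q. t q \<in> L q"
    using s t by (auto simp: sections_def)
  have ext': "\<omega> q [fst l, y] = - blinfun_apply (snd l) y" if "l \<in> L q" "y \<in> pr1 L q" for l q y
    using ext[of q] that by (simp add: extends_to_form_def)
  have pr: "fst l \<in> pr1 L q" if "l \<in> L q" for l q using that by (auto simp: pr1_def)
  have vec: "smooth_vec_on A UNIV (fst \<circ> s)" "smooth_vec_on A UNIV (fst \<circ> t)"
    using sm by (simp_all add: smooth_section_on_def)
  have lie: "lie_bracket A (fst \<circ> s) (fst \<circ> t) p \<in> pr1 L p"
    by (rule lie_bracket_mem_distribution[OF D open_UNIV UNIV_I vec(1) _ vec(2)]) (simp_all add: pr sL)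
  have alt: "alternating_multilinear 2 (\<omega> q)" for q using \<omega> by (simp add: differential_form_def)
  have key: "bracket_covec ?\<phi> s t p z = - \<omega> p [lie_bracket A (fst \<circ> s) (fst \<circ> t) p, z]" if z: "z \<in> pr1 L p" for z
  proof -
    obtain l where l: "l \<in> L p" "z = fst l" using z by (auto simp: pr1_def)
    obtain U r where U: "open U" "p \<in> U" and r: "smooth_section_on A U r" "\<And>q. q \<in> U \<Longrightarrow> r q \<in> L q" "r p = l"
      using local_section_through[OF L l(1)] by blast
    define c where "c = chart_at A p"
    have c: "c \<in> A" "p \<in> dom_of c" unfolding c_def by (rule chart_at)+
    define x where "x = coord c p"
    define S where "S = coord c ` (dom_of c \<inter> U)"
    have S: "open S" "x \<in> S" unfolding S_def x_def using open_A_image[OF c(1) U(1)] c(2) U(2) by auto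
    have Sdom: "y \<in> coord c ` dom_of c" if "y \<in> S" for y using that unfolding S_def by blast
    have secU: "smooth_section_on A U s" "smooth_section_on A U t"
      using sm by (auto intro: smooth_section_on_subset)
    have vecU: "smooth_vec_on A U (fst \<circ> s)" "smooth_vec_on A U (fst \<circ> t)" "smooth_vec_on A U (fst \<circ> r)"
      using secU r(1) by (simp_all add: smooth_section_on_def)
    have dv: "vec_rep A c (fst \<circ> k) differentiable at x"
      and dc: "(\<lambda>y. rep1 c (form_of_covec (snd \<circ> k)) y v) differentiable at x"
      if "smooth_section_on A U k" for k v
      using smooth_section_onD[OF that c(1)] S(2) unfolding S_def
      by (blast intro: smooth_on_imp_differentiable)+
    have dW: "(\<lambda>y. rep2 c \<omega> y u v) differentiable at x" for u v
      using smooth_rep2[OF \<omega> c(1)] Sdom[OF S(2)] by (rule smooth_on_imp_differentiable)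
    have ev: "rep2 c \<omega> y (vec_rep A c (fst \<circ> k) y) (vec_rep A c (fst \<circ> m) y)
        = - rep1 c (form_of_covec (snd \<circ> k)) y (vec_rep A c (fst \<circ> m) y)"
      if y: "y \<in> S" and k: "\<And>q. q \<in> U \<Longrightarrow> k q \<in> L q" and m: "\<And>q. q \<in> U \<Longrightarrow> m q \<in> L q" for y k m
    proof -
      have y': "y \<in> coord c ` (dom_of c \<inter> U)" using y unfolding S_def .
      have q: "param c y \<in> U" by (rule A_param(2)[OF c(1) y'])
      show ?thesis
        using ext'[OF k[OF q] pr[OF m[OF q]]]
        by (simp add: form_rep_def form_of_covec_def dparam_vec_rep[OF c(1) y'])
    qed
    \<comment> \<open>The relation between form and covector is available only for vectors of the
      distribution; the bracket of two of its fields is such a vector.\<close>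
    have brx: "rep2 c \<omega> x (vec_rep A c (fst \<circ> k) x) (ebracket (vec_rep A c (fst \<circ> m)) (vec_rep A c (fst \<circ> r)) x)
        = - rep1 c (form_of_covec (snd \<circ> k)) x (ebracket (vec_rep A c (fst \<circ> m)) (vec_rep A c (fst \<circ> r)) x)"
      if k: "k p \<in> L p" and m: "smooth_vec_on A U (fst \<circ> m)" "\<And>q. q \<in> U \<Longrightarrow> m q \<in> L q" for k m
    proof -
      have "lie_bracket A (fst \<circ> m) (fst \<circ> r) p \<in> pr1 L p"
        by (rule lie_bracket_mem_distribution[OF D U m(1) _ vecU(3)]) (simp_all add: pr m(2) r(2))
      from ext'[OF k this] show ?thesis
        unfolding c_def x_def lie_bracket_chart_at[symmetric] vec_rep_chart_at form_rep_chart_at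
        by (simp add: form_of_covec_def)
    qed
    have z': "z = vec_rep A c (fst \<circ> r) x"
      unfolding c_def x_def vec_rep_chart_at by (simp add: r(3) l(2))
    have "bracket_covec ?\<phi> s t p z = bracket_covec ?\<phi> s t p (dparam A c p z)"
      unfolding c_def dparam_chart_at ..
    also have "\<dots> = elie (vec_rep A c (fst \<circ> s)) (rep1 c (form_of_covec (snd \<circ> t))) x z
      - ed1 (rep1 c (form_of_covec (snd \<circ> s))) x (vec_rep A c (fst \<circ> t) x) z
      + ed2 (rep2 c \<omega>) x (vec_rep A c (fst \<circ> s) x) (vec_rep A c (fst \<circ> t) x) z"
      unfolding bracket_covec_rep[OF sm c] x_def[symmetric] form_rep_ext_deriv_2[OF c(1) Sdom[OF S(2)] \<omega>] ..
    also have "\<dots> = - rep2 c \<omega> x (ebracket (vec_rep A c (fst \<circ> s)) (vec_rep A c (fst \<circ> t)) x) z"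
      unfolding z'
    proof (rule courant_bracket_identity[OF S])
      fix y u v assume "y \<in> S"
      then have y: "y \<in> coord c ` dom_of c" by (rule Sdom)
      show "linear (rep1 c (form_of_covec (snd \<circ> s)) y)" "linear (rep1 c (form_of_covec (snd \<circ> t)) y)"
        by (rule linear_rep1[OF linear_form_of_covec c(1) y])+
      show "linear (\<lambda>u. rep2 c \<omega> y u v)" "linear (rep2 c \<omega> y u)"
        by (rule rep2_linear_alt[OF alt c(1) y])+
    next
      show "rep2 c \<omega> x u v = - rep2 c \<omega> x v u" for u v
        by (rule rep2_linear_alt(3)[OF alt c(1) Sdom[OF S(2)]])
      show "vec_rep A c (fst \<circ> s) differentiable at x" "vec_rep A c (fst \<circ> t) differentiable at x"
        "vec_rep A c (fst \<circ> r) differentiable at x"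
        by (rule dv secU r(1))+
      show "(\<lambda>y. rep1 c (form_of_covec (snd \<circ> s)) y v) differentiable at x"
        "(\<lambda>y. rep1 c (form_of_covec (snd \<circ> t)) y v) differentiable at x" for v
        by (rule dc secU)+
      show "(\<lambda>y. rep2 c \<omega> y u v) differentiable at x" for u v by (rule dW)
      show "rep2 c \<omega> y (vec_rep A c (fst \<circ> t) y) (vec_rep A c (fst \<circ> r) y)
          = - rep1 c (form_of_covec (snd \<circ> t)) y (vec_rep A c (fst \<circ> r) y)"
        "rep2 c \<omega> y (vec_rep A c (fst \<circ> s) y) (vec_rep A c (fst \<circ> r) y)
          = - rep1 c (form_of_covec (snd \<circ> s)) y (vec_rep A c (fst \<circ> r) y)"
        "rep2 c \<omega> y (vec_rep A c (fst \<circ> s) y) (vec_rep A c (fst \<circ> t) y)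
          = - rep1 c (form_of_covec (snd \<circ> s)) y (vec_rep A c (fst \<circ> t) y)" if "y \<in> S" for y
        by (rule ev[OF that sL(2) r(2)], assumption) (rule ev[OF that sL(1) r(2)], assumption, rule ev[OF that sL])
      show "rep2 c \<omega> x (vec_rep A c (fst \<circ> t) x) (ebracket (vec_rep A c (fst \<circ> s)) (vec_rep A c (fst \<circ> r)) x)
          = - rep1 c (form_of_covec (snd \<circ> t)) x (ebracket (vec_rep A c (fst \<circ> s)) (vec_rep A c (fst \<circ> r)) x)"
        by (rule brx[where k = t and m = s, OF sL(2) vecU(1) sL(1)])
      show "rep2 c \<omega> x (vec_rep A c (fst \<circ> s) x) (ebracket (vec_rep A c (fst \<circ> t)) (vec_rep A c (fst \<circ> r)) x)
          = - rep1 c (form_of_covec (snd \<circ> s)) x (ebracket (vec_rep A c (fst \<circ> t)) (vec_rep A c (fst \<circ> r)) x)"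
        by (rule brx[where k = s and m = t, OF sL(1) vecU(2) sL(2)])
    qed
    also have "\<dots> = - \<omega> p [lie_bracket A (fst \<circ> s) (fst \<circ> t) p, z]"
      unfolding c_def x_def lie_bracket_chart_at[symmetric] form_rep_chart_at ..
    finally show ?thesis .
  qed
  have "(lie_bracket A (fst \<circ> s) (fst \<circ> t) p, Blinfun (bracket_covec ?\<phi> s t p)) \<in> L p"
  \<comment> \<open>The comparison function is minus the form, in accordance with the factor -1 in
    \<open>ext\<close>.\<close>
  proof (rule maximal_isotropic_memI[where \<mu> = "\<lambda>u v. - \<omega> p [u, v]"])
    show "maximal_isotropic (L p)" using L by (simp add: almost_dirac_def)
    show "lie_bracket A (fst \<circ> s) (fst \<circ> t) p \<in> fst ` L p" using lie by (simp add: pr1_def)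
    show "blinfun_apply (snd l) y = - \<omega> p [fst l, y]" if "l \<in> L p" "y \<in> fst ` L p" for l y
      using ext'[of l p y] that by (simp add: pr1_def)
    show "blinfun_apply (Blinfun (bracket_covec ?\<phi> s t p)) y = - \<omega> p [lie_bracket A (fst \<circ> s) (fst \<circ> t) p, y]"
      if "y \<in> fst ` L p" for y
      unfolding Blinfun_bracket_covec[OF sm \<phi>] using that by (intro key) (simp add: pr1_def)
  qed
  then show ?thesis by (simp add: courant_bracket_eq)
qed

lemma differential_form_uminus_2:
  assumes "differential_form A 2 \<omega>"
  shows "differential_form A 2 (\<lambda>q vs. - \<omega> q vs)"
proof -
  have "alternating_multilinear 2 (\<lambda>vs. - \<omega> q vs)" for q
    using alternating_multilinear_2_sum[of "{()}" "\<lambda>_. \<omega> q" "\<lambda>_. - 1"] assms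
    by (simp add: differential_form_def)
  moreover have "smooth_form_on A 2 UNIV (\<lambda>q vs. - \<omega> q vs)"
  proof (rule smooth_form_onI)
    fix c and vs :: "'b list" assume "c \<in> A" "length vs = 2"
    then have "smooth_on (coord c ` (dom_of c \<inter> UNIV)) (\<lambda>x. - form_rep A c \<omega> x vs)"
      using assms unfolding differential_form_def
      by (intro smooth_on_minus smooth_form_onD open_A_image open_UNIV) auto
    then show "smooth_on (coord c ` (dom_of c \<inter> UNIV)) (\<lambda>x. form_rep A c (\<lambda>q vs. - \<omega> q vs) x vs)"
      by (simp add: form_rep_def)
  qed
  ultimately show ?thesis by (simp add: differential_form_def)
qed

lemma exists_twisted_dirac:
  assumes L: "almost_dirac A L" "regular L" "integrable_distribution A (pr1 L)"
  shows "\<exists>\<phi>. exact_form A 3 \<phi> \<and> twisted_dirac A \<phi> L"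
proof -
  obtain \<omega> where \<omega>: "differential_form A 2 \<omega>" and ext: "\<And>q. extends_to_form L q 1 (\<omega> q)"
    using global_form[OF L(1,2)] by blast
  \<comment> \<open>The sign is moved into the 2-form, so that the twist is an exterior derivative
    as it stands and exactness is immediate.\<close>
  define \<omega>' where "\<omega>' q vs = - \<omega> q vs" for q vs
  have \<omega>': "differential_form A 2 \<omega>'"
    unfolding \<omega>'_def by (rule differential_form_uminus_2[OF \<omega>])
  have ext': "extends_to_form L q (- 1) (\<omega>' q)" for q
    using ext[of q] by (simp add: extends_to_form_def \<omega>'_def)
  have \<phi>: "differential_form A 3 (ext_deriv A \<omega>')"
    by (rule differential_form_ext_deriv_2[OF \<omega>'])
  have "exact_form A 3 (ext_deriv A \<omega>')"
    unfolding exact_form_def using \<phi> \<omega>' by (intro conjI exI[of _ 2] exI[of _ \<omega>']) simp_all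
  moreover have "courant_bracket A (ext_deriv A \<omega>') s t \<in> sections A L" if "s \<in> sections A L" "t \<in> sections A L" for s t
  proof -
    have "smooth_section_on A UNIV s" "smooth_section_on A UNIV t" using that by (simp_all add: sections_def)
    from smooth_courant_bracket[OF this \<phi>] courant_bracket_mem[OF L(1,3) \<omega>' ext' that]
    show ?thesis by (simp add: sections_def)
  qed
  ultimately show ?thesis
    using closed_form_ext_deriv_2[OF \<omega>'] L(1) unfolding twisted_dirac_def by blast
qed

end

theorem theorem3p5:
  fixes A :: "('a::{t2_space,second_countable_topology}, 'b::real_inner) chart set"
    and L :: "'a \<Rightarrow> 'b gen_vec set"
  assumes "smooth_manifold A"
    and "almost_dirac A L"
    and "regular L"
    and "integrable_distribution A (pr1 L)"
  shows "\<exists>\<phi>. exact_form A 3 \<phi> \<and> twisted_dirac A \<phi> L"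
proof -
  obtain B :: "'b set" where "finite B" "span B = UNIV"
    using assms(1) unfolding smooth_manifold_def by blast
  then obtain E :: "'b set" where "finite_dim_inner E"
    using finite_dim_inner_exists by blast
  then interpret manifold E A
    using assms(1) by (simp add: manifold_def manifold_axioms_def)
  show ?thesis
    using assms(2-4) by (rule exists_twisted_dirac)
qed

end
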